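(* Let $q\equiv 3\pmod 4$ be a prime power. There is an absolute constant $C$ such that there exist infinitely many $g\in\mathbb{F}_q[t]$ for which the Morgenstern Ramanujan graph $X^{q,g}$ is non-bipartite and \[\mathrm{diam}(X^{q,g})\ge \tfrac{4}{3}\log_q|X^{q,g}|-C,\] and infinitely many $g\in\mathbb{F}_q[t]$ for which $X^{q,g}$ is bipartite and satisfies the same inequality.
   Context: For $q$ odd and $g\in\mathbb{F}_q[t]$ with $\gcd(g,t(t-1))=1$, $X^{q,g}$ denotes the $(q+1)$-regular Ramanujan graph constructed by Morgenstern (1994) from the quaternion algebra over $\mathbb{F}_q(t)$ with reduced norm form $x_1^2-\nu x_2^2-(t-1)(x_3^2-\nu x_4^2)$, where $\nu\in\mathbb{F}_q$ is a non-square (here, since $q\equiv 3\bmod 4$, one takes $\nu=-1$): it is a Cayley graph of $\mathrm{PGL}_2(\mathbb{F}_q[t]/(g))$ or $\mathrm{PSL}_2(\mathbb{F}_q[t]/(g))$ with respect to $q+1$ generators obtained by reducing modulo $g$ the norm-$t$ elements of the corresponding integral quaternion order. *)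

theory Defs
  imports
    "HOL-Algebra.Algebra"
    "HOL-Number_Theory.Prime_Powers"
    "HOL-Library.Extended_Real"
begin

section \<open>Graphs\<close>

text \<open>A graph is a pair of a vertex set and a set of ordered adjacent pairs.  The distance is
  \<open>\<infinity>\<close> between vertices that no walk connects.\<close>

type_synonym 'v graph = "'v set \<times> ('v \<times> 'v) set"

definition graph_dist :: "('v \<times> 'v) set \<Rightarrow> 'v \<Rightarrow> 'v \<Rightarrow> enat" where
  "graph_dist E x y = (INF n \<in> {n. (x, y) \<in> E ^^ n}. enat n)"

definition graph_diam :: "'v graph \<Rightarrow> enat" where
  "graph_diam \<Gamma> = (SUP x \<in> fst \<Gamma>. SUP y \<in> fst \<Gamma>. graph_dist (snd \<Gamma>) x y)"

definition bipartite :: "'v graph \<Rightarrow> bool" where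
  "bipartite \<Gamma> \<longleftrightarrow>
     (\<exists>A B. A \<union> B = fst \<Gamma> \<and> A \<inter> B = {} \<and> snd \<Gamma> \<subseteq> (A \<times> B) \<union> (B \<times> A))"

definition cayley_graph :: "('v, 'm) monoid_scheme \<Rightarrow> 'v set \<Rightarrow> 'v set \<Rightarrow> 'v graph" where
  "cayley_graph G H S = (H, {(x, x \<otimes>\<^bsub>G\<^esub> s) | x s. x \<in> H \<and> s \<in> S})"


section \<open>Two by two matrices over a commutative ring\<close>

text \<open>\<open>(a, b, c, d)\<close> is the matrix with rows \<open>(a, b)\<close> and \<open>(c, d)\<close>.\<close>

type_synonym 'a mat2 = "'a \<times> 'a \<times> 'a \<times> 'a"

context
  fixes R :: "('a, 'm) ring_scheme" (structure)
begin

fun mat2_mult :: "'a mat2 \<Rightarrow> 'a mat2 \<Rightarrow> 'a mat2" where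
  "mat2_mult (a, b, c, d) (a', b', c', d') =
     (a \<otimes> a' \<oplus> b \<otimes> c', a \<otimes> b' \<oplus> b \<otimes> d', c \<otimes> a' \<oplus> d \<otimes> c', c \<otimes> b' \<oplus> d \<otimes> d')"

fun mat2_det :: "'a mat2 \<Rightarrow> 'a" where
  "mat2_det (a, b, c, d) = a \<otimes> d \<ominus> b \<otimes> c"

definition GL2 :: "'a mat2 monoid" where
  "GL2 = \<lparr> carrier = {M \<in> carrier R \<times> carrier R \<times> carrier R \<times> carrier R. mat2_det M \<in> Units R},
           monoid.mult = mat2_mult, one = (\<one>, \<zero>, \<zero>, \<one>) \<rparr>"

definition scalars2 :: "'a mat2 set" where
  "scalars2 = {(u, \<zero>, \<zero>, u) | u. u \<in> Units R}"

definition PGL2 :: "'a mat2 set monoid" where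
  "PGL2 = GL2 Mod scalars2"

definition PGL2_class :: "'a mat2 \<Rightarrow> 'a mat2 set" where
  "PGL2_class M = scalars2 #>\<^bsub>GL2\<^esub> M"

text \<open>\<open>PSL2\<close> is the image of \<open>SL2\<close> in \<open>PGL2\<close>.\<close>

definition PSL2 :: "'a mat2 set set" where
  "PSL2 = PGL2_class ` {M \<in> carrier GL2. mat2_det M = \<one>}"

text \<open>The subgroup of \<open>PGL2\<close> of the classes whose determinant is a square, or \<open>\<tau>\<close> times a square,
  of units.  If \<open>\<tau>\<close> is a square this is \<open>PSL2\<close>; if \<open>R\<close> is a finite field and \<open>\<tau>\<close> a
  non-square, it is all of \<open>PGL2\<close> (both proved below).\<close>

definition PSL2_with_det :: "'a \<Rightarrow> 'a mat2 set set" where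
  "PSL2_with_det \<tau> =
     {PGL2_class M | M. M \<in> carrier GL2 \<and>
        (\<exists>u \<in> Units R. mat2_det M = u \<otimes> u \<or> mat2_det M = \<tau> \<otimes> (u \<otimes> u))}"

end

context cring
begin

lemma mat2_det_scale:
  assumes "u \<in> carrier R" "M \<in> carrier R \<times> carrier R \<times> carrier R \<times> carrier R"
  shows "mat2_det R (mat2_mult R (u, \<zero>, \<zero>, u) M) = u \<otimes> u \<otimes> mat2_det R M"
  using assms by (cases M) (simp, algebra)

lemma PGL2_class_scale:
  assumes u: "u \<in> Units R" and M: "M \<in> carrier (GL2 R)"
  shows "PGL2_class R (mat2_mult R (u, \<zero>, \<zero>, u) M) = PGL2_class R M"
    and "mat2_mult R (u, \<zero>, \<zero>, u) M \<in> carrier (GL2 R)"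
proof -
  obtain a b c d where M': "M = (a, b, c, d)" by (cases M)
  have M4: "a \<in> carrier R" "b \<in> carrier R" "c \<in> carrier R" "d \<in> carrier R"
    and dU: "mat2_det R M \<in> Units R"
    using M by (auto simp: GL2_def M')
  have uc: "u \<in> carrier R" using u by auto
  have eq: "PGL2_class R N = {mat2_mult R (v, \<zero>, \<zero>, v) N | v. v \<in> Units R}" for N
    by (auto simp: PGL2_class_def r_coset_def scalars2_def GL2_def)
  have assoc: "mat2_mult R (v, \<zero>, \<zero>, v) (mat2_mult R (u, \<zero>, \<zero>, u) M)
      = mat2_mult R (v \<otimes> u, \<zero>, \<zero>, v \<otimes> u) M" if "v \<in> Units R" for v
    using that M4 uc Units_closed[OF that] by (simp add: M' m_assoc)
  show "PGL2_class R (mat2_mult R (u, \<zero>, \<zero>, u) M) = PGL2_class R M"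
    unfolding eq
  proof (intro equalityI subsetI)
    fix x assume "x \<in> {mat2_mult R (v, \<zero>, \<zero>, v) (mat2_mult R (u, \<zero>, \<zero>, u) M) | v. v \<in> Units R}"
    then show "x \<in> {mat2_mult R (v, \<zero>, \<zero>, v) M | v. v \<in> Units R}"
      using assoc u by blast
  next
    fix x assume "x \<in> {mat2_mult R (v, \<zero>, \<zero>, v) M | v. v \<in> Units R}"
    then obtain v where v: "v \<in> Units R" "x = mat2_mult R (v, \<zero>, \<zero>, v) M" by blast
    have w: "v \<otimes> inv u \<in> Units R" using u v by auto
    have "v \<otimes> inv u \<otimes> u = v"
      using u v by (simp add: m_assoc Units_closed Units_l_inv)
    then have "x = mat2_mult R (v \<otimes> inv u, \<zero>, \<zero>, v \<otimes> inv u) (mat2_mult R (u, \<zero>, \<zero>, u) M)"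
      using assoc[OF w] v by simp
    then show "x \<in> {mat2_mult R (v, \<zero>, \<zero>, v) (mat2_mult R (u, \<zero>, \<zero>, u) M) | v. v \<in> Units R}"
      using w by blast
  qed
  have "mat2_det R (mat2_mult R (u, \<zero>, \<zero>, u) M) \<in> Units R"
    using mat2_det_scale[of u M] uc M4 u dU by (simp add: M' del: mat2_mult.simps)
  then show "mat2_mult R (u, \<zero>, \<zero>, u) M \<in> carrier (GL2 R)"
    using M4 uc by (auto simp: GL2_def M')
qed

lemma PSL2_with_det_square:
  assumes w: "w \<in> Units R" and \<tau>: "\<tau> = w \<otimes> w"
  shows "PSL2_with_det R \<tau> = PSL2 R"
proof (intro equalityI subsetI)
  fix x assume "x \<in> PSL2 R"
  then obtain M where "M \<in> carrier (GL2 R)" "mat2_det R M = \<one>" "x = PGL2_class R M"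
    by (auto simp: PSL2_def)
  then show "x \<in> PSL2_with_det R \<tau>"
    unfolding PSL2_with_det_def by (intro CollectI exI[of _ M] conjI bexI[of _ \<one>]) simp_all
next
  fix x assume "x \<in> PSL2_with_det R \<tau>"
  then obtain M u where M: "M \<in> carrier (GL2 R)" "x = PGL2_class R M" and u: "u \<in> Units R"
    and d: "mat2_det R M = u \<otimes> u \<or> mat2_det R M = \<tau> \<otimes> (u \<otimes> u)"
    unfolding PSL2_with_det_def by blast
  have "w \<otimes> w \<otimes> (u \<otimes> u) = (w \<otimes> u) \<otimes> (w \<otimes> u)"
    using w u by (simp add: m_ac Units_closed)
  with d \<tau> w u obtain v where v: "v \<in> Units R" "mat2_det R M = v \<otimes> v" by auto
  let ?N = "mat2_mult R (inv v, \<zero>, \<zero>, inv v) M"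
  have iv: "inv v \<in> Units R" using v by simp
  have M4: "M \<in> carrier R \<times> carrier R \<times> carrier R \<times> carrier R" using M by (simp add: GL2_def)
  have "inv v \<otimes> inv v \<otimes> (v \<otimes> v) = (inv v \<otimes> v) \<otimes> (inv v \<otimes> v)"
    using v by (simp add: m_ac Units_closed)
  then have "mat2_det R ?N = \<one>"
    using mat2_det_scale[OF _ M4, of "inv v"] v by (simp add: Units_l_inv)
  then show "x \<in> PSL2 R"
    using PGL2_class_scale[OF iv M(1)] M(2) unfolding PSL2_def by blast
qed

end

lemma (in field) PSL2_with_det_nonsquare:
  assumes fin: "finite (carrier R)"
    and \<tau>: "\<tau> \<in> Units R" and ns: "\<And>w. w \<in> Units R \<Longrightarrow> \<tau> \<noteq> w \<otimes> w"
  shows "PSL2_with_det R \<tau> = carrier (PGL2 R)"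
proof -
  define U where "U = Units R"
  define S where "S = (\<lambda>u. u \<otimes> u) ` U"
  have finU: "finite U" using fin unfolding U_def by (rule rev_finite_subset) auto
  have SU: "S \<subseteq> U" unfolding S_def U_def by auto
  have fib: "card {u \<in> U. u \<otimes> u = s} \<le> 2" if s: "s \<in> S" for s
  proof -
    obtain v where v: "v \<in> U" "s = v \<otimes> v" using s unfolding S_def by auto
    have vc: "v \<in> carrier R" using v unfolding U_def by auto
    have "{u \<in> U. u \<otimes> u = s} \<subseteq> {v, \<ominus> v}"
    proof
      fix u assume "u \<in> {u \<in> U. u \<otimes> u = s}"
      then have uc: "u \<in> carrier R" and e: "u \<otimes> u = v \<otimes> v" using v unfolding U_def by auto
      have "(u \<ominus> v) \<otimes> (u \<oplus> v) = u \<otimes> u \<ominus> v \<otimes> v" using uc vc by algebra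
      also have "\<dots> = \<zero>" using e uc vc by (simp add: r_right_minus_eq)
      finally have "u \<ominus> v = \<zero> \<or> u \<oplus> v = \<zero>" using uc vc by (simp add: integral_iff)
      then show "u \<in> {v, \<ominus> v}"
        using uc vc minus_equality[of u v] by (auto simp: r_right_minus_eq)
    qed
    then have "card {u \<in> U. u \<otimes> u = s} \<le> card {v, \<ominus> v}" by (intro card_mono) auto
    also have "\<dots> \<le> 2" by (simp add: card_insert_if)
    finally show ?thesis .
  qed
  have cU: "card U \<le> 2 * card S"
  proof -
    have "U = (\<Union>s\<in>S. {u \<in> U. u \<otimes> u = s})" unfolding S_def by auto
    then have "card U \<le> (\<Sum>s\<in>S. card {u \<in> U. u \<otimes> u = s})"
      using card_UN_le[of S "\<lambda>s. {u \<in> U. u \<otimes> u = s}"] finU by (simp add: S_def)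
    also have "\<dots> \<le> (\<Sum>s\<in>S. 2)" using fib by (rule sum_mono)
    finally show ?thesis by simp
  qed
  define T where "T = (\<lambda>s. \<tau> \<otimes> s) ` S"
  have TU: "T \<subseteq> U" using SU \<tau> unfolding T_def U_def by auto
  have "inj_on (\<lambda>s. \<tau> \<otimes> s) S"
    using SU \<tau> unfolding inj_on_def U_def by (metis Units_l_cancel Units_closed subsetD)
  then have cT: "card T = card S" unfolding T_def by (rule card_image)
  have disj: "S \<inter> T = {}"
  proof (rule ccontr)
    assume "S \<inter> T \<noteq> {}"
    then obtain u v where uv: "u \<in> Units R" "v \<in> Units R" "u \<otimes> u = \<tau> \<otimes> (v \<otimes> v)"
      unfolding S_def T_def U_def by auto
    let ?w = "u \<otimes> inv v"
    have "?w \<otimes> ?w = (u \<otimes> u) \<otimes> (inv v \<otimes> inv v)"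
      using uv(1,2) by (simp add: m_ac Units_closed)
    also have "\<dots> = \<tau> \<otimes> (v \<otimes> v) \<otimes> (inv v \<otimes> inv v)" by (simp only: uv(3))
    also have "\<dots> = \<tau> \<otimes> ((v \<otimes> inv v) \<otimes> (v \<otimes> inv v))"
      using uv(1,2) \<tau> by (simp add: m_ac Units_closed)
    also have "\<dots> = \<tau>" using uv(2) \<tau> by (simp add: Units_closed Units_r_inv)
    finally show False using ns[of ?w] uv by auto
  qed
  have fin2: "finite S" "finite T" using SU TU finU by (auto intro: finite_subset)
  have "card (S \<union> T) = 2 * card S"
    using card_Un_disjoint[OF fin2 disj] cT by simp
  moreover have STU: "S \<union> T \<subseteq> U" using SU TU by blast
  ultimately have "card (S \<union> T) = card U"
    using cU card_mono[OF finU STU] by linarith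
  then have ST: "S \<union> T = U" using card_subset_eq[OF finU STU] by blast
  show ?thesis
  proof (intro equalityI subsetI)
    fix x assume "x \<in> PSL2_with_det R \<tau>"
    then show "x \<in> carrier (PGL2 R)"
      by (auto simp: PSL2_with_det_def PGL2_def carrier_FactGroup PGL2_class_def)
  next
    fix x assume "x \<in> carrier (PGL2 R)"
    then obtain M where M: "M \<in> carrier (GL2 R)" "x = PGL2_class R M"
      by (auto simp: PGL2_def carrier_FactGroup PGL2_class_def)
    then have "mat2_det R M \<in> S \<union> T" using ST by (simp add: GL2_def U_def)
    then have "\<exists>u \<in> Units R. mat2_det R M = u \<otimes> u \<or> mat2_det R M = \<tau> \<otimes> (u \<otimes> u)"
      unfolding S_def T_def U_def by auto
    with M show "x \<in> PSL2_with_det R \<tau>"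
      unfolding PSL2_with_det_def by blast
  qed
qed


section \<open>The Morgenstern graphs\<close>

context
  fixes F :: "('a, 'm) ring_scheme" and \<nu> :: 'a
begin

text \<open>\<open>F\<close> is a finite field of odd order and \<open>\<nu>\<close> a non-square in it.  The indeterminate \<open>t\<close> of
  \<open>poly_ring F\<close> is \<open>X\<^bsub>F\<^esub>\<close>.\<close>

definition pconst :: "'a \<Rightarrow> 'a list" where
  "pconst c = ring.poly_of_const F c"

definition t_minus_1 :: "'a list" where
  "t_minus_1 = X\<^bsub>F\<^esub> \<ominus>\<^bsub>poly_ring F\<^esub> \<one>\<^bsub>poly_ring F\<^esub>"

text \<open>\<open>(x\<^sub>1, x\<^sub>2, x\<^sub>3, x\<^sub>4)\<close> stands for \<open>x\<^sub>1 + x\<^sub>2 i + x\<^sub>3 j + x\<^sub>4 i j\<close> in the quaternion order over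
  \<open>F[t]\<close> with \<open>i\<^sup>2 = \<nu>\<close>, \<open>j\<^sup>2 = t - 1\<close> and \<open>i j = - j i\<close>.\<close>

fun quat_norm :: "'a list \<times> 'a list \<times> 'a list \<times> 'a list \<Rightarrow> 'a list" where
  "quat_norm (x1, x2, x3, x4) =
     (x1 \<otimes>\<^bsub>poly_ring F\<^esub> x1 \<ominus>\<^bsub>poly_ring F\<^esub> pconst \<nu> \<otimes>\<^bsub>poly_ring F\<^esub> (x2 \<otimes>\<^bsub>poly_ring F\<^esub> x2))
     \<ominus>\<^bsub>poly_ring F\<^esub>
     t_minus_1 \<otimes>\<^bsub>poly_ring F\<^esub>
       (x3 \<otimes>\<^bsub>poly_ring F\<^esub> x3 \<ominus>\<^bsub>poly_ring F\<^esub> pconst \<nu> \<otimes>\<^bsub>poly_ring F\<^esub> (x4 \<otimes>\<^bsub>poly_ring F\<^esub> x4))"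

text \<open>Morgenstern's \<open>q + 1\<close> basic elements \<open>1 + \<gamma> j + \<delta> i j\<close> of norm \<open>t\<close>, with \<open>\<gamma>, \<delta>\<close> constant.
  For degree reasons every element of norm \<open>t\<close> is \<open>\<alpha> + \<beta> j\<close> with \<open>\<alpha>, \<beta>\<close> in the constant field
  \<open>F(i)\<close> and \<open>\<alpha>\<close> a unit of norm 1, so it is the product of a unit of norm 1 and exactly one basic
  element.\<close>

definition basic_quats :: "('a list \<times> 'a list \<times> 'a list \<times> 'a list) set" where
  "basic_quats =
     {(\<one>\<^bsub>poly_ring F\<^esub>, \<zero>\<^bsub>poly_ring F\<^esub>, pconst \<gamma>, pconst \<delta>) | \<gamma> \<delta>.
        \<gamma> \<in> carrier F \<and> \<delta> \<in> carrier F \<and>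
        quat_norm (\<one>\<^bsub>poly_ring F\<^esub>, \<zero>\<^bsub>poly_ring F\<^esub>, pconst \<gamma>, pconst \<delta>) = X\<^bsub>F\<^esub>}"

definition residue_ring_mod :: "'a list \<Rightarrow> 'a list set ring" where
  "residue_ring_mod g = poly_ring F Quot (PIdl\<^bsub>poly_ring F\<^esub> g)"

definition residue :: "'a list \<Rightarrow> 'a list \<Rightarrow> 'a list set" where
  "residue g p = (PIdl\<^bsub>poly_ring F\<^esub> g) +>\<^bsub>poly_ring F\<^esub> p"

text \<open>A pair \<open>(a, b)\<close> with \<open>a\<^sup>2 - \<nu> b\<^sup>2 = t - 1\<close> in \<open>F[t]/(g)\<close> splits the quaternion order modulo
  \<open>g\<close>: send \<open>i\<close> to the matrix \<open>(0, \<nu>, 1, 0)\<close> and \<open>j\<close> to \<open>(a, - \<nu> b, b, - a)\<close>; the norm becomes the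
  determinant.  Such a pair exists whenever \<open>g\<close> is coprime to \<open>t (t - 1)\<close> (norms from a quadratic
  extension of a finite field, and Hensel's lemma), and any two isomorphisms onto the matrix algebra
  are conjugate by an element of \<open>GL2\<close>, so the graph does not depend on the choice up to
  isomorphism.\<close>

definition is_splitting :: "'a list \<Rightarrow> 'a list set \<times> 'a list set \<Rightarrow> bool" where
  "is_splitting g ab \<longleftrightarrow>
     (let R = residue_ring_mod g; (a, b) = ab in
        a \<in> carrier R \<and> b \<in> carrier R \<and>
        a \<otimes>\<^bsub>R\<^esub> a \<ominus>\<^bsub>R\<^esub> residue g (pconst \<nu>) \<otimes>\<^bsub>R\<^esub> (b \<otimes>\<^bsub>R\<^esub> b) = residue g t_minus_1)"

definition splitting :: "'a list \<Rightarrow> 'a list set \<times> 'a list set" where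
  "splitting g = (SOME ab. is_splitting g ab)"

fun reduce_quat ::
  "'a list \<Rightarrow> 'a list \<times> 'a list \<times> 'a list \<times> 'a list \<Rightarrow> 'a list set mat2" where
  "reduce_quat g (x1, x2, x3, x4) =
     (let R = residue_ring_mod g;
          (a, b) = splitting g;
          n = residue g (pconst \<nu>);
          y1 = residue g x1; y2 = residue g x2; y3 = residue g x3; y4 = residue g x4
      in (y1 \<oplus>\<^bsub>R\<^esub> a \<otimes>\<^bsub>R\<^esub> y3 \<oplus>\<^bsub>R\<^esub> n \<otimes>\<^bsub>R\<^esub> (b \<otimes>\<^bsub>R\<^esub> y4),
          n \<otimes>\<^bsub>R\<^esub> (y2 \<ominus>\<^bsub>R\<^esub> b \<otimes>\<^bsub>R\<^esub> y3 \<ominus>\<^bsub>R\<^esub> a \<otimes>\<^bsub>R\<^esub> y4),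
          y2 \<oplus>\<^bsub>R\<^esub> b \<otimes>\<^bsub>R\<^esub> y3 \<oplus>\<^bsub>R\<^esub> a \<otimes>\<^bsub>R\<^esub> y4,
          y1 \<ominus>\<^bsub>R\<^esub> a \<otimes>\<^bsub>R\<^esub> y3 \<ominus>\<^bsub>R\<^esub> n \<otimes>\<^bsub>R\<^esub> (b \<otimes>\<^bsub>R\<^esub> y4)))"

text \<open>The Cayley graph of \<open>PSL2\<close> (if \<open>t\<close> is a square modulo \<open>g\<close>) or \<open>PGL2\<close> (if it is not) of
  \<open>F[t]/(g)\<close>.  When \<open>t\<close> is not a square and \<open>g\<close> has several prime factors, \<open>PGL2\<close> has to be read
  as its subgroup \<open>PSL2_with_det\<close>: the generators have determinant \<open>t\<close>, so they all lie in it, and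
  by strong approximation they generate it.  The set of generators is closed under inversion (negate
  \<open>\<gamma>\<close> and \<open>\<delta>\<close>), hence adjacency is symmetric.\<close>

definition morgenstern_graph :: "'a list \<Rightarrow> 'a list set mat2 set graph" where
  "morgenstern_graph g =
     (let R = residue_ring_mod g in
        cayley_graph (PGL2 R) (PSL2_with_det R (residue g X\<^bsub>F\<^esub>))
          (PGL2_class R ` reduce_quat g ` basic_quats))"

definition morgenstern_modulus :: "'a list \<Rightarrow> bool" where
  "morgenstern_modulus g \<longleftrightarrow>
     g \<in> carrier (poly_ring F) \<and>
     \<one>\<^bsub>poly_ring F\<^esub> gcdof\<^bsub>poly_ring F\<^esub> g (X\<^bsub>F\<^esub> \<otimes>\<^bsub>poly_ring F\<^esub> t_minus_1)"

end

end

theory Submission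
  imports Defs
begin

text \<open>With \<open>\<nu> = -1\<close> every product of \<open>h\<close> basic quaternions has norm \<open>t ^ h\<close>, entries
  \<open>x1\<close>, \<open>x2\<close> of degree at most \<open>h / 2\<close>, and \<open>x2\<close> divisible by \<open>t - 1\<close>.  If a walk of length
  \<open>h\<close> joins the identity to the class of \<open>i\<close>, then \<open>g\<close> divides \<open>x1\<close>, \<open>x3\<close> and \<open>x4\<close>, so
  \<open>x2\<^sup>2 \<equiv> t ^ h\<close> modulo \<open>g\<^sup>2\<close>.  For even \<open>h < 4 deg g\<close> and \<open>g\<close> a power of a prime \<open>P\<close> this
  forces \<open>x2 = \<plusminus>t ^ (h / 2)\<close>, which \<open>t - 1\<close> does not divide.  For odd \<open>h\<close> it is impossible
  if \<open>t\<close> is a non-square modulo \<open>P\<close>, as for \<open>P = t + 1\<close>; these graphs are bipartite.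

  In the non-bipartite case take \<open>g\<^sup>2 = P ^ (Q + 1)\<close> with \<open>Q\<close> a power of the characteristic, and
  \<open>P = t - 4\<close>, or \<open>P = t\<^sup>2 + 1\<close> in characteristic 3.  Then \<open>P ^ Q\<close> is \<open>t ^ Q - 4\<close> or
  \<open>t ^ (2 * Q) + 1\<close>, so that the square roots of \<open>t ^ h\<close> modulo \<open>P ^ Q\<close> are explicit and
  sparse; they either have too large a degree or fail to be square roots modulo \<open>P ^ (Q + 1)\<close>.
  For a basic quaternion \<open>1 + w\<close> one has \<open>w\<^sup>2 = 1 - t\<close>, and these \<open>P\<close> divide the
  \<open>w\<close>-coefficient of \<open>(1 + w) ^ 3\<close>, respectively of \<open>(1 + w) ^ 5\<close>; raising to the power \<open>Q\<close>
  gives a closed walk of odd length.  The number of vertices is at most twice \<open>q ^ (3 deg g)\<close>.\<close>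

section \<open>The Frobenius map\<close>

text \<open>Modulo several primes the congruence \<open>x2 ^ 2 = t ^ h\<close> would leave an
  independent sign at each of them; modulo a power of one prime \<open>P\<close> not dividing
  \<open>2 t\<close> only two opposite roots remain, hence a prime power as \<open>g\<close>. The
  factor \<open>t - 1\<close> of \<open>x2\<close> comes from the generators: right multiplication
  by \<open>1 + \<gamma> j + \<delta> i j\<close> changes \<open>x2\<close> by a multiple of
  \<open>j ^ 2 = t - 1\<close>, and the walk starts at 1. For even \<open>h\<close> it excludes the
  one solution that is always short enough.

  A non-bipartite graph needs \<open>t\<close> to be a square modulo \<open>P\<close>. Then roots of
  odd powers of \<open>t\<close> exist modulo every power of \<open>P\<close> and must be shown to
  have no short representative. \<open>P = t - 4\<close> makes \<open>t\<close> congruent to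
  \<open>2 ^ 2\<close>. In characteristic 3 this is the forbidden \<open>t - 1\<close>, and over the
  field of three elements 1 is the only non-zero square, so no linear \<open>P\<close> works; modulo
  \<open>t ^ 2 + 1\<close> the square root of \<open>t\<close> is \<open>t - 1\<close>. The exponent
  \<open>Q + 1\<close> is even, as a square \<open>g ^ 2\<close> requires, and exceeds by one the
  Frobenius exponent at which roots are explicit: the additional factor \<open>P\<close> is what
  excludes the explicit roots that happen to be short.\<close>

context cring
begin

lemma binomial_ring:
  assumes x: "x \<in> carrier R" and y: "y \<in> carrier R"
  shows "(x \<oplus> y) [^] n = (\<Oplus>i\<in>{..n}. add_pow R (n choose i) (x [^] i \<otimes> y [^] (n - i)))"
proof (induction n)
  case 0
  then show ?case using x y by simp
next
  case (Suc n)
  let ?S = "\<Oplus>i\<in>{..n}. add_pow R (n choose i) (x [^] i \<otimes> y [^] (n - i))"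
  let ?A = "\<lambda>i. add_pow R (n choose i) (x [^] Suc i \<otimes> y [^] (n - i))"
  let ?B = "\<lambda>i. add_pow R (n choose i) (x [^] i \<otimes> y [^] (Suc n - i))"
  let ?C = "\<lambda>i. add_pow R (Suc n choose i) (x [^] i \<otimes> y [^] (Suc n - i))"
  have cl: "add_pow R k (x [^] (i::nat) \<otimes> y [^] (j::nat)) \<in> carrier R" for k :: nat and i j
    using x y by simp
  have A: "?S \<otimes> x = (\<Oplus>i\<in>{..n}. ?A i)"
    using x y cl by (subst finsum_ldistr) (auto intro!: finsum_cong' simp: add_pow_ldistr add_pow_rdistr m_ac)
  have B: "?S \<otimes> y = (\<Oplus>i\<in>{..n}. ?B i)"
    using x y cl by (subst finsum_ldistr) (auto intro!: finsum_cong' simp: add_pow_ldistr add_pow_rdistr m_ac Suc_diff_le)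
  have C: "?C (Suc i) = ?A i \<oplus> ?B (Suc i)" for i
    using x y by (simp add: add.nat_pow_mult a_comm del: nat_pow_Suc)
  have "(\<Oplus>i\<in>{..Suc n}. ?C i) = (\<Oplus>i\<in>{..n}. ?A i \<oplus> ?B (Suc i)) \<oplus> ?C 0"
    using cl by (subst finsum_Suc2) (auto simp only: C Pi_iff intro!: a_closed)
  also have "\<dots> = (\<Oplus>i\<in>{..n}. ?A i) \<oplus> ((\<Oplus>i\<in>{..n}. ?B (Suc i)) \<oplus> ?B 0)"
    using cl x y by (subst finsum_addf) (auto simp: a_assoc Pi_iff simp del: nat_pow_Suc)
  also have "(\<Oplus>i\<in>{..n}. ?B (Suc i)) \<oplus> ?B 0 = (\<Oplus>i\<in>{..Suc n}. ?B i)"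
    using cl by (subst finsum_Suc2) (auto simp del: nat_pow_Suc)
  also have "\<dots> = (\<Oplus>i\<in>{..n}. ?B i)"
    using cl x y by (subst finsum_Suc) (auto simp: Pi_iff binomial_eq_0 simp del: nat_pow_Suc)
  finally have "(\<Oplus>i\<in>{..Suc n}. ?C i) = ?S \<otimes> x \<oplus> ?S \<otimes> y" using A B by simp
  also have "\<dots> = ?S \<otimes> (x \<oplus> y)" using x y cl by (subst r_distr) auto
  also have "\<dots> = (x \<oplus> y) [^] Suc n" using Suc by simp
  finally show ?case by simp
qed

text \<open>The binomial coefficients strictly between the ends are multiples of \<open>p\<close>.
  The characteristic is expressed by \<open>add_pow R p \<one> = \<zero>\<close>, so that the lemma
  applies both to \<open>F[t]\<close> and to the pair rings \<open>quad_ring\<close>, which may have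
  zero divisors.\<close>

lemma frobenius_prime_add:
  assumes p: "Factorial_Ring.prime (p::nat)" and char: "add_pow R p \<one> = \<zero>" and x: "x \<in> carrier R" and y: "y \<in> carrier R"
  shows "(x \<oplus> y) [^] p = x [^] p \<oplus> y [^] p"
proof -
  let ?f = "\<lambda>i. add_pow R (p choose i) (x [^] i \<otimes> y [^] (p - i))"
  \<comment> \<open>Two successors let the terms with indices \<open>p\<close> and \<open>0\<close>
    be peeled off the sum.\<close>
  obtain m where m: "p = Suc (Suc m)" using prime_ge_2_nat[OF p] by (metis Suc_diff_Suc add_2_eq_Suc' le_Suc_ex less_iff_Suc_add add.commute plus_1_eq_Suc Suc_1)
  have cl: "?f i \<in> carrier R" for i using x y by simp
  have mid: "?f i = \<zero>" if "0 < i" "i < p" for i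
  proof -
    have "p dvd (p choose i)" using dvd_choose_prime[of i p] that p by simp
    then obtain k where k: "p choose i = p * k" by (rule dvdE)
    have z: "x [^] i \<otimes> y [^] (p - i) \<in> carrier R" (is "?z \<in> _") using x y by simp
    have "add_pow R p ?z = (add_pow R p \<one>) \<otimes> ?z" using z by (simp add: add_pow_ldistr)
    then have "add_pow R p ?z = \<zero>" using char z by simp
    then show ?thesis using z by (simp add: k add.nat_pow_pow[symmetric])
  qed
  have "(x \<oplus> y) [^] p = (\<Oplus>i\<in>{..Suc (Suc m)}. ?f i)" using binomial_ring[OF x y, of p] m by simp
  also have "\<dots> = ?f p \<oplus> (\<Oplus>i\<in>{..Suc m}. ?f i)"
    using cl m by (subst finsum_Suc) auto
  also have "(\<Oplus>i\<in>{..Suc m}. ?f i) = (\<Oplus>i\<in>{..m}. ?f (Suc i)) \<oplus> ?f 0"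
    using cl by (subst finsum_Suc2) auto
  also have "(\<Oplus>i\<in>{..m}. ?f (Suc i)) = \<zero>"
    by (intro add.finprod_one_eqI mid) (simp_all add: m)
  finally show ?thesis using x y by simp
qed

lemma frobenius_add:
  assumes p: "Factorial_Ring.prime (p::nat)" and char: "add_pow R p \<one> = \<zero>" and x: "x \<in> carrier R" and y: "y \<in> carrier R"
  shows "(x \<oplus> y) [^] (p ^ e) = x [^] (p ^ e) \<oplus> y [^] (p ^ e)"
proof (induction e)
  case (Suc e)
  have "(x \<oplus> y) [^] (p ^ Suc e) = ((x \<oplus> y) [^] (p ^ e)) [^] p"
    using x y by (simp add: nat_pow_pow mult.commute)
  then show ?case
    using x y Suc frobenius_prime_add[OF p char] by (simp add: nat_pow_pow mult.commute)
qed (use x y in simp)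

text \<open>Additivity is applied to \<open>x = (x - y) + y\<close>, so no sign
  \<open>(-1) ^ (p ^ e)\<close> appears.\<close>

lemma frobenius_minus:
  assumes "Factorial_Ring.prime (p::nat)" and "add_pow R p \<one> = \<zero>" and x: "x \<in> carrier R" and y: "y \<in> carrier R"
  shows "(x \<ominus> y) [^] (p ^ e) = x [^] (p ^ e) \<ominus> y [^] (p ^ e)"
proof -
  have "x [^] (p ^ e) = ((x \<ominus> y) \<oplus> y) [^] (p ^ e)" using x y by (simp add: minus_eq a_assoc l_neg)
  also have "\<dots> = (x \<ominus> y) [^] (p ^ e) \<oplus> y [^] (p ^ e)" using assms by (simp add: frobenius_add)
  finally show ?thesis using x y by (simp add: minus_eq a_assoc r_neg)
qed

section \<open>Graphs on classes of matrices\<close>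

lemma PGL2_class_alt: "PGL2_class R N = {mat2_mult R (v, \<zero>, \<zero>, v) N | v. v \<in> Units R}"
  by (auto simp: PGL2_class_def r_coset_def scalars2_def GL2_def)

lemma mat2_det_mult:
  assumes "M \<in> carrier R \<times> carrier R \<times> carrier R \<times> carrier R"
    and "N \<in> carrier R \<times> carrier R \<times> carrier R \<times> carrier R"
  shows "mat2_det R (mat2_mult R M N) = mat2_det R M \<otimes> mat2_det R N"
proof -
  obtain a b c d a' b' c' d' where [simp]: "M = (a, b, c, d)" "N = (a', b', c', d')"
    by (cases M, cases N) auto
  have "a \<in> carrier R" "b \<in> carrier R" "c \<in> carrier R" "d \<in> carrier R"
    "a' \<in> carrier R" "b' \<in> carrier R" "c' \<in> carrier R" "d' \<in> carrier R"
    using assms by auto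
  then show ?thesis by simp algebra
qed

lemma mat2_mult_closed:
  assumes "M \<in> carrier R \<times> carrier R \<times> carrier R \<times> carrier R"
    and "N \<in> carrier R \<times> carrier R \<times> carrier R \<times> carrier R"
  shows "mat2_mult R M N \<in> carrier R \<times> carrier R \<times> carrier R \<times> carrier R"
  using assms by (cases M, cases N) auto

lemma carrier_GL2: "M \<in> carrier (GL2 R) \<longleftrightarrow>
    M \<in> carrier R \<times> carrier R \<times> carrier R \<times> carrier R \<and> mat2_det R M \<in> Units R"
  by (simp add: GL2_def)

lemma GL2_mult_closed:
  assumes "M \<in> carrier (GL2 R)" "N \<in> carrier (GL2 R)"
  shows "mat2_mult R M N \<in> carrier (GL2 R)"
  using assms mat2_mult_closed[of M N] mat2_det_mult[of M N] unfolding carrier_GL2 by (simp del: mem_Sigma_iff)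

lemma mat2_mult_scale:
  assumes "u \<in> carrier R" "v \<in> carrier R"
    and "M \<in> carrier R \<times> carrier R \<times> carrier R \<times> carrier R"
    and "N \<in> carrier R \<times> carrier R \<times> carrier R \<times> carrier R"
  shows "mat2_mult R (mat2_mult R (u, \<zero>, \<zero>, u) M) (mat2_mult R (v, \<zero>, \<zero>, v) N)
    = mat2_mult R (u \<otimes> v, \<zero>, \<zero>, u \<otimes> v) (mat2_mult R M N)"
proof -
  obtain a b c d a' b' c' d' where [simp]: "M = (a, b, c, d)" "N = (a', b', c', d')"
    by (cases M, cases N) auto
  have "a \<in> carrier R" "b \<in> carrier R" "c \<in> carrier R" "d \<in> carrier R"
    "a' \<in> carrier R" "b' \<in> carrier R" "c' \<in> carrier R" "d' \<in> carrier R"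
    using assms by auto
  then show ?thesis using assms(1,2) by simp (intro conjI; algebra)
qed

text \<open>\<open>Mod\<close> multiplies cosets as sets. Scalars are central, so a product of
  scaled matrices is a scaled product; conversely the whole scalar can be put on the first
  factor.\<close>

lemma PGL2_class_mult:
  assumes "M \<in> carrier (GL2 R)" "N \<in> carrier (GL2 R)"
  shows "PGL2_class R M \<otimes>\<^bsub>PGL2 R\<^esub> PGL2_class R N = PGL2_class R (mat2_mult R M N)"
proof -
  have MN: "M \<in> carrier R \<times> carrier R \<times> carrier R \<times> carrier R"
    "N \<in> carrier R \<times> carrier R \<times> carrier R \<times> carrier R"
    using assms by (auto simp: carrier_GL2)
  have m: "x \<otimes>\<^bsub>GL2 R\<^esub> y = mat2_mult R x y" for x y by (simp add: GL2_def)
  show ?thesis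
    unfolding PGL2_def mult_FactGroup set_mult_def PGL2_class_alt m
  proof (intro equalityI subsetI)
    fix x assume "x \<in> (\<Union>h\<in>{mat2_mult R (v, \<zero>, \<zero>, v) M |v. v \<in> Units R}.
              \<Union>k\<in>{mat2_mult R (v, \<zero>, \<zero>, v) N |v. v \<in> Units R}. {mat2_mult R h k})"
    then obtain u v where "u \<in> Units R" "v \<in> Units R"
      "x = mat2_mult R (mat2_mult R (u, \<zero>, \<zero>, u) M) (mat2_mult R (v, \<zero>, \<zero>, v) N)" by blast
    then show "x \<in> {mat2_mult R (v, \<zero>, \<zero>, v) (mat2_mult R M N) |v. v \<in> Units R}"
      using mat2_mult_scale[OF _ _ MN] by blast
  next
    fix x assume "x \<in> {mat2_mult R (v, \<zero>, \<zero>, v) (mat2_mult R M N) |v. v \<in> Units R}"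
    then obtain u where u: "u \<in> Units R" "x = mat2_mult R (u, \<zero>, \<zero>, u) (mat2_mult R M N)" by blast
    then have "x = mat2_mult R (mat2_mult R (u, \<zero>, \<zero>, u) M) (mat2_mult R (\<one>, \<zero>, \<zero>, \<one>) N)"
      using mat2_mult_scale[OF _ _ MN, of u \<one>] by (simp add: Units_closed)
    then show "x \<in> (\<Union>h\<in>{mat2_mult R (v, \<zero>, \<zero>, v) M |v. v \<in> Units R}.
              \<Union>k\<in>{mat2_mult R (v, \<zero>, \<zero>, v) N |v. v \<in> Units R}. {mat2_mult R h k})"
      using u(1) by blast
  qed
qed

lemma PGL2_class_eqD:
  assumes "M \<in> carrier (GL2 R)" "PGL2_class R M = PGL2_class R N"
  obtains u where "u \<in> Units R" "M = mat2_mult R (u, \<zero>, \<zero>, u) N"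
proof -
  have "mat2_mult R (\<one>, \<zero>, \<zero>, \<one>) M = M"
    using assms(1) by (cases M) (auto simp: carrier_GL2)
  then have "\<exists>v. M = mat2_mult R (v, \<zero>, \<zero>, v) M \<and> v \<in> Units R"
    by (intro exI[of _ \<one>] conjI) simp_all
  then have "M \<in> PGL2_class R M" unfolding PGL2_class_alt by (rule CollectI)
  then have "M \<in> PGL2_class R N" by (simp only: assms(2))
  then show thesis unfolding PGL2_class_alt using that by blast
qed

text \<open>Scaling by \<open>w\<close> multiplies a determinant by \<open>w \<otimes> w\<close>, so
  being a square or \<open>\<tau>\<close> times a square is a property of the class. For a
  non-square \<open>\<tau>\<close> the two properties exclude each other, and a generator of
  determinant \<open>\<tau>\<close> exchanges them.\<close>

lemma cayley_PGL2_bipartite: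
  assumes \<tau>: "\<tau> \<in> Units R" and ns: "\<And>w. w \<in> Units R \<Longrightarrow> \<tau> \<noteq> w \<otimes> w"
    and S: "\<And>s. s \<in> S \<Longrightarrow> \<exists>M \<in> carrier (GL2 R). mat2_det R M = \<tau> \<and> s = PGL2_class R M"
  shows "bipartite (cayley_graph (PGL2 R) (PSL2_with_det R \<tau>) S)"
proof -
  define A where "A = {PGL2_class R M | M. M \<in> carrier (GL2 R) \<and> (\<exists>u \<in> Units R. mat2_det R M = u \<otimes> u)}"
  define B where "B = {PGL2_class R M | M. M \<in> carrier (GL2 R) \<and> (\<exists>u \<in> Units R. mat2_det R M = \<tau> \<otimes> (u \<otimes> u))}"
  have disj: "A \<inter> B = {}"
  proof (rule ccontr)
    assume "A \<inter> B \<noteq> {}"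
    then obtain M N u v where M: "M \<in> carrier (GL2 R)" "u \<in> Units R" "mat2_det R M = u \<otimes> u"
      and N: "N \<in> carrier (GL2 R)" "v \<in> Units R" "mat2_det R N = \<tau> \<otimes> (v \<otimes> v)"
      and eq: "PGL2_class R M = PGL2_class R N"
      unfolding A_def B_def by blast
    obtain w where w: "w \<in> Units R" "M = mat2_mult R (w, \<zero>, \<zero>, w) N"
      using PGL2_class_eqD[OF M(1) eq] by blast
    have "u \<otimes> u = w \<otimes> w \<otimes> (\<tau> \<otimes> (v \<otimes> v))"
      using mat2_det_scale[of w N] w N M by (auto simp: carrier_GL2)
    also have "\<dots> = \<tau> \<otimes> ((w \<otimes> v) \<otimes> (w \<otimes> v))"
      using w(1) N(2) \<tau> by (simp add: m_ac Units_closed)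
    finally have e: "u \<otimes> u = \<tau> \<otimes> ((w \<otimes> v) \<otimes> (w \<otimes> v))" .
    let ?z = "w \<otimes> v"
    have z: "?z \<in> Units R" using w N by simp
    have "(u \<otimes> inv ?z) \<otimes> (u \<otimes> inv ?z) = (u \<otimes> u) \<otimes> (inv ?z \<otimes> inv ?z)"
      using M(2) z by (simp add: m_ac Units_closed)
    also have "\<dots> = \<tau> \<otimes> ((?z \<otimes> inv ?z) \<otimes> (?z \<otimes> inv ?z))"
      using Units_inv_closed[OF z] Units_closed[OF z] Units_closed[OF \<tau>] unfolding e
      by (simp add: m_ac)
    also have "\<dots> = \<tau>" using z \<tau> by (simp add: Units_closed)
    finally show False using ns[of "u \<otimes> inv ?z"] M(2) z by auto
  qed
  have AB: "A \<union> B = PSL2_with_det R \<tau>" unfolding A_def B_def PSL2_with_det_def by blast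
  have edge: "x \<otimes>\<^bsub>PGL2 R\<^esub> s \<in> (if x \<in> A then B else A)"
    if x: "x \<in> PSL2_with_det R \<tau>" and s: "s \<in> S" for x s
  proof -
    obtain N where N: "N \<in> carrier (GL2 R)" "mat2_det R N = \<tau>" "s = PGL2_class R N"
      using S[OF s] by blast
    have A': "x \<otimes>\<^bsub>PGL2 R\<^esub> s \<in> B" if xA: "x \<in> A"
    proof -
      obtain M u where M: "M \<in> carrier (GL2 R)" "u \<in> Units R" "mat2_det R M = u \<otimes> u" "x = PGL2_class R M"
        using xA unfolding A_def by blast
      have "mat2_det R (mat2_mult R M N) = \<tau> \<otimes> (u \<otimes> u)"
        using M N \<tau> by (subst mat2_det_mult) (auto simp: carrier_GL2 Units_closed m_comm)
      then show ?thesis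
        unfolding M(4) N(3) PGL2_class_mult[OF M(1) N(1)] B_def
        using M(2) GL2_mult_closed[OF M(1) N(1)] by blast
    qed
    have B': "x \<otimes>\<^bsub>PGL2 R\<^esub> s \<in> A" if xB: "x \<in> B"
    proof -
      obtain M u where M: "M \<in> carrier (GL2 R)" "u \<in> Units R" "mat2_det R M = \<tau> \<otimes> (u \<otimes> u)" "x = PGL2_class R M"
        using xB unfolding B_def by blast
      have "mat2_det R (mat2_mult R M N) = (\<tau> \<otimes> u) \<otimes> (\<tau> \<otimes> u)"
        using M N \<tau> by (subst mat2_det_mult) (auto simp: carrier_GL2 Units_closed m_ac)
      moreover have "\<tau> \<otimes> u \<in> Units R" using \<tau> M by simp
      ultimately show ?thesis
        unfolding M(4) N(3) PGL2_class_mult[OF M(1) N(1)] A_def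
        using M(2) GL2_mult_closed[OF M(1) N(1)] by blast
    qed
    show ?thesis using A' B' x AB by auto
  qed
  show ?thesis
    unfolding bipartite_def
  proof (intro exI conjI)
    show "A \<union> B = fst (cayley_graph (PGL2 R) (PSL2_with_det R \<tau>) S)"
      using AB by (simp add: cayley_graph_def)
    show "snd (cayley_graph (PGL2 R) (PSL2_with_det R \<tau>) S) \<subseteq> A \<times> B \<union> B \<times> A"
    proof
      fix e assume "e \<in> snd (cayley_graph (PGL2 R) (PSL2_with_det R \<tau>) S)"
      then obtain x s where e: "e = (x, x \<otimes>\<^bsub>PGL2 R\<^esub> s)" and x: "x \<in> PSL2_with_det R \<tau>" and s: "s \<in> S"
        unfolding cayley_graph_def by auto
      show "e \<in> A \<times> B \<union> B \<times> A"
        using edge[OF x s] x AB unfolding e by (cases "x \<in> A") auto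
    qed
  qed (rule disj)
qed

text \<open>Each class has a representative with an entry 1 in its first row, and at most three
  entries remain free: hence the exponent 3, and the factor 2 for the position of the 1. The
  hypothesis \<open>loc\<close> is typical of local rings.\<close>

lemma card_PSL2_with_det_le:
  assumes fin: "finite (carrier R)"
    and loc: "\<And>a b c d. (a, b, c, d) \<in> carrier (GL2 R) \<Longrightarrow> a \<in> Units R \<or> b \<in> Units R"
  shows "finite (PSL2_with_det R \<tau>)" and "card (PSL2_with_det R \<tau>) \<le> 2 * card (carrier R) ^ 3"
proof -
  let ?C = "carrier R"
  let ?X = "{\<one>} \<times> ?C \<times> ?C \<times> ?C" and ?Y = "?C \<times> {\<one>} \<times> ?C \<times> ?C"
  have sub: "PSL2_with_det R \<tau> \<subseteq> PGL2_class R ` (?X \<union> ?Y)"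
  proof
    fix x assume "x \<in> PSL2_with_det R \<tau>"
    then obtain M where M0: "M \<in> carrier (GL2 R)" "x = PGL2_class R M"
      unfolding PSL2_with_det_def by blast
    obtain a b c d where "M = (a, b, c, d)" by (cases M)
    with M0 have M: "(a, b, c, d) \<in> carrier (GL2 R)" "x = PGL2_class R (a, b, c, d)" by simp_all
    have cl: "a \<in> ?C" "b \<in> ?C" "c \<in> ?C" "d \<in> ?C" using M by (auto simp: carrier_GL2)
    from loc[OF M(1)] obtain u where u: "u \<in> Units R" "inv u \<otimes> a = \<one> \<or> inv u \<otimes> b = \<one>"
      using Units_l_inv by blast
    have eq: "x = PGL2_class R (mat2_mult R (inv u, \<zero>, \<zero>, inv u) (a, b, c, d))"
      using PGL2_class_scale(1)[OF _ M(1), of "inv u"] u M(2) by simp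
    have "mat2_mult R (inv u, \<zero>, \<zero>, inv u) (a, b, c, d) \<in> ?X \<union> ?Y"
      using u cl by auto
    then show "x \<in> PGL2_class R ` (?X \<union> ?Y)" unfolding eq by (rule imageI)
  qed
  have finXY: "finite (?X \<union> ?Y)" using fin by simp
  then show "finite (PSL2_with_det R \<tau>)" using sub by (meson finite_imageI finite_subset)
  have "card (PSL2_with_det R \<tau>) \<le> card (PGL2_class R ` (?X \<union> ?Y))"
    using sub finXY by (intro card_mono) auto
  also have "\<dots> \<le> card (?X \<union> ?Y)" using finXY by (rule card_image_le)
  also have "\<dots> \<le> card ?X + card ?Y" by (rule card_Un_le)
  also have "\<dots> = 2 * card ?C ^ 3" by (simp add: card_cartesian_product power3_eq_cube)
  finally show "card (PSL2_with_det R \<tau>) \<le> 2 * card (carrier R) ^ 3" .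
qed

end

section \<open>Walks, odd cycles and the diameter of a graph\<close>

lemma relpow_alternates:
  assumes "E \<subseteq> (A \<times> B) \<union> (B \<times> A)" "A \<inter> B = {}" and "(a, b) \<in> E ^^ n" "a \<in> A"
  shows "b \<in> (if even n then A else B)"
  using assms(3)
proof (induction n arbitrary: b)
  case (Suc n)
  then obtain c where c: "(a, c) \<in> E ^^ n" "(c, b) \<in> E" by auto
  have "c \<in> (if even n then A else B)" by (rule Suc.IH[OF c(1)])
  moreover have "(c, b) \<in> (A \<times> B) \<union> (B \<times> A)" using c(2) assms(1) by blast
  ultimately show ?case using assms(2) by (cases "even n") auto
qed (use assms(4) in simp)

lemma not_bipartite_if_odd_cycle:
  assumes cyc: "(x, x) \<in> snd \<Gamma> ^^ n" and "odd n"
  shows "\<not> bipartite \<Gamma>"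
proof
  assume "bipartite \<Gamma>"
  then obtain A B where AB: "snd \<Gamma> \<subseteq> (A \<times> B) \<union> (B \<times> A)" "A \<inter> B = {}"
    unfolding bipartite_def by blast
  then have BA: "snd \<Gamma> \<subseteq> (B \<times> A) \<union> (A \<times> B)" "B \<inter> A = {}" by blast+
  \<comment> \<open>Nothing places \<open>x\<close> among the vertices, but a walk of odd length is
    non-empty and its last edge puts \<open>x\<close> into \<open>A\<close> or
    \<open>B\<close>.\<close>
  obtain m where "n = Suc m" using \<open>odd n\<close> by (cases n) auto
  with cyc obtain y where "(y, x) \<in> snd \<Gamma>" by auto
  with AB(1) have "x \<in> A \<or> x \<in> B" by blast
  with relpow_alternates[OF AB cyc] relpow_alternates[OF BA cyc] \<open>odd n\<close> AB(2)
  show False by auto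
qed

text \<open>The infimum of an empty set of lengths is infinity, so the bound also covers vertices in
  different components.\<close>

lemma graph_diam_ge:
  assumes "x \<in> fst \<Gamma>" "y \<in> fst \<Gamma>" and "\<And>n. (x, y) \<in> snd \<Gamma> ^^ n \<Longrightarrow> L \<le> n"
  shows "enat L \<le> graph_diam \<Gamma>"
proof -
  have "enat L \<le> graph_dist (snd \<Gamma>) x y"
    unfolding graph_dist_def using assms(3) by (intro INF_greatest) auto
  also have "\<dots> \<le> graph_diam \<Gamma>"
    unfolding graph_diam_def using assms(1,2) by (meson SUP_upper SUP_upper2)
  finally show ?thesis .
qed

section \<open>Quadratic extensions and finite fields\<close>

text \<open>The ring \<open>R[w] / (w ^ 2 - c)\<close>, with \<open>(a, b)\<close> standing for
  \<open>a + b w\<close>. It models the commutative subring generated by a single basic quaternion,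
  where Frobenius is available.\<close>

definition quad_ring :: "('a, 'm) ring_scheme \<Rightarrow> 'a \<Rightarrow> ('a \<times> 'a) ring" where
  "quad_ring R c = \<lparr> carrier = carrier R \<times> carrier R,
     monoid.mult = (\<lambda>(a, b) (a', b'). (a \<otimes>\<^bsub>R\<^esub> a' \<oplus>\<^bsub>R\<^esub> c \<otimes>\<^bsub>R\<^esub> (b \<otimes>\<^bsub>R\<^esub> b'), a \<otimes>\<^bsub>R\<^esub> b' \<oplus>\<^bsub>R\<^esub> b \<otimes>\<^bsub>R\<^esub> a')),
     one = (\<one>\<^bsub>R\<^esub>, \<zero>\<^bsub>R\<^esub>), ring.zero = (\<zero>\<^bsub>R\<^esub>, \<zero>\<^bsub>R\<^esub>),
     ring.add = (\<lambda>(a, b) (a', b'). (a \<oplus>\<^bsub>R\<^esub> a', b \<oplus>\<^bsub>R\<^esub> b')) \<rparr>"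

context cring
begin

lemma quad_ring_simps [simp]:
  "carrier (quad_ring R c) = carrier R \<times> carrier R"
  "(a, b) \<otimes>\<^bsub>quad_ring R c\<^esub> (a', b') = (a \<otimes> a' \<oplus> c \<otimes> (b \<otimes> b'), a \<otimes> b' \<oplus> b \<otimes> a')"
  "(a, b) \<oplus>\<^bsub>quad_ring R c\<^esub> (a', b') = (a \<oplus> a', b \<oplus> b')"
  "\<one>\<^bsub>quad_ring R c\<^esub> = (\<one>, \<zero>)" "\<zero>\<^bsub>quad_ring R c\<^esub> = (\<zero>, \<zero>)"
  by (simp_all add: quad_ring_def)

lemma cring_quad_ring:
  assumes c: "c \<in> carrier R"
  shows "cring (quad_ring R c)"
proof (rule cringI)
  show "abelian_group (quad_ring R c)"
  proof (rule abelian_groupI)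
    fix x assume "x \<in> carrier (quad_ring R c)"
    then show "\<exists>y\<in>carrier (quad_ring R c). y \<oplus>\<^bsub>quad_ring R c\<^esub> x = \<zero>\<^bsub>quad_ring R c\<^esub>"
      by (intro bexI[of _ "(\<ominus> fst x, \<ominus> snd x)"]) (auto simp: l_neg)
  qed (auto simp: a_ac)
  show "comm_monoid (quad_ring R c)"
  proof (rule comm_monoidI)
    fix x y z assume "x \<in> carrier (quad_ring R c)" "y \<in> carrier (quad_ring R c)" "z \<in> carrier (quad_ring R c)"
    then show "(x \<otimes>\<^bsub>quad_ring R c\<^esub> y) \<otimes>\<^bsub>quad_ring R c\<^esub> z = x \<otimes>\<^bsub>quad_ring R c\<^esub> (y \<otimes>\<^bsub>quad_ring R c\<^esub> z)"
      using c by (auto simp: l_distr r_distr m_ac a_ac)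
  qed (use c in \<open>auto simp: m_ac a_ac\<close>)
qed (use c in \<open>auto simp: l_distr r_distr m_ac a_ac\<close>)

text \<open>By Frobenius the power of \<open>x + y w\<close> is
  \<open>x ^ (p ^ e) + y ^ (p ^ e) w ^ (p ^ e)\<close>, so its \<open>w\<close>-coefficient contains
  \<open>y ^ (p ^ e)\<close> and with it \<open>d ^ (p ^ e)\<close>. For a general exponent only one
  factor \<open>d\<close> would be guaranteed.\<close>

lemma quad_ring_snd_pow_divides:
  assumes p: "Factorial_Ring.prime (p::nat)" and char: "add_pow R p \<one> = \<zero>"
    and cl: "c \<in> carrier R" "x \<in> carrier R" "y \<in> carrier R" "d \<in> carrier R" and dvd: "d divides y"
  shows "d [^] (p ^ e) divides snd ((x, y) [^]\<^bsub>quad_ring R c\<^esub> (p ^ e))"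
proof -
  let ?Q = "quad_ring R c"
  interpret Q: cring ?Q using cl by (intro cring_quad_ring)
  have "add_pow ?Q n \<one>\<^bsub>?Q\<^esub> = (add_pow R n \<one>, \<zero>)" for n :: nat
    by (induction n) simp_all
  then have charQ: "add_pow ?Q p \<one>\<^bsub>?Q\<^esub> = \<zero>\<^bsub>?Q\<^esub>" using char by simp
  have const: "(a, \<zero>) [^]\<^bsub>?Q\<^esub> n = (a [^] n, \<zero>)" if "a \<in> carrier R" for a and n :: nat
    using that cl by (induction n) auto
  have "(x, y) = (x, \<zero>) \<oplus>\<^bsub>?Q\<^esub> (y, \<zero>) \<otimes>\<^bsub>?Q\<^esub> (\<zero>, \<one>)" using cl by simp
  then have "(x, y) [^]\<^bsub>?Q\<^esub> (p ^ e)
    = (x, \<zero>) [^]\<^bsub>?Q\<^esub> (p ^ e) \<oplus>\<^bsub>?Q\<^esub> ((y, \<zero>) \<otimes>\<^bsub>?Q\<^esub> (\<zero>, \<one>)) [^]\<^bsub>?Q\<^esub> (p ^ e)"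
    using Q.frobenius_add[OF p charQ, of "(x, \<zero>)" "(y, \<zero>) \<otimes>\<^bsub>?Q\<^esub> (\<zero>, \<one>)" e] cl by simp
  also have "((y, \<zero>) \<otimes>\<^bsub>?Q\<^esub> (\<zero>, \<one>)) [^]\<^bsub>?Q\<^esub> (p ^ e) = (y [^] (p ^ e), \<zero>) \<otimes>\<^bsub>?Q\<^esub> (\<zero>, \<one>) [^]\<^bsub>?Q\<^esub> (p ^ e)"
    using cl by (subst Q.nat_pow_distrib) (simp_all add: const del: quad_ring_simps(2))
  finally have *: "(x, y) [^]\<^bsub>?Q\<^esub> (p ^ e)
    = (x [^] (p ^ e), \<zero>) \<oplus>\<^bsub>?Q\<^esub> (y [^] (p ^ e), \<zero>) \<otimes>\<^bsub>?Q\<^esub> (\<zero>, \<one>) [^]\<^bsub>?Q\<^esub> (p ^ e)"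
    using cl by (simp add: const)
  obtain a b where ab: "(\<zero>, \<one>) [^]\<^bsub>?Q\<^esub> (p ^ e) = (a, b)" by (meson surj_pair)
  moreover have "(\<zero>, \<one>) [^]\<^bsub>?Q\<^esub> (p ^ e) \<in> carrier ?Q" by (rule Q.nat_pow_closed) simp
  ultimately have b: "a \<in> carrier R" "b \<in> carrier R" by auto
  have "snd ((x, y) [^]\<^bsub>?Q\<^esub> (p ^ e)) = y [^] (p ^ e) \<otimes> b"
    unfolding * ab using cl b by simp
  moreover obtain z where z: "z \<in> carrier R" "y = d \<otimes> z" using dvd by (auto simp: factor_def)
  ultimately have "snd ((x, y) [^]\<^bsub>?Q\<^esub> (p ^ e)) = d [^] (p ^ e) \<otimes> (z [^] (p ^ e) \<otimes> b)"
    using cl b by (simp add: nat_pow_distrib m_assoc)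
  then show ?thesis using z b by (intro dividesI[of "z [^] (p ^ e) \<otimes> b"]) auto
qed

text \<open>Here \<open>w ^ 2 = 1 - t\<close>, and the \<open>w\<close>-coefficient of
  \<open>(1 + w) ^ 3\<close> is \<open>3 + w ^ 2 = 4 - t\<close>.\<close>

lemma quad_ring_cube:
  assumes t: "t \<in> carrier R"
  shows "snd ((\<one>, \<one>) [^]\<^bsub>quad_ring R (\<ominus> (t \<ominus> \<one>))\<^esub> (3::nat)) = \<ominus> (t \<ominus> (\<one> \<oplus> \<one>) \<otimes> (\<one> \<oplus> \<one>))"
proof -
  have "snd ((\<one>, \<one>) [^]\<^bsub>quad_ring R (\<ominus> (t \<ominus> \<one>))\<^esub> (3::nat)) = \<one> \<oplus> \<ominus> (t \<ominus> \<one>) \<oplus> (\<one> \<oplus> \<one>)"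
    using t by (simp add: nat_pow_def numeral_3_eq_3)
  also have "\<dots> = \<ominus> (t \<ominus> (\<one> \<oplus> \<one>) \<otimes> (\<one> \<oplus> \<one>))"
    using t by algebra
  finally show ?thesis .
qed

section \<open>Identities in characteristic three\<close>

context
  assumes three: "\<one> \<oplus> \<one> \<oplus> \<one> = \<zero>"
begin

text \<open>This and the next two identities are arranged around \<open>u ^ 2 + 1\<close>, which
  becomes the modulus \<open>P ^ Q\<close> for \<open>u = t ^ Q\<close>. Each is first proved with
  an explicit multiple of \<open>1 + 1 + 1\<close>, in which form it holds in every commutative
  ring.\<close>

lemma char3_pred_square:
  assumes u: "u \<in> carrier R"
  shows "(u \<ominus> \<one>) \<otimes> (u \<ominus> \<one>) = (u \<otimes> u \<oplus> \<one>) \<oplus> u"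
proof -
  have "(u \<ominus> \<one>) \<otimes> (u \<ominus> \<one>) = (u \<otimes> u \<oplus> \<one>) \<oplus> u \<ominus> u \<otimes> (\<one> \<oplus> \<one> \<oplus> \<one>)" using u by algebra
  then show ?thesis unfolding three using u by (simp add: minus_eq)
qed

lemma char3_pred_succ:
  assumes u: "u \<in> carrier R"
  shows "(u \<ominus> \<one>) \<otimes> (u \<oplus> \<one>) = (u \<otimes> u \<oplus> \<one>) \<oplus> \<one>"
proof -
  have "(u \<ominus> \<one>) \<otimes> (u \<oplus> \<one>) = (u \<otimes> u \<oplus> \<one>) \<oplus> \<one> \<ominus> (\<one> \<oplus> \<one> \<oplus> \<one>)" using u by algebra
  then show ?thesis unfolding three using u by (simp add: minus_eq)
qed

lemma char3_succ_square:
  assumes u: "u \<in> carrier R"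
  shows "(u \<oplus> \<one>) \<otimes> (u \<oplus> \<one>) = (u \<otimes> u \<oplus> \<one>) \<ominus> u"
proof -
  have "(u \<oplus> \<one>) \<otimes> (u \<oplus> \<one>) = (u \<otimes> u \<oplus> \<one>) \<ominus> u \<oplus> u \<otimes> (\<one> \<oplus> \<one> \<oplus> \<one>)" using u by algebra
  then show ?thesis unfolding three using u by simp
qed

text \<open>For \<open>s = 1 - t\<close> the \<open>w\<close>-coefficient of
  \<open>(1 + w) ^ 5\<close> is \<open>5 + 10 s + s ^ 2\<close>, which is
  \<open>s ^ 2 + s - 1\<close> in characteristic 3. The third power would only give
  \<open>3 + s = s\<close>, a multiple of the forbidden prime \<open>t - 1\<close>.\<close>

lemma quad_ring_pow5_char3:
  assumes t: "t \<in> carrier R"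
  shows "snd ((\<one>, \<one>) [^]\<^bsub>quad_ring R (\<ominus> (t \<ominus> \<one>))\<^esub> (5::nat)) = t \<otimes> t \<oplus> \<one>"
proof -
  define s where "s = \<ominus> (t \<ominus> \<one>)"
  have s: "s \<in> carrier R" using t by (simp add: s_def)
  have two: "\<one> \<oplus> \<one> = \<ominus> \<one>" using minus_equality[OF three] by simp
  have "snd ((\<one>, \<one>) [^]\<^bsub>quad_ring R s\<^esub> (5::nat)) =
      (\<one> \<oplus> s \<oplus> s \<otimes> (\<one> \<oplus> \<one>) \<oplus> s \<otimes> (\<one> \<oplus> s \<oplus> (\<one> \<oplus> \<one>)))
      \<oplus> (\<one> \<oplus> s \<oplus> (\<one> \<oplus> \<one>) \<oplus> (\<one> \<oplus> s \<oplus> s \<otimes> (\<one> \<oplus> \<one>)))"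
    using s by (simp add: nat_pow_def numeral_eq_Suc a_ac)
  also have "\<dots> = (s \<otimes> s \<oplus> \<one>) \<oplus> s \<oplus> \<one>"
    unfolding two using s by algebra
  also have "\<dots> = t \<otimes> t \<oplus> \<one> \<ominus> (t \<ominus> \<one>) \<otimes> (\<one> \<oplus> \<one> \<oplus> \<one>)"
    unfolding s_def using t by algebra
  finally show ?thesis unfolding three s_def using t by (simp add: minus_eq)
qed

text \<open>Makes \<open>(t, t - 1)\<close> an explicit splitting pair modulo
  \<open>t ^ 2 + 1\<close>: the left side is \<open>2 (t ^ 2 + 1) - 3 t\<close>.\<close>

lemma char3_splitting:
  assumes t: "t \<in> carrier R"
  shows "t \<otimes> t \<oplus> (t \<ominus> \<one>) \<otimes> (t \<ominus> \<one>) \<ominus> (t \<ominus> \<one>) = (t \<otimes> t \<oplus> \<one>) \<otimes> (\<one> \<oplus> \<one>)"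
  unfolding char3_pred_square[OF t] using t by algebra

end

lemma add_pow_one_mult:
  "add_pow R (m * n :: nat) \<one> = add_pow R m \<one> \<otimes> add_pow R n \<one>"
  by (simp add: add_pow_ldistr add.nat_pow_pow mult.commute)

end

section \<open>Characteristic, squares and sums of two squares in finite fields\<close>

context domain
begin

lemma add_pow_order_eq_zero:
  assumes "finite (carrier R)"
  shows "add_pow R (card (carrier R)) \<one> = \<zero>"
  using add.pow_order_eq_1[of \<one>] assms by (simp add: add_pow_def order_def)

text \<open>The multiple \<open>p ^ k\<close> of one vanishes by Lagrange in the additive group. It
  is also the \<open>k\<close>-th power of the multiple \<open>p\<close> of one, and a domain has no
  nilpotents.\<close>

lemma primepow_card_char:
  assumes "primepow (card (carrier R))" "finite (carrier R)"
  obtains p k where "Factorial_Ring.prime (p::nat)" "k > 0" "card (carrier R) = p ^ k" "add_pow R p \<one> = \<zero>"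
proof -
  obtain p k where pk: "Factorial_Ring.prime p" "k > 0" "card (carrier R) = p ^ k"
    using assms unfolding primepow_def by blast
  have "add_pow R (p ^ k) \<one> = \<zero> \<Longrightarrow> add_pow R p \<one> = \<zero>"
  proof (induction k)
    case (Suc k)
    then show ?case
      using integral[of "add_pow R p \<one>" "add_pow R (p ^ k) \<one>"] by (auto simp: add_pow_one_mult)
  qed simp
  with pk that add_pow_order_eq_zero[OF assms(2)] show thesis by auto
qed

end

context field
begin

context
  assumes fin: "finite (carrier R)"
begin

lemma odd_card_two_nonzero:
  assumes "odd (card (carrier R))"
  shows "\<one> \<oplus> \<one> \<noteq> \<zero>"
proof
  assume two: "\<one> \<oplus> \<one> = \<zero>"
  obtain k where k: "card (carrier R) = 2 * k + 1" using assms by (elim oddE)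
  have "add_pow R (2 * k + 1) \<one> = add_pow R (2 * k) \<one> \<oplus> \<one>" by simp
  also have "add_pow R (2 * k) \<one> = add_pow R (2::nat) \<one> \<otimes> add_pow R k \<one>" by (rule add_pow_one_mult)
  also have "add_pow R (2::nat) \<one> = \<zero>" using two by (simp add: numeral_2_eq_2)
  finally show False using add_pow_order_eq_zero[OF fin] k by simp
qed

text \<open>The multiplicative group has order \<open>2 (2 k + 1)\<close>. If
  \<open>w ^ 2 = -1\<close>, the power of \<open>w\<close> to that order would be
  \<open>(-1) ^ (2 k + 1) = -1\<close> instead of 1.\<close>

lemma minus_one_not_square:
  assumes card: "card (carrier R) mod 4 = 3" and w: "w \<in> carrier R"
  shows "w \<otimes> w \<noteq> \<ominus> \<one>"
proof
  assume eq: "w \<otimes> w = \<ominus> \<one>"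
  have two: "\<one> \<oplus> \<one> \<noteq> \<zero>" using card by (intro odd_card_two_nonzero) presburger
  have w0: "w \<noteq> \<zero>" using eq by (metis add.inv_eq_1_iff l_null one_closed one_not_zero zero_closed)
  interpret M: Group.group "Multiplicative_Group.mult_of R" by (rule field_mult_group)
  obtain k where "card (carrier R) = 4 * k + 3" using card by (metis mult_div_mod_eq)
  then have k: "order (Multiplicative_Group.mult_of R) = 2 * (2 * k + 1)" using fin by (simp add: order_def)
  have "w [^] (2 * (2 * k + 1)) = \<one>"
    using M.pow_order_eq_1[of w] w w0 unfolding k by (simp only: Multiplicative_Group.nat_pow_mult_of Multiplicative_Group.one_mult_of
      Multiplicative_Group.carrier_mult_of) simp
  moreover have "w [^] (2 * (2 * k + 1)) = (\<ominus> \<one>) [^] (2 * k + 1)"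
    using w eq nat_pow_pow[of w 2 "2 * k + 1"] by (simp add: numeral_2_eq_2 del: nat_pow_Suc add: nat_pow_Suc[of _ "Suc 0"] nat_pow_Suc[of _ 0])
  moreover have "(\<ominus> \<one>) [^] (2 * k + 1) = \<ominus> \<one>"
    by (induction k) (simp_all add: l_minus r_minus)
  ultimately show False using two by (metis l_neg one_closed)
qed

text \<open>Pigeonhole: squaring is at most two-to-one and the order is odd, so the set of squares
  and its image under \<open>s \<mapsto> c - s\<close> each fill more than half of the field and
  meet.\<close>

lemma sum_two_squares:
  assumes odd: "odd (card (carrier R))" and c: "c \<in> carrier R"
  obtains a b where "a \<in> carrier R" "b \<in> carrier R" "a \<otimes> a \<oplus> b \<otimes> b = c"
proof -
  let ?C = "carrier R"
  define S where "S = (\<lambda>x. x \<otimes> x) ` ?C"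
  define T where "T = (\<lambda>s. c \<ominus> s) ` S"
  have S: "S \<subseteq> ?C" and T: "T \<subseteq> ?C" using c unfolding S_def T_def by auto
  have finS: "finite S" "finite T" using fin unfolding S_def T_def by auto
  have "inj_on (\<lambda>s. c \<ominus> s) S"
  proof (rule inj_onI)
    fix x y assume xy: "x \<in> S" "y \<in> S" "c \<ominus> x = c \<ominus> y"
    then have "x \<in> ?C" "y \<in> ?C" using S by auto
    with xy c show "x = y" by (metis a_minus_def add.inv_closed add.l_cancel minus_minus)
  qed
  then have cT: "card T = card S" unfolding T_def by (rule card_image)
  have fib: "card {x \<in> ?C. x \<otimes> x = s} \<le> 2" if s: "s \<in> S" for s
  proof -
    obtain v where v: "v \<in> ?C" "s = v \<otimes> v" using s unfolding S_def by auto
    have "{x \<in> ?C. x \<otimes> x = s} \<subseteq> {v, \<ominus> v}"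
    proof
      fix x assume "x \<in> {x \<in> ?C. x \<otimes> x = s}"
      then have x: "x \<in> ?C" "x \<otimes> x = v \<otimes> v" using v by auto
      have "(x \<ominus> v) \<otimes> (x \<oplus> v) = x \<otimes> x \<ominus> v \<otimes> v" using x(1) v(1) by algebra
      also have "\<dots> = \<zero>" using x v by simp
      finally have "x \<ominus> v = \<zero> \<or> x \<oplus> v = \<zero>" using x(1) v(1) integral by blast
      then show "x \<in> {v, \<ominus> v}" using x v minus_equality[of x v] by auto
    qed
    then have "card {x \<in> ?C. x \<otimes> x = s} \<le> card {v, \<ominus> v}" by (intro card_mono) auto
    also have "\<dots> \<le> 2" by (simp add: card_insert_if)
    finally show ?thesis .
  qed
  have "?C = (\<Union>s\<in>S. {x \<in> ?C. x \<otimes> x = s})" unfolding S_def by auto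
  then have "card ?C \<le> (\<Sum>s\<in>S. card {x \<in> ?C. x \<otimes> x = s})"
    using card_UN_le[OF finS(1), of "\<lambda>s. {x \<in> ?C. x \<otimes> x = s}"] by simp
  also have "\<dots> \<le> (\<Sum>s\<in>S. 2)" using fib by (rule sum_mono)
  finally have "card ?C \<le> 2 * card S" by simp
  with odd have "card ?C < card S + card T" unfolding cT by presburger
  moreover have "card (S \<union> T) \<le> card ?C" using S T fin by (intro card_mono) auto
  ultimately have "S \<inter> T \<noteq> {}" using card_Un_disjoint[OF finS] by auto
  then obtain a b where ab: "a \<in> ?C" "b \<in> ?C" "a \<otimes> a = c \<ominus> b \<otimes> b"
    unfolding S_def T_def by blast
  then have "a \<otimes> a \<oplus> b \<otimes> b = c" using c by (simp add: minus_eq a_assoc l_neg)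
  with ab that show thesis by blast
qed

end

end

section \<open>Quaternions over a commutative ring\<close>

context cring
begin

text \<open>This is \<open>reduce_quat\<close> for \<open>\<nu> = -1\<close> over an arbitrary ring:
  \<open>i\<close> goes to \<open>(0, -1, 1, 0)\<close>, \<open>j\<close> to
  \<open>(a, b, b, -a)\<close> and \<open>i j\<close> to their product
  \<open>(-b, a, a, b)\<close>.\<close>

fun qmat :: "'a \<Rightarrow> 'a \<Rightarrow> 'a \<times> 'a \<times> 'a \<times> 'a \<Rightarrow> 'a mat2" where
  "qmat a b (y1, y2, y3, y4) =
     (y1 \<oplus> (a \<otimes> y3 \<ominus> b \<otimes> y4), (b \<otimes> y3 \<oplus> a \<otimes> y4) \<ominus> y2,
      y2 \<oplus> (b \<otimes> y3 \<oplus> a \<otimes> y4), y1 \<ominus> (a \<otimes> y3 \<ominus> b \<otimes> y4))"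

fun qnorm :: "'a \<Rightarrow> 'a \<times> 'a \<times> 'a \<times> 'a \<Rightarrow> 'a" where
  "qnorm c (y1, y2, y3, y4) = y1 \<otimes> y1 \<oplus> y2 \<otimes> y2 \<ominus> c \<otimes> (y3 \<otimes> y3 \<oplus> y4 \<otimes> y4)"

text \<open>Right multiplication by \<open>1 + \<gamma> j + \<delta> i j\<close> in the order with
  \<open>i ^ 2 = -1\<close> and \<open>j ^ 2 = c\<close>.\<close>

fun qstep :: "'a \<Rightarrow> 'a \<Rightarrow> 'a \<Rightarrow> 'a \<times> 'a \<times> 'a \<times> 'a \<Rightarrow> 'a \<times> 'a \<times> 'a \<times> 'a" where
  "qstep c \<gamma> \<delta> (y1, y2, y3, y4) =
     (y1 \<oplus> c \<otimes> (y3 \<otimes> \<gamma> \<oplus> y4 \<otimes> \<delta>), y2 \<oplus> c \<otimes> (y4 \<otimes> \<gamma> \<ominus> y3 \<otimes> \<delta>),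
      y3 \<oplus> (y1 \<otimes> \<gamma> \<ominus> y2 \<otimes> \<delta>), y4 \<oplus> (y1 \<otimes> \<delta> \<oplus> y2 \<otimes> \<gamma>))"

lemma qnorm_qstep:
  assumes "y \<in> carrier R \<times> carrier R \<times> carrier R \<times> carrier R"
    and cl: "c \<in> carrier R" "\<gamma> \<in> carrier R" "\<delta> \<in> carrier R"
  shows "qnorm c (qstep c \<gamma> \<delta> y) = qnorm c y \<otimes> qnorm c (\<one>, \<zero>, \<gamma>, \<delta>)"
proof -
  obtain y1 y2 y3 y4 where [simp]: "y = (y1, y2, y3, y4)" by (cases y)
  have "y1 \<in> carrier R" "y2 \<in> carrier R" "y3 \<in> carrier R" "y4 \<in> carrier R" using assms by auto
  note y = this
  \<comment> \<open>With \<open>\<alpha> = y1 + y2 i\<close>, \<open>\<beta> = y3 + y4 i\<close>,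
    \<open>\<theta> = \<gamma> + \<delta> i\<close> and \<open>\<theta>'\<close> the conjugate of
    \<open>\<theta>\<close>, the product is \<open>(\<alpha> + c \<beta> \<theta>') + (\<beta> +
    \<alpha> \<theta>) j\<close>. Here \<open>A1 + A2 i\<close> is \<open>\<beta> \<theta>'\<close>
    and \<open>B1 + B2 i\<close> is \<open>\<alpha> \<theta>\<close>. Both norms produce the same
    cross term \<open>2 E\<close>, so these cancel.\<close>
  define A1 A2 B1 B2 where AB: "A1 = y3 \<otimes> \<gamma> \<oplus> y4 \<otimes> \<delta>" "A2 = y4 \<otimes> \<gamma> \<ominus> y3 \<otimes> \<delta>"
    "B1 = y1 \<otimes> \<gamma> \<ominus> y2 \<otimes> \<delta>" "B2 = y1 \<otimes> \<delta> \<oplus> y2 \<otimes> \<gamma>"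
  define n m k E where nm: "n = y1 \<otimes> y1 \<oplus> y2 \<otimes> y2" "m = y3 \<otimes> y3 \<oplus> y4 \<otimes> y4" "k = \<gamma> \<otimes> \<gamma> \<oplus> \<delta> \<otimes> \<delta>"
    and E: "E = y1 \<otimes> A1 \<oplus> y2 \<otimes> A2"
  have clAB: "A1 \<in> carrier R" "A2 \<in> carrier R" "B1 \<in> carrier R" "B2 \<in> carrier R"
    unfolding AB using y cl by simp_all
  have clnm: "n \<in> carrier R" "m \<in> carrier R" "k \<in> carrier R" "E \<in> carrier R"
    unfolding nm E using y cl clAB by simp_all
  have A: "A1 \<otimes> A1 \<oplus> A2 \<otimes> A2 = m \<otimes> k" unfolding AB nm using y cl by algebra
  have B: "B1 \<otimes> B1 \<oplus> B2 \<otimes> B2 = n \<otimes> k" unfolding AB nm using y cl by algebra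
  have E': "y3 \<otimes> B1 \<oplus> y4 \<otimes> B2 = E" unfolding E AB using y cl by algebra
  have "(y1 \<oplus> c \<otimes> A1) \<otimes> (y1 \<oplus> c \<otimes> A1) \<oplus> (y2 \<oplus> c \<otimes> A2) \<otimes> (y2 \<oplus> c \<otimes> A2)
      = n \<oplus> c \<otimes> (E \<oplus> E) \<oplus> c \<otimes> c \<otimes> (A1 \<otimes> A1 \<oplus> A2 \<otimes> A2)"
    unfolding nm E using y clAB cl by algebra
  moreover have "(y3 \<oplus> B1) \<otimes> (y3 \<oplus> B1) \<oplus> (y4 \<oplus> B2) \<otimes> (y4 \<oplus> B2)
      = m \<oplus> (E \<oplus> E) \<oplus> (B1 \<otimes> B1 \<oplus> B2 \<otimes> B2)"
    unfolding nm E'[symmetric] using y clAB by algebra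
  ultimately have "qnorm c (qstep c \<gamma> \<delta> y)
      = n \<oplus> c \<otimes> (E \<oplus> E) \<oplus> c \<otimes> c \<otimes> (m \<otimes> k) \<ominus> c \<otimes> (m \<oplus> (E \<oplus> E) \<oplus> n \<otimes> k)"
    by (simp only: \<open>y = _\<close> qstep.simps qnorm.simps AB[symmetric] A B)
  also have "\<dots> = (n \<ominus> c \<otimes> m) \<otimes> (\<one> \<ominus> c \<otimes> k)" using clnm cl by algebra
  finally show ?thesis using cl by (simp add: nm)
qed

lemma qmat_closed:
  assumes "y \<in> carrier R \<times> carrier R \<times> carrier R \<times> carrier R" and "a \<in> carrier R" "b \<in> carrier R"
  shows "qmat a b y \<in> carrier R \<times> carrier R \<times> carrier R \<times> carrier R"
  using assms by (cases y) simp

lemma det_qmat: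
  assumes "y \<in> carrier R \<times> carrier R \<times> carrier R \<times> carrier R" and ab: "a \<in> carrier R" "b \<in> carrier R"
  shows "mat2_det R (qmat a b y) = qnorm (a \<otimes> a \<oplus> b \<otimes> b) y"
proof -
  obtain y1 y2 y3 y4 where [simp]: "y = (y1, y2, y3, y4)" by (cases y)
  have "y1 \<in> carrier R" "y2 \<in> carrier R" "y3 \<in> carrier R" "y4 \<in> carrier R" using assms by auto
  note y = this
  define f h where fh: "f = a \<otimes> y3 \<ominus> b \<otimes> y4" "h = b \<otimes> y3 \<oplus> a \<otimes> y4"
  have cl: "f \<in> carrier R" "h \<in> carrier R" unfolding fh using y ab by simp_all
  have "mat2_det R (qmat a b y) = (y1 \<oplus> f) \<otimes> (y1 \<ominus> f) \<ominus> (h \<ominus> y2) \<otimes> (y2 \<oplus> h)"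
    by (simp only: \<open>y = _\<close> qmat.simps mat2_det.simps fh)
  also have "\<dots> = y1 \<otimes> y1 \<oplus> y2 \<otimes> y2 \<ominus> (f \<otimes> f \<oplus> h \<otimes> h)" using y cl by algebra
  also have "f \<otimes> f \<oplus> h \<otimes> h = (a \<otimes> a \<oplus> b \<otimes> b) \<otimes> (y3 \<otimes> y3 \<oplus> y4 \<otimes> y4)"
    unfolding fh using y ab by algebra
  finally show ?thesis by simp
qed

lemma qmat_qstep:
  assumes "y \<in> carrier R \<times> carrier R \<times> carrier R \<times> carrier R" and ab: "a \<in> carrier R" "b \<in> carrier R"
    and cl: "\<gamma> \<in> carrier R" "\<delta> \<in> carrier R"
  shows "qmat a b (qstep (a \<otimes> a \<oplus> b \<otimes> b) \<gamma> \<delta> y) = mat2_mult R (qmat a b y) (qmat a b (\<one>, \<zero>, \<gamma>, \<delta>))"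
proof -
  obtain y1 y2 y3 y4 where [simp]: "y = (y1, y2, y3, y4)" by (cases y)
  have "y1 \<in> carrier R" "y2 \<in> carrier R" "y3 \<in> carrier R" "y4 \<in> carrier R" using assms by auto
  note y = this
  \<comment> \<open>In these variables the parameters \<open>a\<close> and \<open>b\<close>
    disappear from all matrix entries.\<close>
  define f h \<phi> \<eta> where fh: "f = a \<otimes> y3 \<ominus> b \<otimes> y4" "h = b \<otimes> y3 \<oplus> a \<otimes> y4"
    "\<phi> = a \<otimes> \<gamma> \<ominus> b \<otimes> \<delta>" "\<eta> = b \<otimes> \<gamma> \<oplus> a \<otimes> \<delta>"
  have cl': "f \<in> carrier R" "h \<in> carrier R" "\<phi> \<in> carrier R" "\<eta> \<in> carrier R" unfolding fh using y ab cl by simp_all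
  have I1: "(a \<otimes> a \<oplus> b \<otimes> b) \<otimes> (y3 \<otimes> \<gamma> \<oplus> y4 \<otimes> \<delta>) = f \<otimes> \<phi> \<oplus> h \<otimes> \<eta>"
    unfolding fh using y ab cl by algebra
  have I2: "(a \<otimes> a \<oplus> b \<otimes> b) \<otimes> (y4 \<otimes> \<gamma> \<ominus> y3 \<otimes> \<delta>) = h \<otimes> \<phi> \<ominus> f \<otimes> \<eta>"
    unfolding fh using y ab cl by algebra
  have I3: "a \<otimes> (y3 \<oplus> (y1 \<otimes> \<gamma> \<ominus> y2 \<otimes> \<delta>)) \<ominus> b \<otimes> (y4 \<oplus> (y1 \<otimes> \<delta> \<oplus> y2 \<otimes> \<gamma>)) = f \<oplus> (y1 \<otimes> \<phi> \<ominus> y2 \<otimes> \<eta>)"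
    unfolding fh using y ab cl by algebra
  have I4: "b \<otimes> (y3 \<oplus> (y1 \<otimes> \<gamma> \<ominus> y2 \<otimes> \<delta>)) \<oplus> a \<otimes> (y4 \<oplus> (y1 \<otimes> \<delta> \<oplus> y2 \<otimes> \<gamma>)) = h \<oplus> (y1 \<otimes> \<eta> \<oplus> y2 \<otimes> \<phi>)"
    unfolding fh using y ab cl by algebra
  have "qmat a b (\<one>, \<zero>, \<gamma>, \<delta>) = (\<one> \<oplus> \<phi>, \<eta> \<ominus> \<zero>, \<zero> \<oplus> \<eta>, \<one> \<ominus> \<phi>)"
    by (simp only: qmat.simps fh)
  also have "\<dots> = (\<one> \<oplus> \<phi>, \<eta>, \<eta>, \<one> \<ominus> \<phi>)" using cl' by (simp add: minus_eq)
  finally have "qmat a b (\<one>, \<zero>, \<gamma>, \<delta>) = (\<one> \<oplus> \<phi>, \<eta>, \<eta>, \<one> \<ominus> \<phi>)" .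
  moreover have "qmat a b y = (y1 \<oplus> f, h \<ominus> y2, y2 \<oplus> h, y1 \<ominus> f)"
    by (simp only: \<open>y = _\<close> qmat.simps fh)
  ultimately show ?thesis
    unfolding \<open>y = _\<close> qstep.simps qmat.simps[of a b "y1 \<oplus> _"] I1 I2 I3 I4
    by (simp only: mat2_mult.simps prod.inject) (intro conjI; (insert y cl', algebra))
qed

text \<open>The class of \<open>(0, -1, 1, 0)\<close>, the image of the unit \<open>i\<close>, only contains reductions of
  quaternions congruent to a multiple of \<open>i\<close>.\<close>

lemma qmat_eq_scaled_i:
  assumes cl: "y1 \<in> carrier R" "y2 \<in> carrier R" "y3 \<in> carrier R" "y4 \<in> carrier R"
      "a \<in> carrier R" "b \<in> carrier R" "u \<in> carrier R"
    and two: "\<one> \<oplus> \<one> \<in> Units R" and c: "a \<otimes> a \<oplus> b \<otimes> b \<in> Units R"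
    and eq: "qmat a b (y1, y2, y3, y4) = mat2_mult R (u, \<zero>, \<zero>, u) (\<zero>, \<ominus> \<one>, \<one>, \<zero>)"
  shows "y1 = \<zero>" "y3 = \<zero>" "y4 = \<zero>"
proof -
  define f where "f = a \<otimes> y3 \<ominus> b \<otimes> y4"
  define h where "h = b \<otimes> y3 \<oplus> a \<otimes> y4"
  have fh: "f \<in> carrier R" "h \<in> carrier R" using cl by (simp_all add: f_def h_def)
  have "mat2_mult R (u, \<zero>, \<zero>, u) (\<zero>, \<ominus> \<one>, \<one>, \<zero>) = (\<zero>, \<ominus> u, u, \<zero>)"
    using cl by (simp add: r_minus)
  then have "(y1 \<oplus> f, h \<ominus> y2, y2 \<oplus> h, y1 \<ominus> f) = (\<zero>, \<ominus> u, u, \<zero>)"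
    using eq by (simp only: qmat.simps f_def h_def)
  then have e: "y1 \<oplus> f = \<zero>" "h \<ominus> y2 = \<ominus> u" "y2 \<oplus> h = u" "y1 \<ominus> f = \<zero>"
    by blast+
  \<comment> \<open>A multiple of \<open>(0, -1, 1, 0)\<close> has zero diagonal and is
    antisymmetric: adding the diagonal entries isolates \<open>2 y1\<close>, adding the other two
    isolates \<open>2 h\<close>.\<close>
  have "(\<one> \<oplus> \<one>) \<otimes> y1 = (y1 \<oplus> f) \<oplus> (y1 \<ominus> f)" using cl fh by algebra
  then have "(\<one> \<oplus> \<one>) \<otimes> y1 = (\<one> \<oplus> \<one>) \<otimes> \<zero>" using e by simp
  then show y1: "y1 = \<zero>" using Units_l_cancel[OF two] cl by blast
  then have f0: "f = \<zero>" using e(1) fh by simp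
  have "(\<one> \<oplus> \<one>) \<otimes> h = (h \<ominus> y2) \<oplus> (y2 \<oplus> h)" using cl fh by algebra
  then have "(\<one> \<oplus> \<one>) \<otimes> h = (\<one> \<oplus> \<one>) \<otimes> \<zero>" using e cl by (simp add: l_neg)
  then have h0: "h = \<zero>" using Units_l_cancel[OF two] fh by blast
  \<comment> \<open>\<open>(f, h)\<close> arises from \<open>(y3, y4)\<close> by a matrix of
    determinant \<open>a ^ 2 + b ^ 2\<close>; its adjugate recovers \<open>y3\<close> and
    \<open>y4\<close>.\<close>
  have "(a \<otimes> a \<oplus> b \<otimes> b) \<otimes> y3 = a \<otimes> f \<oplus> b \<otimes> h" unfolding f_def h_def
    using cl by algebra
  then have "(a \<otimes> a \<oplus> b \<otimes> b) \<otimes> y3 = (a \<otimes> a \<oplus> b \<otimes> b) \<otimes> \<zero>" using f0 h0 cl by simp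
  then show "y3 = \<zero>" using Units_l_cancel[OF c] cl by blast
  have "(a \<otimes> a \<oplus> b \<otimes> b) \<otimes> y4 = a \<otimes> h \<ominus> b \<otimes> f" unfolding f_def h_def
    using cl by algebra
  then have "(a \<otimes> a \<oplus> b \<otimes> b) \<otimes> y4 = (a \<otimes> a \<oplus> b \<otimes> b) \<otimes> \<zero>" using f0 h0 cl by simp
  then show "y4 = \<zero>" using Units_l_cancel[OF c] cl by blast
qed

lemma qnorm_rearrange:
  assumes "x1 \<in> carrier R" "x2 \<in> carrier R" "x3 \<in> carrier R" "x4 \<in> carrier R" "c \<in> carrier R"
  shows "x2 \<otimes> x2 \<ominus> qnorm c (x1, x2, x3, x4) = c \<otimes> (x3 \<otimes> x3 \<oplus> x4 \<otimes> x4) \<ominus> x1 \<otimes> x1"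
  unfolding qnorm.simps using assms by algebra

text \<open>For \<open>w = \<gamma> j + \<delta> i j\<close> the hypothesis \<open>gd\<close> gives
  \<open>w ^ 2 = -c\<close>, and the step is the product \<open>(a + b w) (1 + w)\<close>.\<close>

lemma qstep_pure:
  assumes ab: "a \<in> carrier R" "b \<in> carrier R" "c \<in> carrier R" "\<gamma> \<in> carrier R" "\<delta> \<in> carrier R"
    and gd: "\<gamma> \<otimes> \<gamma> \<oplus> \<delta> \<otimes> \<delta> = \<ominus> \<one>"
  shows "qstep c \<gamma> \<delta> (a, \<zero>, b \<otimes> \<gamma>, b \<otimes> \<delta>) = (a \<ominus> c \<otimes> b, \<zero>, (a \<oplus> b) \<otimes> \<gamma>, (a \<oplus> b) \<otimes> \<delta>)"
proof -
  have "a \<oplus> c \<otimes> (b \<otimes> \<gamma> \<otimes> \<gamma> \<oplus> b \<otimes> \<delta> \<otimes> \<delta>) = a \<oplus> c \<otimes> b \<otimes> (\<gamma> \<otimes> \<gamma> \<oplus> \<delta> \<otimes> \<delta>)"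
    using ab by algebra
  also have "\<dots> = a \<ominus> c \<otimes> b" unfolding gd using ab by (simp add: minus_eq r_minus)
  finally have 1: "a \<oplus> c \<otimes> (b \<otimes> \<gamma> \<otimes> \<gamma> \<oplus> b \<otimes> \<delta> \<otimes> \<delta>) = a \<ominus> c \<otimes> b" .
  have 2: "\<zero> \<oplus> c \<otimes> (b \<otimes> \<delta> \<otimes> \<gamma> \<ominus> b \<otimes> \<gamma> \<otimes> \<delta>) = \<zero>"
    using ab by algebra
  have 3: "b \<otimes> \<gamma> \<oplus> (a \<otimes> \<gamma> \<ominus> \<zero> \<otimes> \<delta>) = (a \<oplus> b) \<otimes> \<gamma>"
    using ab by algebra
  have 4: "b \<otimes> \<delta> \<oplus> (a \<otimes> \<delta> \<oplus> \<zero> \<otimes> \<gamma>) = (a \<oplus> b) \<otimes> \<delta>"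
    using ab by algebra
  show ?thesis unfolding qstep.simps 1 2 3 4 ..
qed

lemma qnorm_alt:
  assumes "x1 \<in> carrier R" "x2 \<in> carrier R" "x3 \<in> carrier R" "x4 \<in> carrier R" "c \<in> carrier R"
  shows "(x1 \<otimes> x1 \<ominus> (\<ominus> \<one>) \<otimes> (x2 \<otimes> x2)) \<ominus> c \<otimes> (x3 \<otimes> x3 \<ominus> (\<ominus> \<one>) \<otimes> (x4 \<otimes> x4))
    = qnorm c (x1, x2, x3, x4)"
  using assms by (simp add: l_minus) algebra

section \<open>Divisibility in commutative rings\<close>

lemma divides_add:
  assumes "d divides a" "d divides b" "d \<in> carrier R"
  shows "d divides (a \<oplus> b)"
proof -
  obtain x y where "x \<in> carrier R" "a = d \<otimes> x" "y \<in> carrier R" "b = d \<otimes> y"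
    using assms unfolding factor_def by blast
  then show ?thesis using assms(3) by (intro dividesI[of "x \<oplus> y"]) (auto simp: r_distr)
qed

lemma divides_uminus:
  assumes "d divides a" "d \<in> carrier R"
  shows "d divides (\<ominus> a)"
proof -
  obtain x where "x \<in> carrier R" "a = d \<otimes> x"
    using assms unfolding factor_def by blast
  then show ?thesis using assms(2) by (intro dividesI[of "\<ominus> x"]) (auto simp: r_minus)
qed

lemma divides_minus:
  assumes "d divides a" "d divides b" "d \<in> carrier R"
  shows "d divides (a \<ominus> b)"
  unfolding minus_eq by (intro divides_add divides_uminus assms)

lemma divides_minus_cancel:
  assumes "d divides a" "d divides (a \<ominus> b)" "d \<in> carrier R" "a \<in> carrier R" "b \<in> carrier R"
  shows "d divides b"
proof -
  have "a \<ominus> (a \<ominus> b) = b" using assms(4,5) by algebra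
  then show ?thesis using divides_minus[OF assms(1-3)] by simp
qed

lemma divides_pow_mono:
  assumes "d \<in> carrier R" "m \<le> (n::nat)"
  shows "(d [^] m) divides (d [^] n)"
proof (rule dividesI)
  show "d [^] n = d [^] m \<otimes> d [^] (n - m)" using assms by (simp add: nat_pow_mult)
qed (use assms in simp)

lemma divides_pow:
  assumes "d divides a" "d \<in> carrier R"
  shows "(d [^] (n::nat)) divides (a [^] n)"
proof -
  obtain z where "z \<in> carrier R" "a = d \<otimes> z" using assms by (auto simp: factor_def)
  then show ?thesis using assms by (intro dividesI[of "z [^] n"]) (auto simp: nat_pow_distrib)
qed

lemma minus_minus_one_mult:
  assumes "t \<in> carrier R"
  shows "\<one> \<oplus> \<zero> \<ominus> (t \<ominus> \<one>) \<otimes> (\<ominus> \<one>) = t"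
  using assms by algebra

end

section \<open>Polynomials over the finite field\<close>

locale finite_field_3_mod_4 = field F for F :: "'a ring" (structure) +
  assumes fin: "finite (carrier F)"
    and card_mod: "card (carrier F) mod 4 = 3"
    and card_pp: "primepow (card (carrier F))"
begin

abbreviation "K \<equiv> poly_ring F"
abbreviation "T \<equiv> X\<^bsub>F\<^esub>"
abbreviation "c \<equiv> t_minus_1 F"
abbreviation (input) "pc \<equiv> pconst F"

sublocale K: principal_domain "poly_ring F"
  by (rule univ_poly_is_principal[OF carrier_is_subfield])

lemma K_zero: "\<zero>\<^bsub>K\<^esub> = []"
  by (simp add: univ_poly_zero)

lemma T_closed [simp, intro]: "T \<in> carrier K"
  by (rule var_closed(1)[OF carrier_is_subring])

lemma c_def: "c = T \<ominus>\<^bsub>K\<^esub> \<one>\<^bsub>K\<^esub>"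
  by (simp add: t_minus_1_def)

lemma c_closed [simp, intro]: "c \<in> carrier K"
  by (simp add: c_def)

text \<open>Degrees are controlled through lengths: a non-zero polynomial has length degree plus one
  and zero is the empty list, whereas \<open>degree\<close> does not separate zero from the
  constants.\<close>

lemma length_add_le:
  assumes "length p \<le> n" "length r \<le> n"
  shows "length (p \<oplus>\<^bsub>K\<^esub> r) \<le> n"
  using poly_add_length_le[of p r] assms by (simp add: univ_poly_add)

lemma length_uminus [simp]: "p \<in> carrier K \<Longrightarrow> length (\<ominus>\<^bsub>K\<^esub> p) = length p"
  by (rule univ_poly_a_inv_length[OF carrier_is_subring])

lemma length_minus_le:
  assumes "length p \<le> n" "length r \<le> n" "r \<in> carrier K"
  shows "length (p \<ominus>\<^bsub>K\<^esub> r) \<le> n"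
  using length_add_le[of p n "\<ominus>\<^bsub>K\<^esub> r"] assms by (simp add: K.minus_eq)

lemma length_add_eq:
  assumes "p \<in> carrier K" "r \<in> carrier K" "length r < length p"
  shows "length (p \<oplus>\<^bsub>K\<^esub> r) = length p"
  using poly_add_length_eq[OF carrier_is_subring, of p r] assms
  by (simp add: univ_poly_add univ_poly_carrier)

lemma length_minus_eq:
  assumes "p \<in> carrier K" "r \<in> carrier K" "length r < length p"
  shows "length (p \<ominus>\<^bsub>K\<^esub> r) = length p"
  using length_add_eq[of p "\<ominus>\<^bsub>K\<^esub> r"] assms by (simp add: K.minus_eq)

lemma length_mult:
  assumes "p \<in> carrier K" "r \<in> carrier K" "p \<noteq> \<zero>\<^bsub>K\<^esub>" "r \<noteq> \<zero>\<^bsub>K\<^esub>"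
  shows "length (p \<otimes>\<^bsub>K\<^esub> r) + 1 = length p + length r"
proof -
  have "length (p \<otimes>\<^bsub>K\<^esub> r) - 1 = (length p - 1) + (length r - 1)"
    using poly_mult_degree_eq[OF carrier_is_subring, of p r] assms
    by (simp add: univ_poly_mult univ_poly_carrier K_zero)
  moreover have "p \<otimes>\<^bsub>K\<^esub> r \<noteq> []" using assms K.integral_iff[of p r] by (simp add: K_zero)
  ultimately show ?thesis using assms by (cases p; cases r; cases "p \<otimes>\<^bsub>K\<^esub> r") (auto simp: K_zero)
qed

lemma length_mult_le:
  assumes "p \<in> carrier K" "r \<in> carrier K" "length p \<le> m" "length r \<le> Suc n"
  shows "length (p \<otimes>\<^bsub>K\<^esub> r) \<le> m + n"
proof (cases "p = \<zero>\<^bsub>K\<^esub> \<or> r = \<zero>\<^bsub>K\<^esub>")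
  case True
  then have "p \<otimes>\<^bsub>K\<^esub> r = \<zero>\<^bsub>K\<^esub>" using assms by auto
  then show ?thesis by (simp add: K_zero)
next
  case False
  then show ?thesis using length_mult[of p r] assms by simp
qed

lemma length_T_pow [simp]: "length (T [^]\<^bsub>K\<^esub> (n::nat)) = n + 1"
proof (induction n)
  case (Suc n)
  have "T [^]\<^bsub>K\<^esub> n \<noteq> \<zero>\<^bsub>K\<^esub>" using Suc by (auto simp: K_zero)
  moreover have "T \<noteq> \<zero>\<^bsub>K\<^esub>" "length T = 2" by (simp_all add: K_zero var_def)
  ultimately show ?case using length_mult[of "T [^]\<^bsub>K\<^esub> n" T] Suc by simp
qed (simp add: univ_poly_one)

lemma divides_short_imp_zero:
  assumes "d divides\<^bsub>K\<^esub> p" "d \<in> carrier K" "length p < length d"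
  shows "p = \<zero>\<^bsub>K\<^esub>"
proof (rule ccontr)
  assume p: "p \<noteq> \<zero>\<^bsub>K\<^esub>"
  obtain z where z: "z \<in> carrier K" "p = d \<otimes>\<^bsub>K\<^esub> z" using assms by (auto simp: factor_def)
  have "d \<noteq> \<zero>\<^bsub>K\<^esub>" "z \<noteq> \<zero>\<^bsub>K\<^esub>" using p z(1) assms(2) unfolding z(2) by auto
  moreover from this have "1 \<le> length z" by (cases z) (simp_all add: K_zero)
  ultimately show False using length_mult[of d z] z(1) assms(2,3) unfolding z(2) by linarith
qed

lemma eval_hom: "a \<in> carrier F \<Longrightarrow> ring_hom_cring K F (\<lambda>p. eval p a)"
  by (rule eval_cring_hom[OF carrier_is_subring])

lemma pconst_hom: "ring_hom_ring F K pc"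
  unfolding pconst_def using canonical_embedding_ring_hom[OF carrier_is_subring] by simp

lemma pconst_closed [simp, intro]: "a \<in> carrier F \<Longrightarrow> pc a \<in> carrier K"
  using ring_hom_closed[OF ring_hom_ring.homh[OF pconst_hom]] .

lemma pconst_minus_one: "pc (\<ominus> \<one>) = \<ominus>\<^bsub>K\<^esub> \<one>\<^bsub>K\<^esub>"
proof -
  interpret h: ring_hom_ring F K pc by (rule pconst_hom)
  show ?thesis by simp
qed

lemma length_pconst: "length (pc a) \<le> 1"
  unfolding pconst_def poly_of_const_def using normalize_length_le[of "[a]"] by simp

lemma add_pow_K: "add_pow F (n::nat) \<one> = \<zero> \<Longrightarrow> add_pow K n \<one>\<^bsub>K\<^esub> = \<zero>\<^bsub>K\<^esub>"
proof -
  interpret h: ring_hom_ring F K pc by (rule pconst_hom)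
  have "pc (add_pow F n \<one>) = add_pow K n \<one>\<^bsub>K\<^esub>" by (induction n) simp_all
  then show "add_pow F n \<one> = \<zero> \<Longrightarrow> add_pow K n \<one>\<^bsub>K\<^esub> = \<zero>\<^bsub>K\<^esub>" by simp
qed

section \<open>Basic quaternions and their products\<close>

lemma quat_norm_eq_qnorm:
  assumes "z \<in> carrier K \<times> carrier K \<times> carrier K \<times> carrier K"
  shows "quat_norm F (\<ominus> \<one>) z = K.qnorm c z"
proof -
  obtain x1 x2 x3 x4 where [simp]: "z = (x1, x2, x3, x4)" by (cases z)
  have "x1 \<in> carrier K" "x2 \<in> carrier K" "x3 \<in> carrier K" "x4 \<in> carrier K" using assms by auto
  then show ?thesis
    using K.qnorm_alt[OF _ _ _ _ c_closed, of x1 x2 x3 x4] by (simp only: quat_norm.simps pconst_minus_one \<open>z = _\<close>)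
qed

lemma basic_quatsE:
  assumes "s \<in> basic_quats F (\<ominus> \<one>)"
  obtains \<gamma> \<delta> where "\<gamma> \<in> carrier K" "\<delta> \<in> carrier K" "length \<gamma> \<le> 1" "length \<delta> \<le> 1"
    "s = (\<one>\<^bsub>K\<^esub>, \<zero>\<^bsub>K\<^esub>, \<gamma>, \<delta>)" "K.qnorm c (\<one>\<^bsub>K\<^esub>, \<zero>\<^bsub>K\<^esub>, \<gamma>, \<delta>) = T"
proof -
  obtain \<gamma> \<delta> where gd: "\<gamma> \<in> carrier F" "\<delta> \<in> carrier F" "s = (\<one>\<^bsub>K\<^esub>, \<zero>\<^bsub>K\<^esub>, pc \<gamma>, pc \<delta>)"
      "quat_norm F (\<ominus> \<one>) (\<one>\<^bsub>K\<^esub>, \<zero>\<^bsub>K\<^esub>, pc \<gamma>, pc \<delta>) = T"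
    using assms unfolding basic_quats_def by blast
  then show thesis
    using that[of "pc \<gamma>" "pc \<delta>"] quat_norm_eq_qnorm[of "(\<one>\<^bsub>K\<^esub>, \<zero>\<^bsub>K\<^esub>, pc \<gamma>, pc \<delta>)"] length_pconst by simp
qed

lemma basic_quat_exists:
  obtains \<gamma> \<delta> where "\<gamma> \<in> carrier K" "\<delta> \<in> carrier K"
    "\<gamma> \<otimes>\<^bsub>K\<^esub> \<gamma> \<oplus>\<^bsub>K\<^esub> \<delta> \<otimes>\<^bsub>K\<^esub> \<delta> = \<ominus>\<^bsub>K\<^esub> \<one>\<^bsub>K\<^esub>" "(\<one>\<^bsub>K\<^esub>, \<zero>\<^bsub>K\<^esub>, \<gamma>, \<delta>) \<in> basic_quats F (\<ominus> \<one>)"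
proof -
  interpret h: ring_hom_ring F K pc by (rule pconst_hom)
  have "odd (card (carrier F))" using card_mod by presburger
  then obtain a b where ab: "a \<in> carrier F" "b \<in> carrier F" "a \<otimes> a \<oplus> b \<otimes> b = \<ominus> \<one>"
    using sum_two_squares[OF fin, of "\<ominus> \<one>"] by auto
  have sq: "pc a \<otimes>\<^bsub>K\<^esub> pc a \<oplus>\<^bsub>K\<^esub> pc b \<otimes>\<^bsub>K\<^esub> pc b = \<ominus>\<^bsub>K\<^esub> \<one>\<^bsub>K\<^esub>"
    using ab h.hom_add[of "a \<otimes> a" "b \<otimes> b"] by (simp add: pconst_minus_one)
  \<comment> \<open>The norm is \<open>1 - (t - 1) (\<gamma> ^ 2 + \<delta> ^ 2)\<close>, which
    equals \<open>t\<close> because the sum of squares is -1.\<close>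
  have "K.qnorm c (\<one>\<^bsub>K\<^esub>, \<zero>\<^bsub>K\<^esub>, pc a, pc b) = T"
    using K.minus_minus_one_mult[of T] by (simp add: sq c_def)
  then have "(\<one>\<^bsub>K\<^esub>, \<zero>\<^bsub>K\<^esub>, pc a, pc b) \<in> basic_quats F (\<ominus> \<one>)"
    using ab quat_norm_eq_qnorm[of "(\<one>\<^bsub>K\<^esub>, \<zero>\<^bsub>K\<^esub>, pc a, pc b)"] unfolding basic_quats_def by auto
  then show thesis using that[of "pc a" "pc b"] sq ab by simp
qed

text \<open>Ordered products of \<open>n\<close> basic quaternions, backtracking included: the lifts
  to \<open>F[t]\<close> of the walks that start at the identity.\<close>

inductive quat_walk :: "nat \<Rightarrow> 'a list \<times> 'a list \<times> 'a list \<times> 'a list \<Rightarrow> bool" where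
  quat_walk_0: "quat_walk 0 (\<one>\<^bsub>K\<^esub>, \<zero>\<^bsub>K\<^esub>, \<zero>\<^bsub>K\<^esub>, \<zero>\<^bsub>K\<^esub>)"
| quat_walk_Suc: "quat_walk n z \<Longrightarrow> (\<one>\<^bsub>K\<^esub>, \<zero>\<^bsub>K\<^esub>, \<gamma>, \<delta>) \<in> basic_quats F (\<ominus> \<one>) \<Longrightarrow>
    quat_walk (Suc n) (K.qstep c \<gamma> \<delta> z)"

text \<open>A step adds \<open>c\<close> times constant combinations of \<open>x3\<close>,
  \<open>x4\<close> to \<open>x1\<close>, \<open>x2\<close>, but only constant combinations of
  \<open>x1\<close>, \<open>x2\<close> to \<open>x3\<close>, \<open>x4\<close>. So each degree bound
  rises by one every second step, the two pairs alternating. The entry \<open>x2\<close> starts at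
  zero and only gains multiples of \<open>c\<close>.\<close>

lemma quat_walk_invariants:
  assumes "quat_walk n z"
  shows "z \<in> carrier K \<times> carrier K \<times> carrier K \<times> carrier K \<and> K.qnorm c z = T [^]\<^bsub>K\<^esub> n \<and>
    c divides\<^bsub>K\<^esub> fst (snd z) \<and>
    length (fst z) \<le> n div 2 + 1 \<and> length (fst (snd z)) \<le> n div 2 + 1 \<and>
    length (fst (snd (snd z))) \<le> (n + 1) div 2 \<and> length (snd (snd (snd z))) \<le> (n + 1) div 2"
  using assms
proof induction
  case quat_walk_0
  have "length \<zero>\<^bsub>K\<^esub> = 0" "length \<one>\<^bsub>K\<^esub> = 1" by (simp_all add: univ_poly_one univ_poly_zero)
  moreover have "c divides\<^bsub>K\<^esub> \<zero>\<^bsub>K\<^esub>" by (rule K.divides_zero) simp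
  moreover have "K.qnorm c (\<one>\<^bsub>K\<^esub>, \<zero>\<^bsub>K\<^esub>, \<zero>\<^bsub>K\<^esub>, \<zero>\<^bsub>K\<^esub>) = \<one>\<^bsub>K\<^esub>" by (simp add: K.minus_eq)
  moreover note K.zero_closed K.one_closed
  ultimately show ?case by (simp del: K.qnorm.simps)
next
  case (quat_walk_Suc n z \<gamma> \<delta>)
  obtain x1 x2 x3 x4 where z [simp]: "z = (x1, x2, x3, x4)" by (cases z)
  obtain \<gamma>' \<delta>' where gd': "\<gamma>' \<in> carrier K" "\<delta>' \<in> carrier K" "length \<gamma>' \<le> 1" "length \<delta>' \<le> 1"
    "(\<one>\<^bsub>K\<^esub>, \<zero>\<^bsub>K\<^esub>, \<gamma>, \<delta>) = (\<one>\<^bsub>K\<^esub>, \<zero>\<^bsub>K\<^esub>, \<gamma>', \<delta>')" "K.qnorm c (\<one>\<^bsub>K\<^esub>, \<zero>\<^bsub>K\<^esub>, \<gamma>', \<delta>') = T"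
    by (rule basic_quatsE[OF quat_walk_Suc.hyps(2)])
  then have "\<gamma>' = \<gamma>" "\<delta>' = \<delta>" by blast+
  with gd' have gd: "\<gamma> \<in> carrier K" "\<delta> \<in> carrier K" "length \<gamma> \<le> Suc 0" "length \<delta> \<le> Suc 0"
    and N: "K.qnorm c (\<one>\<^bsub>K\<^esub>, \<zero>\<^bsub>K\<^esub>, \<gamma>, \<delta>) = T"
    by (simp_all only: One_nat_def)
  have x: "x1 \<in> carrier K" "x2 \<in> carrier K" "x3 \<in> carrier K" "x4 \<in> carrier K"
    and len: "length x1 \<le> n div 2 + 1" "length x2 \<le> n div 2 + 1"
      "length x3 \<le> (n + 1) div 2" "length x4 \<le> (n + 1) div 2"
    and norm: "K.qnorm c z = T [^]\<^bsub>K\<^esub> n" and dvd: "c divides\<^bsub>K\<^esub> x2"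
    using quat_walk_Suc.IH unfolding z by (simp_all only: fst_conv snd_conv mem_Times_iff)
  have lc: "length c \<le> Suc 1"
    unfolding c_def by (rule length_minus_le[OF _ _ K.one_closed]) (simp_all add: var_def univ_poly_one)
  have gl: "length (y \<otimes>\<^bsub>K\<^esub> \<gamma>) \<le> m" "length (y \<otimes>\<^bsub>K\<^esub> \<delta>) \<le> m" if y: "y \<in> carrier K" "length y \<le> m" for y m
    using length_mult_le[OF y(1) gd(1) y(2) gd(3)] length_mult_le[OF y(1) gd(2) y(2) gd(4)] by simp_all
  have cl: "length (c \<otimes>\<^bsub>K\<^esub> y) \<le> m + 1" if y: "y \<in> carrier K" "length y \<le> m" for y m
    using length_mult_le[OF y(1) c_closed y(2) lc] y by (simp add: K.m_comm)
  have n1: "(n + 1) div 2 + 1 = (Suc n) div 2 + 1" "n div 2 + 1 \<le> (Suc n) div 2 + 1"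
      "(Suc n + 1) div 2 = n div 2 + 1" "(n + 1) div 2 \<le> n div 2 + 1" by presburger+
  let ?A = "x3 \<otimes>\<^bsub>K\<^esub> \<gamma> \<oplus>\<^bsub>K\<^esub> x4 \<otimes>\<^bsub>K\<^esub> \<delta>" and ?B = "x4 \<otimes>\<^bsub>K\<^esub> \<gamma> \<ominus>\<^bsub>K\<^esub> x3 \<otimes>\<^bsub>K\<^esub> \<delta>"
  have A: "length ?A \<le> (n + 1) div 2" "?A \<in> carrier K"
    by (intro length_add_le gl x len) (use x gd in simp)
  have B: "length ?B \<le> (n + 1) div 2" "?B \<in> carrier K"
    by (intro length_minus_le gl x len) (use x gd in simp_all)
  have "length (x1 \<oplus>\<^bsub>K\<^esub> c \<otimes>\<^bsub>K\<^esub> ?A) \<le> (n + 1) div 2 + 1" "length (x2 \<oplus>\<^bsub>K\<^esub> c \<otimes>\<^bsub>K\<^esub> ?B) \<le> (n + 1) div 2 + 1"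
    using len(1,2) n1(1,2) by (intro length_add_le cl A B; linarith)+
  then have l12: "length (x1 \<oplus>\<^bsub>K\<^esub> c \<otimes>\<^bsub>K\<^esub> ?A) \<le> (Suc n) div 2 + 1"
    "length (x2 \<oplus>\<^bsub>K\<^esub> c \<otimes>\<^bsub>K\<^esub> ?B) \<le> (Suc n) div 2 + 1"
    unfolding n1(1) .
  have l34: "length (x3 \<oplus>\<^bsub>K\<^esub> (x1 \<otimes>\<^bsub>K\<^esub> \<gamma> \<ominus>\<^bsub>K\<^esub> x2 \<otimes>\<^bsub>K\<^esub> \<delta>)) \<le> (Suc n + 1) div 2"
    "length (x4 \<oplus>\<^bsub>K\<^esub> (x1 \<otimes>\<^bsub>K\<^esub> \<delta> \<oplus>\<^bsub>K\<^esub> x2 \<otimes>\<^bsub>K\<^esub> \<gamma>)) \<le> (Suc n + 1) div 2"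
    unfolding n1(3) using x gd len(3,4) n1(4)
    by (intro length_add_le length_minus_le gl x len(1,2); simp)+
  have "c divides\<^bsub>K\<^esub> (x2 \<oplus>\<^bsub>K\<^esub> c \<otimes>\<^bsub>K\<^esub> (x4 \<otimes>\<^bsub>K\<^esub> \<gamma> \<ominus>\<^bsub>K\<^esub> x3 \<otimes>\<^bsub>K\<^esub> \<delta>))"
    using x gd dvd by (intro K.divides_add K.divides_prod_r) auto
  moreover have "K.qnorm c (K.qstep c \<gamma> \<delta> z) = T [^]\<^bsub>K\<^esub> Suc n"
    using K.qnorm_qstep[of z c \<gamma> \<delta>] x gd N norm by (simp del: K.qnorm.simps K.qstep.simps)
  ultimately show ?case using l12 l34 x gd by (simp del: K.qnorm.simps)
qed

end

section \<open>Reduction modulo a prime power\<close>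

text \<open>\<open>p ^ e\<close> is the number \<open>Q\<close> of the overview, and
  \<open>N\<close> is chosen so that \<open>g = P ^ N\<close> has the square
  \<open>P ^ (Q + 1)\<close>. The assumptions \<open>not_dvd_T\<close> and \<open>not_dvd_c\<close>
  express coprimality to \<open>t (t - 1)\<close>; \<open>splits\<close> is a splitting modulo
  \<open>P\<close>, to be lifted to one modulo \<open>g\<close>.\<close>

locale prime_power_modulus = finite_field_3_mod_4 F for F :: "'a ring" (structure) +
  fixes P :: "'a list" and p e N :: nat
  assumes P_closed [simp, intro]: "P \<in> carrier (poly_ring F)"
    and P_irr: "pirreducible (carrier F) P"
    and p_prime: "Factorial_Ring.prime p"
    and char_p: "add_pow F p \<one> = \<zero>"
    and N: "p ^ e + 1 = 2 * N"
    and not_dvd_T: "\<not> P divides\<^bsub>poly_ring F\<^esub> X\<^bsub>F\<^esub>"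
    and not_dvd_c: "\<not> P divides\<^bsub>poly_ring F\<^esub> t_minus_1 F"
    and splits: "\<exists>a\<in>carrier (poly_ring F). \<exists>b\<in>carrier (poly_ring F).
      P divides\<^bsub>poly_ring F\<^esub> (a \<otimes>\<^bsub>poly_ring F\<^esub> a \<oplus>\<^bsub>poly_ring F\<^esub> b \<otimes>\<^bsub>poly_ring F\<^esub> b \<ominus>\<^bsub>poly_ring F\<^esub> t_minus_1 F)"
begin

abbreviation "g \<equiv> P [^]\<^bsub>K\<^esub> N"
abbreviation "RR \<equiv> residue_ring_mod F g"
abbreviation "\<rho> \<equiv> residue F g"
abbreviation "\<Gamma> \<equiv> morgenstern_graph F (\<ominus> \<one>) g"

lemma N_pos: "N > 0"
  using N by (cases N) auto

section \<open>Divisibility by powers of P\<close>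

lemma pow_divides_cancel:
  assumes "a \<in> carrier K" "b \<in> carrier K" "\<not> P divides\<^bsub>K\<^esub> a" "(P [^]\<^bsub>K\<^esub> (n::nat)) divides\<^bsub>K\<^esub> (a \<otimes>\<^bsub>K\<^esub> b)"
  shows "(P [^]\<^bsub>K\<^esub> n) divides\<^bsub>K\<^esub> b"
  using pirreducible_pow_pdivides_iff[OF carrier_is_subfield P_closed assms(1,2) P_irr] assms(3,4)
  by (simp add: pdivides_def)

lemma P_prime:
  assumes "a \<in> carrier K" "b \<in> carrier K" "P divides\<^bsub>K\<^esub> (a \<otimes>\<^bsub>K\<^esub> b)"
  shows "P divides\<^bsub>K\<^esub> a \<or> P divides\<^bsub>K\<^esub> b"
proof -
  have 1: "P [^]\<^bsub>K\<^esub> (1::nat) = P" by (rule K.nat_pow_eone) (rule P_closed)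
  show ?thesis using pow_divides_cancel[OF assms(1,2), of 1] assms(3) unfolding 1 by blast
qed

lemma P_not_unit: "u \<in> Units K \<Longrightarrow> \<not> P divides\<^bsub>K\<^esub> u"
  using K.divides_unit[of P u, OF _ P_closed] pirreducibleE(2)[OF carrier_is_subring P_closed P_irr] by blast

lemma P_not_dvd_pow: "a \<in> carrier K \<Longrightarrow> \<not> P divides\<^bsub>K\<^esub> a \<Longrightarrow> \<not> P divides\<^bsub>K\<^esub> (a [^]\<^bsub>K\<^esub> (n::nat))"
proof (induction n)
  case 0
  show ?case unfolding K.nat_pow_0 by (rule P_not_unit) (rule K.Units_one_closed)
next
  case (Suc n)
  have "\<not> P divides\<^bsub>K\<^esub> (a [^]\<^bsub>K\<^esub> n)" by (rule Suc.IH[OF Suc.prems])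
  then show ?case
    using P_prime[OF K.nat_pow_closed[OF Suc.prems(1)] Suc.prems(1)] Suc.prems(2) unfolding K.nat_pow_Suc by blast
qed

lemma pow_divides_one_factor:
  assumes ab: "a \<in> carrier K" "b \<in> carrier K" "(P [^]\<^bsub>K\<^esub> (n::nat)) divides\<^bsub>K\<^esub> (a \<otimes>\<^bsub>K\<^esub> b)"
    and "\<not> (P divides\<^bsub>K\<^esub> a \<and> P divides\<^bsub>K\<^esub> b)"
  shows "(P [^]\<^bsub>K\<^esub> n) divides\<^bsub>K\<^esub> a \<or> (P [^]\<^bsub>K\<^esub> n) divides\<^bsub>K\<^esub> b"
proof (cases "P divides\<^bsub>K\<^esub> a")
  case True
  then show ?thesis using pow_divides_cancel[OF ab(2,1)] assms(4) ab(3) unfolding K.m_comm[OF ab(2,1)] by blast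
next
  case False
  then show ?thesis using pow_divides_cancel[OF ab(1,2)] ab(3) by blast
qed

lemma two_unit_K: "\<one>\<^bsub>K\<^esub> \<oplus>\<^bsub>K\<^esub> \<one>\<^bsub>K\<^esub> \<in> Units K"
proof -
  interpret h: ring_hom_ring F K "pconst F" by (rule pconst_hom)
  have "odd (card (carrier F))" using card_mod by presburger
  then have "\<one> \<oplus> \<one> \<in> Units F" using odd_card_two_nonzero[OF fin] by (simp add: field_Units)
  then have u: "(\<one> \<oplus> \<one>) \<otimes> inv (\<one> \<oplus> \<one>) = \<one>" "inv (\<one> \<oplus> \<one>) \<in> carrier F" by auto
  have "pconst F (\<one> \<oplus> \<one>) \<otimes>\<^bsub>K\<^esub> pconst F (inv (\<one> \<oplus> \<one>)) = \<one>\<^bsub>K\<^esub>"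
    using u h.hom_mult[of "\<one> \<oplus> \<one>" "inv (\<one> \<oplus> \<one>)"] by simp
  then have "(\<one>\<^bsub>K\<^esub> \<oplus>\<^bsub>K\<^esub> \<one>\<^bsub>K\<^esub>) \<otimes>\<^bsub>K\<^esub> pconst F (inv (\<one> \<oplus> \<one>)) \<in> Units K" by simp
  then show ?thesis using K.unit_factor[of "\<one>\<^bsub>K\<^esub> \<oplus>\<^bsub>K\<^esub> \<one>\<^bsub>K\<^esub>" "pconst F (inv (\<one> \<oplus> \<one>))"] u(2) by simp
qed

section \<open>The residue ring modulo g\<close>

lemma g_closed [simp, intro]: "g \<in> carrier K"
  by simp

lemma P_divides_g: "P divides\<^bsub>K\<^esub> g"
  using K.divides_pow_mono[OF P_closed, of 1 N] N_pos unfolding K.nat_pow_eone[OF P_closed] by simp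

lemma ideal_g: "ideal (PIdl\<^bsub>K\<^esub> g) K"
  by (rule K.cgenideal_ideal) simp

sublocale R: cring "residue_ring_mod F g"
  unfolding residue_ring_mod_def by (rule ideal.quotient_is_cring[OF ideal_g K.is_cring])

sublocale h: ring_hom_cring K "residue_ring_mod F g" "residue F g"
  unfolding residue_ring_mod_def residue_def[abs_def]
  by (rule ideal.rcos_ring_hom_cring[OF ideal_g K.is_cring])

lemma carrier_RR: "carrier RR = \<rho> ` carrier K"
  by (auto simp: residue_ring_mod_def residue_def FactRing_def A_RCOSETS_def')

lemma residue_eq_zero_iff:
  assumes "a \<in> carrier K"
  shows "\<rho> a = \<zero>\<^bsub>RR\<^esub> \<longleftrightarrow> g divides\<^bsub>K\<^esub> a"
proof -
  have "\<rho> a = \<zero>\<^bsub>RR\<^esub> \<longleftrightarrow> a \<in> PIdl\<^bsub>K\<^esub> g"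
  proof
    assume "\<rho> a = \<zero>\<^bsub>RR\<^esub>"
    then show "a \<in> PIdl\<^bsub>K\<^esub> g"
      using ideal.rcos_const_imp_mem[OF ideal_g assms] by (simp add: residue_def residue_ring_mod_def FactRing_def)
  next
    assume "a \<in> PIdl\<^bsub>K\<^esub> g"
    then show "\<rho> a = \<zero>\<^bsub>RR\<^esub>"
      using abelian_subgroup.a_rcos_const[OF abelian_subgroupI3[OF ideal.axioms(1)[OF ideal_g] K.abelian_group_axioms]]
      by (simp add: residue_def residue_ring_mod_def FactRing_def)
  qed
  also have "\<dots> \<longleftrightarrow> g divides\<^bsub>K\<^esub> a"
    unfolding cgenideal_def factor_def by (auto simp: K.m_comm)
  finally show ?thesis .
qed

lemma residue_eq_iff:
  assumes "a \<in> carrier K" "b \<in> carrier K"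
  shows "\<rho> a = \<rho> b \<longleftrightarrow> g divides\<^bsub>K\<^esub> (a \<ominus>\<^bsub>K\<^esub> b)"
  using residue_eq_zero_iff[of "a \<ominus>\<^bsub>K\<^esub> b"] assms by (simp add: K.minus_eq R.minus_eq[symmetric])

lemma P_pow_nonzero: "P [^]\<^bsub>K\<^esub> (n::nat) \<noteq> \<zero>\<^bsub>K\<^esub>"
  using polynomial_pow_not_zero[OF P_closed] pirreducibleE(1)[OF carrier_is_subring P_closed P_irr]
  by (simp add: K_zero)

lemma length_P_pow: "length (P [^]\<^bsub>K\<^esub> (n::nat)) = n * degree P + 1"
proof -
  have "degree (P [^]\<^bsub>K\<^esub> n) = n * degree P" by (rule polynomial_pow_degree) simp
  then show ?thesis using P_pow_nonzero[of n] unfolding K_zero by (cases "P [^]\<^bsub>K\<^esub> n") auto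
qed

text \<open>Every class contains a remainder of length at most \<open>N * degree P\<close>. Padding
  with leading zeros turns remainders into coefficient lists of exactly this length, and
  \<open>normalize\<close> removes the padding.\<close>

lemma card_RR: "finite (carrier RR)" "card (carrier RR) \<le> card (carrier F) ^ (N * degree P)"
proof -
  let ?d = "N * degree P"
  let ?L = "{xs. set xs \<subseteq> carrier F \<and> length xs = ?d}"
  have sub: "carrier RR \<subseteq> (\<lambda>xs. \<rho> (normalize xs)) ` ?L"
  proof
    fix x assume "x \<in> carrier RR"
    then obtain a where a: "a \<in> carrier K" "x = \<rho> a" unfolding carrier_RR by blast
    have g0: "g \<noteq> []" using P_pow_nonzero[of N] unfolding K_zero .
    obtain b r where br: "b \<in> carrier K" "r \<in> carrier K" "long_divides a g (b, r)"
      using exists_long_division[OF carrier_is_subfield a(1) g_closed g0] by blast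
    then have eq: "a = g \<otimes>\<^bsub>K\<^esub> b \<oplus>\<^bsub>K\<^esub> r" and len: "r = [] \<or> degree r < degree g"
      unfolding long_divides_def by auto
    have "length r \<le> ?d" using len length_P_pow[of N] g0 by (cases r) auto
    have "a \<ominus>\<^bsub>K\<^esub> r = g \<otimes>\<^bsub>K\<^esub> b" unfolding eq using br by (simp add: K.minus_eq K.a_assoc K.r_neg)
    then have "\<rho> a = \<rho> r" using residue_eq_iff[OF a(1) br(2)] br(1) by (auto intro: dividesI)
    moreover have "normalize (replicate (?d - length r) \<zero> @ r) = r"
      using normalize_replicate_zero[of _ r] normalize_polynomial[of "carrier F" r] br(2)
      by (simp add: univ_poly_carrier)
    moreover have "set r \<subseteq> carrier F" using br(2) polynomial_incl by (simp add: univ_poly_carrier[symmetric])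
    ultimately show "x \<in> (\<lambda>xs. \<rho> (normalize xs)) ` ?L"
      using a(2) \<open>length r \<le> ?d\<close> by (intro image_eqI[of _ _ "replicate (?d - length r) \<zero> @ r"]) auto
  qed
  have L: "finite ?L" "card ?L = card (carrier F) ^ ?d"
    using finite_lists_length_eq[OF fin] card_lists_length_eq[OF fin] by auto
  show "finite (carrier RR)" using finite_surj[OF L(1) sub] .
  show "card (carrier RR) \<le> card (carrier F) ^ ?d"
    using card_mono[OF finite_imageI[OF L(1)] sub] card_image_le[OF L(1), of "\<lambda>xs. \<rho> (normalize xs)"] L(2) by linarith
qed

text \<open>Multiplication by \<open>a\<close> is injective modulo \<open>g\<close>, because powers
  of \<open>P\<close> can be cancelled against \<open>a\<close>; on a finite ring it is then
  surjective and reaches one.\<close>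

lemma residue_unit:
  assumes a: "a \<in> carrier K" "\<not> P divides\<^bsub>K\<^esub> a"
  shows "\<rho> a \<in> Units RR"
proof -
  let ?f = "\<lambda>x. \<rho> a \<otimes>\<^bsub>RR\<^esub> x"
  have inj: "inj_on ?f (carrier RR)"
  proof (rule inj_onI)
    fix x y assume "x \<in> carrier RR" "y \<in> carrier RR" and eq: "?f x = ?f y"
    then obtain u v where uv: "u \<in> carrier K" "v \<in> carrier K" "x = \<rho> u" "y = \<rho> v"
      unfolding carrier_RR by blast
    have "\<rho> (a \<otimes>\<^bsub>K\<^esub> u) = \<rho> (a \<otimes>\<^bsub>K\<^esub> v)" using eq uv a by simp
    moreover have "a \<otimes>\<^bsub>K\<^esub> u \<in> carrier K" "a \<otimes>\<^bsub>K\<^esub> v \<in> carrier K" using uv(1,2) a(1) by simp_all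
    ultimately have "g divides\<^bsub>K\<^esub> (a \<otimes>\<^bsub>K\<^esub> u \<ominus>\<^bsub>K\<^esub> a \<otimes>\<^bsub>K\<^esub> v)" using residue_eq_iff by blast
    moreover have "a \<otimes>\<^bsub>K\<^esub> u \<ominus>\<^bsub>K\<^esub> a \<otimes>\<^bsub>K\<^esub> v = a \<otimes>\<^bsub>K\<^esub> (u \<ominus>\<^bsub>K\<^esub> v)"
      using uv(1,2) a(1) by (simp add: K.minus_eq K.r_distr K.r_minus)
    ultimately have d: "g divides\<^bsub>K\<^esub> (a \<otimes>\<^bsub>K\<^esub> (u \<ominus>\<^bsub>K\<^esub> v))" by (simp only:)
    have "g divides\<^bsub>K\<^esub> (u \<ominus>\<^bsub>K\<^esub> v)"
      by (rule pow_divides_cancel[OF a(1) _ a(2) d]) (use uv(1,2) in simp)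
    then show "x = y" unfolding uv(3,4) using residue_eq_iff[OF uv(1,2)] by blast
  qed
  have "?f ` carrier RR = carrier RR"
    using a by (intro endo_inj_surj[OF card_RR(1) _ inj]) auto
  then obtain x where "x \<in> carrier RR" "\<rho> a \<otimes>\<^bsub>RR\<^esub> x = \<one>\<^bsub>RR\<^esub>"
    using R.one_closed by (elim equalityE) (drule subsetD, assumption, blast)
  then have "\<rho> a \<otimes>\<^bsub>RR\<^esub> x \<in> Units RR" by simp
  then show ?thesis using \<open>x \<in> carrier RR\<close> a(1) by (intro R.unit_factor[of "\<rho> a" x]) simp_all
qed

lemma nonunit_residue:
  assumes "a \<in> carrier K" "P divides\<^bsub>K\<^esub> a"
  shows "\<rho> a \<notin> Units RR"
proof
  assume "\<rho> a \<in> Units RR"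
  then obtain x where "x \<in> carrier RR" "\<rho> a \<otimes>\<^bsub>RR\<^esub> x = \<one>\<^bsub>RR\<^esub>" by (auto simp: Units_def)
  then obtain b where b: "b \<in> carrier K" "\<rho> a \<otimes>\<^bsub>RR\<^esub> \<rho> b = \<one>\<^bsub>RR\<^esub>" unfolding carrier_RR by blast
  then have "\<rho> (a \<otimes>\<^bsub>K\<^esub> b) = \<rho> \<one>\<^bsub>K\<^esub>" using assms by simp
  then have "g divides\<^bsub>K\<^esub> (a \<otimes>\<^bsub>K\<^esub> b \<ominus>\<^bsub>K\<^esub> \<one>\<^bsub>K\<^esub>)" using assms b by (subst (asm) residue_eq_iff) auto
  then have 1: "P divides\<^bsub>K\<^esub> (a \<otimes>\<^bsub>K\<^esub> b \<ominus>\<^bsub>K\<^esub> \<one>\<^bsub>K\<^esub>)"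
    by (rule K.divides_trans[OF P_divides_g _ P_closed])
  have 2: "P divides\<^bsub>K\<^esub> (a \<otimes>\<^bsub>K\<^esub> b)" by (rule K.divides_prod_r[OF assms(2) P_closed b(1)])
  have "P divides\<^bsub>K\<^esub> \<one>\<^bsub>K\<^esub>"
    by (rule K.divides_minus_cancel[OF 2 1 P_closed _ K.one_closed]) (use assms b in simp)
  then show False using P_not_unit[OF K.Units_one_closed] by blast
qed

text \<open>The ring modulo \<open>P ^ N\<close> is local: non-units are the residues of multiples
  of \<open>P\<close>, and two of them in the first row would make the determinant one as well. This
  is the hypothesis \<open>loc\<close> of the vertex count.\<close>

lemma first_row_unit:
  assumes "(a, b, d, f) \<in> carrier (GL2 RR)"
  shows "a \<in> Units RR \<or> b \<in> Units RR"
proof (rule ccontr)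
  assume neg: "\<not> (a \<in> Units RR \<or> b \<in> Units RR)"
  have cl: "a \<in> carrier RR" "b \<in> carrier RR" "d \<in> carrier RR" "f \<in> carrier RR"
    and det: "a \<otimes>\<^bsub>RR\<^esub> f \<ominus>\<^bsub>RR\<^esub> b \<otimes>\<^bsub>RR\<^esub> d \<in> Units RR"
    using assms by (auto simp: R.carrier_GL2)
  obtain a' where a: "a' \<in> carrier K" "a = \<rho> a'" using cl(1) unfolding carrier_RR by blast
  obtain b' where b: "b' \<in> carrier K" "b = \<rho> b'" using cl(2) unfolding carrier_RR by blast
  obtain d' where d: "d' \<in> carrier K" "d = \<rho> d'" using cl(3) unfolding carrier_RR by blast
  obtain f' where f: "f' \<in> carrier K" "f = \<rho> f'" using cl(4) unfolding carrier_RR by blast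
  note * = a b d f
  have "P divides\<^bsub>K\<^esub> a'" "P divides\<^bsub>K\<^esub> b'"
    using neg residue_unit[OF a(1)] residue_unit[OF b(1)] unfolding a(2) b(2) by blast+
  then have "P divides\<^bsub>K\<^esub> (a' \<otimes>\<^bsub>K\<^esub> f' \<ominus>\<^bsub>K\<^esub> b' \<otimes>\<^bsub>K\<^esub> d')"
    using a(1) b(1) d(1) f(1) by (intro K.divides_minus K.divides_prod_r P_closed)
  then have "\<rho> (a' \<otimes>\<^bsub>K\<^esub> f' \<ominus>\<^bsub>K\<^esub> b' \<otimes>\<^bsub>K\<^esub> d') \<notin> Units RR" using a(1) b(1) d(1) f(1) by (intro nonunit_residue) simp_all
  then show False using det a b d f by (simp add: K.minus_eq R.minus_eq)
qed

lemma unit_T: "\<rho> T \<in> Units RR" and unit_c: "\<rho> c \<in> Units RR"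
  using residue_unit not_dvd_T not_dvd_c by auto

lemma unit_two: "\<one>\<^bsub>RR\<^esub> \<oplus>\<^bsub>RR\<^esub> \<one>\<^bsub>RR\<^esub> \<in> Units RR"
  using residue_unit[OF _ P_not_unit[OF two_unit_K]] by simp

text \<open>Invertibility of \<open>t (t - 1)\<close> modulo \<open>g\<close> is a Bezout relation,
  so every common divisor divides 1.\<close>

lemma morgenstern_modulus_g: "morgenstern_modulus F g"
  unfolding morgenstern_modulus_def isgcd_def
proof (intro conjI ballI impI)
  fix y assume y: "y \<in> carrier K" "y divides\<^bsub>K\<^esub> g \<and> y divides\<^bsub>K\<^esub> (T \<otimes>\<^bsub>K\<^esub> c)"
  have "\<rho> (T \<otimes>\<^bsub>K\<^esub> c) \<in> Units RR" using unit_T unit_c by simp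
  then obtain x where "x \<in> carrier RR" "\<rho> (T \<otimes>\<^bsub>K\<^esub> c) \<otimes>\<^bsub>RR\<^esub> x = \<one>\<^bsub>RR\<^esub>" by (auto simp: Units_def)
  then obtain b where b: "b \<in> carrier K" "\<rho> (T \<otimes>\<^bsub>K\<^esub> c) \<otimes>\<^bsub>RR\<^esub> \<rho> b = \<one>\<^bsub>RR\<^esub>" unfolding carrier_RR by blast
  let ?z = "T \<otimes>\<^bsub>K\<^esub> c \<otimes>\<^bsub>K\<^esub> b"
  have zc: "?z \<in> carrier K" using b by simp
  have "\<rho> ?z = \<rho> \<one>\<^bsub>K\<^esub>" using b by simp
  then have "g divides\<^bsub>K\<^esub> (?z \<ominus>\<^bsub>K\<^esub> \<one>\<^bsub>K\<^esub>)" using zc by (subst (asm) residue_eq_iff) auto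
  then have 1: "y divides\<^bsub>K\<^esub> (?z \<ominus>\<^bsub>K\<^esub> \<one>\<^bsub>K\<^esub>)" using y K.divides_trans[of y g] by blast
  have 2: "y divides\<^bsub>K\<^esub> ?z" using y b by (intro K.divides_prod_r[of y "T \<otimes>\<^bsub>K\<^esub> c" b]) auto
  show "y divides\<^bsub>K\<^esub> \<one>\<^bsub>K\<^esub>"
    by (rule K.divides_minus_cancel[OF 2 1 y(1) zc K.one_closed])
next
  show "\<one>\<^bsub>K\<^esub> divides\<^bsub>K\<^esub> g" by (rule K.unit_divides[OF K.Units_one_closed g_closed])
  show "\<one>\<^bsub>K\<^esub> divides\<^bsub>K\<^esub> (T \<otimes>\<^bsub>K\<^esub> c)" by (rule K.unit_divides[OF K.Units_one_closed]) simp
  show "g \<in> carrier K" by (rule g_closed)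
qed

section \<open>Splitting the quaternion order modulo g\<close>

lemma residue_pow: "a \<in> carrier K \<Longrightarrow> \<rho> (a [^]\<^bsub>K\<^esub> (n::nat)) = \<rho> a [^]\<^bsub>RR\<^esub> n"
  by (induction n) simp_all

lemma is_splitting_iff:
  "is_splitting F (\<ominus> \<one>) g (a, b) \<longleftrightarrow>
    a \<in> carrier RR \<and> b \<in> carrier RR \<and> a \<otimes>\<^bsub>RR\<^esub> a \<oplus>\<^bsub>RR\<^esub> b \<otimes>\<^bsub>RR\<^esub> b = \<rho> c"
proof -
  have "\<rho> (pconst F (\<ominus> \<one>)) = \<ominus>\<^bsub>RR\<^esub> \<one>\<^bsub>RR\<^esub>" by (simp add: pconst_minus_one)
  then show ?thesis
    unfolding is_splitting_def Let_def by (auto simp: R.l_minus R.minus_eq)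
qed

lemma p_pow_pred: "p ^ e = N + (N - 1)" "N \<le> p ^ e"
  using N N_pos by linarith+

text \<open>Raising a splitting modulo \<open>P\<close> to the power \<open>p ^ e \<ge> N\<close> solves
  \<open>a\<^sup>2 + b\<^sup>2 = c ^ (p ^ e)\<close> modulo \<open>P ^ N\<close>, and \<open>c ^ (p ^ e - 1)\<close> is the square of a unit.\<close>

lemma splitting_exists: "\<exists>ab. is_splitting F (\<ominus> \<one>) g ab"
proof -
  let ?Q = "p ^ e"
  obtain a b where ab: "a \<in> carrier K" "b \<in> carrier K"
    and dvd: "P divides\<^bsub>K\<^esub> (a \<otimes>\<^bsub>K\<^esub> a \<oplus>\<^bsub>K\<^esub> b \<otimes>\<^bsub>K\<^esub> b \<ominus>\<^bsub>K\<^esub> c)"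
    using splits by blast
  have frob: "(x \<oplus>\<^bsub>K\<^esub> y) [^]\<^bsub>K\<^esub> ?Q = x [^]\<^bsub>K\<^esub> ?Q \<oplus>\<^bsub>K\<^esub> y [^]\<^bsub>K\<^esub> ?Q"
    "(x \<ominus>\<^bsub>K\<^esub> y) [^]\<^bsub>K\<^esub> ?Q = x [^]\<^bsub>K\<^esub> ?Q \<ominus>\<^bsub>K\<^esub> y [^]\<^bsub>K\<^esub> ?Q"
    if "x \<in> carrier K" "y \<in> carrier K" for x y
    using K.frobenius_add[OF p_prime add_pow_K[OF char_p] that] K.frobenius_minus[OF p_prime add_pow_K[OF char_p] that] by auto
  let ?A = "a [^]\<^bsub>K\<^esub> ?Q" and ?B = "b [^]\<^bsub>K\<^esub> ?Q"
  have "(a \<otimes>\<^bsub>K\<^esub> a \<oplus>\<^bsub>K\<^esub> b \<otimes>\<^bsub>K\<^esub> b \<ominus>\<^bsub>K\<^esub> c) [^]\<^bsub>K\<^esub> ?Q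
      = ?A \<otimes>\<^bsub>K\<^esub> ?A \<oplus>\<^bsub>K\<^esub> ?B \<otimes>\<^bsub>K\<^esub> ?B \<ominus>\<^bsub>K\<^esub> c [^]\<^bsub>K\<^esub> ?Q"
    using ab by (simp add: frob K.nat_pow_distrib)
  then have "(P [^]\<^bsub>K\<^esub> ?Q) divides\<^bsub>K\<^esub> (?A \<otimes>\<^bsub>K\<^esub> ?A \<oplus>\<^bsub>K\<^esub> ?B \<otimes>\<^bsub>K\<^esub> ?B \<ominus>\<^bsub>K\<^esub> c [^]\<^bsub>K\<^esub> ?Q)"
    using K.divides_pow[OF dvd P_closed, of ?Q] by (simp only:)
  then have "g divides\<^bsub>K\<^esub> (?A \<otimes>\<^bsub>K\<^esub> ?A \<oplus>\<^bsub>K\<^esub> ?B \<otimes>\<^bsub>K\<^esub> ?B \<ominus>\<^bsub>K\<^esub> c [^]\<^bsub>K\<^esub> ?Q)"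
    by (rule K.divides_trans[OF K.divides_pow_mono[OF P_closed p_pow_pred(2)] _ g_closed])
  moreover have cl: "?A \<otimes>\<^bsub>K\<^esub> ?A \<oplus>\<^bsub>K\<^esub> ?B \<otimes>\<^bsub>K\<^esub> ?B \<in> carrier K" "c [^]\<^bsub>K\<^esub> ?Q \<in> carrier K"
    using ab by simp_all
  ultimately have "\<rho> (?A \<otimes>\<^bsub>K\<^esub> ?A \<oplus>\<^bsub>K\<^esub> ?B \<otimes>\<^bsub>K\<^esub> ?B) = \<rho> (c [^]\<^bsub>K\<^esub> ?Q)"
    using residue_eq_iff[OF cl] by blast
  then have eq: "\<rho> ?A \<otimes>\<^bsub>RR\<^esub> \<rho> ?A \<oplus>\<^bsub>RR\<^esub> \<rho> ?B \<otimes>\<^bsub>RR\<^esub> \<rho> ?B = \<rho> c [^]\<^bsub>RR\<^esub> ?Q"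
    using ab by (simp add: residue_pow)
  let ?i = "inv\<^bsub>RR\<^esub> (\<rho> c)" and ?c = "\<rho> c"
  let ?j = "?i [^]\<^bsub>RR\<^esub> (N - 1)"
  have ic: "?i \<in> carrier RR" "?c \<in> carrier RR" "?c \<otimes>\<^bsub>RR\<^esub> ?i = \<one>\<^bsub>RR\<^esub>" using unit_c by auto
  have AB: "\<rho> ?A \<in> carrier RR" "\<rho> ?B \<in> carrier RR" "?j \<in> carrier RR" using ab ic by (auto intro!: h.hom_closed)
  have "?c [^]\<^bsub>RR\<^esub> (N - 1) \<otimes>\<^bsub>RR\<^esub> ?j = \<one>\<^bsub>RR\<^esub>"
    using ic by (simp add: R.nat_pow_distrib[symmetric])
  then have cj: "?c [^]\<^bsub>RR\<^esub> (N - 1) \<otimes>\<^bsub>RR\<^esub> ?c [^]\<^bsub>RR\<^esub> (N - 1) \<otimes>\<^bsub>RR\<^esub> (?j \<otimes>\<^bsub>RR\<^esub> ?j) = \<one>\<^bsub>RR\<^esub>"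
    (is "?X \<otimes>\<^bsub>RR\<^esub> ?X \<otimes>\<^bsub>RR\<^esub> _ = _")
  proof -
    assume 1: "?X \<otimes>\<^bsub>RR\<^esub> ?j = \<one>\<^bsub>RR\<^esub>"
    have "?X \<otimes>\<^bsub>RR\<^esub> ?X \<otimes>\<^bsub>RR\<^esub> (?j \<otimes>\<^bsub>RR\<^esub> ?j) = (?X \<otimes>\<^bsub>RR\<^esub> ?j) \<otimes>\<^bsub>RR\<^esub> (?X \<otimes>\<^bsub>RR\<^esub> ?j)"
      using AB(3) R.nat_pow_closed[OF ic(2), of "N - 1"] by (simp only: R.m_ac R.m_closed)
    then show ?thesis unfolding 1 by simp
  qed
  have "?Q = Suc ((N - 1) + (N - 1))" using p_pow_pred N_pos by simp
  then have cQ: "?c [^]\<^bsub>RR\<^esub> ?Q = ?c [^]\<^bsub>RR\<^esub> (N - 1) \<otimes>\<^bsub>RR\<^esub> ?c [^]\<^bsub>RR\<^esub> (N - 1) \<otimes>\<^bsub>RR\<^esub> ?c"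
    using ic by (simp add: R.nat_pow_mult)
  have "(\<rho> ?A \<otimes>\<^bsub>RR\<^esub> ?j) \<otimes>\<^bsub>RR\<^esub> (\<rho> ?A \<otimes>\<^bsub>RR\<^esub> ?j) \<oplus>\<^bsub>RR\<^esub> (\<rho> ?B \<otimes>\<^bsub>RR\<^esub> ?j) \<otimes>\<^bsub>RR\<^esub> (\<rho> ?B \<otimes>\<^bsub>RR\<^esub> ?j)
    = (\<rho> ?A \<otimes>\<^bsub>RR\<^esub> \<rho> ?A \<oplus>\<^bsub>RR\<^esub> \<rho> ?B \<otimes>\<^bsub>RR\<^esub> \<rho> ?B) \<otimes>\<^bsub>RR\<^esub> (?j \<otimes>\<^bsub>RR\<^esub> ?j)"
    using AB by (simp only: R.l_distr R.m_ac R.m_closed)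
  also have "\<dots> = (?c [^]\<^bsub>RR\<^esub> (N - 1) \<otimes>\<^bsub>RR\<^esub> ?c [^]\<^bsub>RR\<^esub> (N - 1) \<otimes>\<^bsub>RR\<^esub> (?j \<otimes>\<^bsub>RR\<^esub> ?j)) \<otimes>\<^bsub>RR\<^esub> ?c"
    unfolding eq cQ using AB ic R.nat_pow_closed[OF ic(2), of "N - 1"] by (simp only: R.m_ac R.m_closed)
  also have "\<dots> = ?c" unfolding cj using ic by simp
  finally have "is_splitting F (\<ominus> \<one>) g (\<rho> ?A \<otimes>\<^bsub>RR\<^esub> ?j, \<rho> ?B \<otimes>\<^bsub>RR\<^esub> ?j)"
    unfolding is_splitting_iff using AB by simp
  then show ?thesis by blast
qed

text \<open>The pair is chosen by \<open>SOME\<close> inside \<open>splitting\<close>, so it is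
  known only through \<open>splitting_props\<close>.\<close>

definition sa where "sa = fst (splitting F (\<ominus> \<one>) g)"
definition sb where "sb = snd (splitting F (\<ominus> \<one>) g)"

lemma splitting_props:
  "sa \<in> carrier RR" "sb \<in> carrier RR" "sa \<otimes>\<^bsub>RR\<^esub> sa \<oplus>\<^bsub>RR\<^esub> sb \<otimes>\<^bsub>RR\<^esub> sb = \<rho> c"
proof -
  have "is_splitting F (\<ominus> \<one>) g (sa, sb)"
    using someI_ex[OF splitting_exists] by (simp add: sa_def sb_def splitting_def)
  then show "sa \<in> carrier RR" "sb \<in> carrier RR" "sa \<otimes>\<^bsub>RR\<^esub> sa \<oplus>\<^bsub>RR\<^esub> sb \<otimes>\<^bsub>RR\<^esub> sb = \<rho> c"
    unfolding is_splitting_iff by auto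
qed

fun residue4 where "residue4 (x1, x2, x3, x4) = (\<rho> x1, \<rho> x2, \<rho> x3, \<rho> x4)"

abbreviation "K4 \<equiv> carrier K \<times> carrier K \<times> carrier K \<times> carrier K"
abbreviation "R4 \<equiv> carrier RR \<times> carrier RR \<times> carrier RR \<times> carrier RR"

lemma residue4_closed: "z \<in> K4 \<Longrightarrow> residue4 z \<in> R4"
  by (cases z) (auto intro!: h.hom_closed)

lemma residue4_qstep:
  assumes "z \<in> K4" "\<gamma> \<in> carrier K" "\<delta> \<in> carrier K"
  shows "residue4 (K.qstep c \<gamma> \<delta> z) = R.qstep (\<rho> c) (\<rho> \<gamma>) (\<rho> \<delta>) (residue4 z)"
  using assms by (cases z) (simp add: K.minus_eq R.minus_eq)

lemma residue_qnorm:
  assumes "z \<in> K4"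
  shows "\<rho> (K.qnorm c z) = R.qnorm (\<rho> c) (residue4 z)"
  using assms by (cases z) (simp add: K.minus_eq R.minus_eq)

definition red where "red z = R.qmat sa sb (residue4 z)"

lemma reduce_quat_eq:
  assumes "z \<in> K4"
  shows "reduce_quat F (\<ominus> \<one>) g z = red z"
proof -
  obtain x1 x2 x3 x4 where z: "z = (x1, x2, x3, x4)" by (cases z)
  have cl: "\<rho> x1 \<in> carrier RR" "\<rho> x2 \<in> carrier RR" "\<rho> x3 \<in> carrier RR" "\<rho> x4 \<in> carrier RR"
    using assms unfolding z by auto
  have n: "\<rho> (pconst F (\<ominus> \<one>)) = \<ominus>\<^bsub>RR\<^esub> \<one>\<^bsub>RR\<^esub>" by (simp add: pconst_minus_one)
  have sp: "splitting F (\<ominus> \<one>) g = (sa, sb)" by (simp add: sa_def sb_def)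
  show ?thesis
    unfolding z red_def residue4.simps reduce_quat.simps Let_def sp n prod.case R.qmat.simps
    using cl splitting_props(1,2)
    by (simp add: R.l_minus R.minus_eq R.minus_add R.a_ac)
qed

lemma det_red:
  assumes "z \<in> K4"
  shows "mat2_det RR (red z) = \<rho> (K.qnorm c z)" "red z \<in> R4"
  using R.det_qmat[OF residue4_closed[OF assms] splitting_props(1,2)] residue_qnorm[OF assms]
    R.qmat_closed[OF residue4_closed[OF assms] splitting_props(1,2)]
  unfolding red_def splitting_props(3) by auto

lemma red_qstep:
  assumes "z \<in> K4" "\<gamma> \<in> carrier K" "\<delta> \<in> carrier K"
  shows "red (K.qstep c \<gamma> \<delta> z) = mat2_mult RR (red z) (red (\<one>\<^bsub>K\<^esub>, \<zero>\<^bsub>K\<^esub>, \<gamma>, \<delta>))"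
  using R.qmat_qstep[OF residue4_closed[OF assms(1)] splitting_props(1,2), of "\<rho> \<gamma>" "\<rho> \<delta>"] assms
  unfolding red_def splitting_props(3) residue4_qstep[OF assms] residue4.simps
  by (simp del: R.qmat.simps mat2_mult.simps R.qstep.simps)

section \<open>Walks in the graph as products of basic quaternions\<close>

lemma quat_walk_red:
  assumes "quat_walk n z"
  shows "red z \<in> carrier (GL2 RR)" "mat2_det RR (red z) = \<rho> T [^]\<^bsub>RR\<^esub> n"
proof -
  have z: "z \<in> K4" "K.qnorm c z = T [^]\<^bsub>K\<^esub> n" using quat_walk_invariants[OF assms] by blast+
  show det: "mat2_det RR (red z) = \<rho> T [^]\<^bsub>RR\<^esub> n"
    unfolding det_red(1)[OF z(1)] z(2) by (rule residue_pow) simp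
  show "red z \<in> carrier (GL2 RR)"
    unfolding R.carrier_GL2 det using det_red(2)[OF z(1)] R.Units_pow_closed[OF unit_T] by simp
qed

lemma basic_quat_red:
  assumes "s \<in> basic_quats F (\<ominus> \<one>)"
  shows "reduce_quat F (\<ominus> \<one>) g s = red s" "red s \<in> carrier (GL2 RR)" "mat2_det RR (red s) = \<rho> T"
proof -
  obtain \<gamma> \<delta> where s: "\<gamma> \<in> carrier K" "\<delta> \<in> carrier K" "s = (\<one>\<^bsub>K\<^esub>, \<zero>\<^bsub>K\<^esub>, \<gamma>, \<delta>)"
    "K.qnorm c (\<one>\<^bsub>K\<^esub>, \<zero>\<^bsub>K\<^esub>, \<gamma>, \<delta>) = T"
    by (rule basic_quatsE[OF assms])
  then have s4: "s \<in> K4" by simp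
  show "reduce_quat F (\<ominus> \<one>) g s = red s" by (rule reduce_quat_eq[OF s4])
  show det: "mat2_det RR (red s) = \<rho> T" unfolding det_red(1)[OF s4] unfolding s(3,4) ..
  show "red s \<in> carrier (GL2 RR)"
    unfolding R.carrier_GL2 det using det_red(2)[OF s4] unit_T by simp
qed

lemma red_one: "red (\<one>\<^bsub>K\<^esub>, \<zero>\<^bsub>K\<^esub>, \<zero>\<^bsub>K\<^esub>, \<zero>\<^bsub>K\<^esub>) = (\<one>\<^bsub>RR\<^esub>, \<zero>\<^bsub>RR\<^esub>, \<zero>\<^bsub>RR\<^esub>, \<one>\<^bsub>RR\<^esub>)"
  unfolding red_def using splitting_props(1,2) by (simp add: R.minus_eq)

lemma graph_vertices: "fst \<Gamma> = PSL2_with_det RR (\<rho> T)"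
  by (simp add: morgenstern_graph_def cayley_graph_def Let_def)

lemma graph_edges: "snd \<Gamma> = {(x, x \<otimes>\<^bsub>PGL2 RR\<^esub> PGL2_class RR (red s)) | x s. x \<in> fst \<Gamma> \<and> s \<in> basic_quats F (\<ominus> \<one>)}"
proof -
  have "PGL2_class RR ` reduce_quat F (\<ominus> \<one>) g ` basic_quats F (\<ominus> \<one>) = (\<lambda>s. PGL2_class RR (red s)) ` basic_quats F (\<ominus> \<one>)"
    unfolding image_image by (intro image_cong refl) (simp add: basic_quat_red(1))
  then show ?thesis
    unfolding graph_vertices unfolding morgenstern_graph_def cayley_graph_def Let_def snd_conv by (simp only:) blast
qed

text \<open>The determinant \<open>t ^ n\<close> is a square for even \<open>n\<close> and
  \<open>t\<close> times a square for odd \<open>n\<close>, which are the two alternatives in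
  \<open>PSL2_with_det\<close>.\<close>

lemma quat_walk_vertex:
  assumes "quat_walk n z"
  shows "PGL2_class RR (red z) \<in> fst \<Gamma>"
proof -
  let ?u = "\<rho> T [^]\<^bsub>RR\<^esub> (n div 2)"
  have u: "?u \<in> Units RR" by (rule R.Units_pow_closed[OF unit_T])
  have T: "\<rho> T \<in> carrier RR" by simp
  have "mat2_det RR (red z) = ?u \<otimes>\<^bsub>RR\<^esub> ?u \<or> mat2_det RR (red z) = \<rho> T \<otimes>\<^bsub>RR\<^esub> (?u \<otimes>\<^bsub>RR\<^esub> ?u)"
  proof (cases "even n")
    case True
    then have "n = n div 2 + n div 2" by presburger
    then show ?thesis unfolding quat_walk_red(2)[OF assms] R.nat_pow_mult[OF T] by simp
  next
    case False
    then have "n = Suc (n div 2 + n div 2)" by presburger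
    then have "\<rho> T [^]\<^bsub>RR\<^esub> n = \<rho> T [^]\<^bsub>RR\<^esub> (n div 2 + n div 2) \<otimes>\<^bsub>RR\<^esub> \<rho> T"
      using R.nat_pow_Suc[of "\<rho> T" "n div 2 + n div 2"] by simp
    then show ?thesis unfolding quat_walk_red(2)[OF assms] R.nat_pow_mult[OF T]
      using R.m_comm[OF T R.nat_pow_closed[OF T, of "n div 2 + n div 2"]] by simp
  qed
  then show ?thesis
    unfolding graph_vertices PSL2_with_det_def using quat_walk_red(1)[OF assms] u by blast
qed

lemma quat_walk_step_class:
  assumes "quat_walk n z" "(\<one>\<^bsub>K\<^esub>, \<zero>\<^bsub>K\<^esub>, \<gamma>, \<delta>) \<in> basic_quats F (\<ominus> \<one>)"
  shows "PGL2_class RR (red (K.qstep c \<gamma> \<delta> z)) = PGL2_class RR (red z) \<otimes>\<^bsub>PGL2 RR\<^esub> PGL2_class RR (red (\<one>\<^bsub>K\<^esub>, \<zero>\<^bsub>K\<^esub>, \<gamma>, \<delta>))"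
proof -
  have z: "z \<in> K4" using quat_walk_invariants[OF assms(1)] by blast
  have gd: "\<gamma> \<in> carrier K" "\<delta> \<in> carrier K" using basic_quatsE[OF assms(2)] by blast+
  show ?thesis
    unfolding R.PGL2_class_mult[OF quat_walk_red(1)[OF assms(1)] basic_quat_red(2)[OF assms(2)]] red_qstep[OF z gd] ..
qed

lemma quat_walk_relpow:
  assumes "quat_walk n z"
  shows "(PGL2_class RR (red (\<one>\<^bsub>K\<^esub>, \<zero>\<^bsub>K\<^esub>, \<zero>\<^bsub>K\<^esub>, \<zero>\<^bsub>K\<^esub>)), PGL2_class RR (red z)) \<in> snd \<Gamma> ^^ n"
  using assms
proof induction
  case (quat_walk_Suc n z \<gamma> \<delta>)
  have "(PGL2_class RR (red z), PGL2_class RR (red (K.qstep c \<gamma> \<delta> z))) \<in> snd \<Gamma>"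
    unfolding quat_walk_step_class[OF quat_walk_Suc.hyps] graph_edges
    using quat_walk_vertex[OF quat_walk_Suc.hyps(1)] quat_walk_Suc.hyps(2) by blast
  with quat_walk_Suc.IH show ?case by (rule relpow_Suc_I)
qed simp

text \<open>Every walk from the identity lifts to \<open>F[t]\<close>. This direction serves the
  lower bound on the diameter; its converse \<open>quat_walk_relpow\<close> serves the odd closed
  walk.\<close>

lemma relpow_quat_walk:
  assumes "(PGL2_class RR (red (\<one>\<^bsub>K\<^esub>, \<zero>\<^bsub>K\<^esub>, \<zero>\<^bsub>K\<^esub>, \<zero>\<^bsub>K\<^esub>)), y) \<in> snd \<Gamma> ^^ n"
  shows "\<exists>z. quat_walk n z \<and> y = PGL2_class RR (red z)"
  using assms
proof (induction n arbitrary: y)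
  case 0
  then show ?case using quat_walk_0 by auto
next
  case (Suc n)
  then obtain x where x: "(PGL2_class RR (red (\<one>\<^bsub>K\<^esub>, \<zero>\<^bsub>K\<^esub>, \<zero>\<^bsub>K\<^esub>, \<zero>\<^bsub>K\<^esub>)), x) \<in> snd \<Gamma> ^^ n" "(x, y) \<in> snd \<Gamma>"
    by (elim relpow_Suc_E)
  obtain z where z: "quat_walk n z" "x = PGL2_class RR (red z)" using Suc.IH[OF x(1)] by blast
  obtain s where s: "s \<in> basic_quats F (\<ominus> \<one>)" "y = x \<otimes>\<^bsub>PGL2 RR\<^esub> PGL2_class RR (red s)"
    using x(2) unfolding graph_edges by blast
  obtain \<gamma> \<delta> where gd: "s = (\<one>\<^bsub>K\<^esub>, \<zero>\<^bsub>K\<^esub>, \<gamma>, \<delta>)" by (rule basic_quatsE[OF s(1)])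
  have "y = PGL2_class RR (red (K.qstep c \<gamma> \<delta> z))"
    using quat_walk_step_class[OF z(1) s(1)[unfolded gd]] s(2) z(2) gd by simp
  then show ?case using quat_walk.quat_walk_Suc[OF z(1) s(1)[unfolded gd]] by blast
qed

section \<open>Distance to the class of i, and bipartiteness\<close>

lemma g_square: "g \<otimes>\<^bsub>K\<^esub> g = P [^]\<^bsub>K\<^esub> (p ^ e + 1)"
  unfolding N by (simp add: K.nat_pow_mult mult_2)

lemma graph_diam_ge_if_no_approx:
  assumes no_approx: "\<And>h x. h < L \<Longrightarrow> x \<in> carrier K \<Longrightarrow> length x \<le> h div 2 + 1 \<Longrightarrow> c divides\<^bsub>K\<^esub> x \<Longrightarrow>
      (P [^]\<^bsub>K\<^esub> (p ^ e + 1)) divides\<^bsub>K\<^esub> (x \<otimes>\<^bsub>K\<^esub> x \<ominus>\<^bsub>K\<^esub> T [^]\<^bsub>K\<^esub> h) \<Longrightarrow> False"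
  shows "enat L \<le> graph_diam \<Gamma>"
proof (rule graph_diam_ge)
  let ?I = "(\<zero>\<^bsub>RR\<^esub>, \<ominus>\<^bsub>RR\<^esub> \<one>\<^bsub>RR\<^esub>, \<one>\<^bsub>RR\<^esub>, \<zero>\<^bsub>RR\<^esub>)"
  let ?x = "PGL2_class RR (red (\<one>\<^bsub>K\<^esub>, \<zero>\<^bsub>K\<^esub>, \<zero>\<^bsub>K\<^esub>, \<zero>\<^bsub>K\<^esub>))" and ?y = "PGL2_class RR ?I"
  show "?x \<in> fst \<Gamma>" by (rule quat_walk_vertex[OF quat_walk_0])
  \<comment> \<open>The class of \<open>i\<close> is a vertex whatever \<open>t\<close> is modulo
    \<open>g\<close>, because its determinant 1 is a square.\<close>
  have "mat2_det RR ?I = \<one>\<^bsub>RR\<^esub> \<otimes>\<^bsub>RR\<^esub> \<one>\<^bsub>RR\<^esub>" by (simp add: R.minus_eq R.l_minus)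
  moreover from this have "?I \<in> carrier (GL2 RR)" by (simp add: R.carrier_GL2)
  ultimately show "?y \<in> fst \<Gamma>"
    unfolding graph_vertices PSL2_with_det_def using R.Units_one_closed by blast
  fix n assume "(?x, ?y) \<in> snd \<Gamma> ^^ n"
  then obtain z where z: "quat_walk n z" "?y = PGL2_class RR (red z)" using relpow_quat_walk by blast
  obtain x1 x2 x3 x4 where zx: "z = (x1, x2, x3, x4)" by (cases z)
  have x: "x1 \<in> carrier K" "x2 \<in> carrier K" "x3 \<in> carrier K" "x4 \<in> carrier K"
    and norm: "K.qnorm c (x1, x2, x3, x4) = T [^]\<^bsub>K\<^esub> n"
    and dvd: "c divides\<^bsub>K\<^esub> x2" and len: "length x2 \<le> n div 2 + 1"
    using quat_walk_invariants[OF z(1)] unfolding zx by (simp_all only: fst_conv snd_conv mem_Times_iff)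
  obtain u where u: "u \<in> Units RR" "red z = mat2_mult RR (u, \<zero>\<^bsub>RR\<^esub>, \<zero>\<^bsub>RR\<^esub>, u) ?I"
    by (rule R.PGL2_class_eqD[OF quat_walk_red(1)[OF z(1)] z(2)[symmetric]])
  have eq: "R.qmat sa sb (\<rho> x1, \<rho> x2, \<rho> x3, \<rho> x4) = mat2_mult RR (u, \<zero>\<^bsub>RR\<^esub>, \<zero>\<^bsub>RR\<^esub>, u) ?I"
    using u(2) unfolding red_def zx residue4.simps .
  have ab: "sa \<otimes>\<^bsub>RR\<^esub> sa \<oplus>\<^bsub>RR\<^esub> sb \<otimes>\<^bsub>RR\<^esub> sb \<in> Units RR"
    unfolding splitting_props(3) by (rule unit_c)
  note * = R.qmat_eq_scaled_i[OF h.hom_closed[OF x(1)] h.hom_closed[OF x(2)] h.hom_closed[OF x(3)]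
      h.hom_closed[OF x(4)] splitting_props(1,2) R.Units_closed[OF u(1)] unit_two ab eq]
  have g_dvd: "g divides\<^bsub>K\<^esub> x1" "g divides\<^bsub>K\<^esub> x3" "g divides\<^bsub>K\<^esub> x4"
    using * residue_eq_zero_iff[OF x(1)] residue_eq_zero_iff[OF x(3)] residue_eq_zero_iff[OF x(4)] by blast+
  have sq: "(g \<otimes>\<^bsub>K\<^esub> g) divides\<^bsub>K\<^esub> (y \<otimes>\<^bsub>K\<^esub> y)" if y: "g divides\<^bsub>K\<^esub> y" for y
  proof -
    obtain w where w: "w \<in> carrier K" "y = g \<otimes>\<^bsub>K\<^esub> w" using y by (auto simp: factor_def)
    show ?thesis
    proof (rule dividesI)
      show "w \<otimes>\<^bsub>K\<^esub> w \<in> carrier K" using w(1) by simp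
      show "y \<otimes>\<^bsub>K\<^esub> y = g \<otimes>\<^bsub>K\<^esub> g \<otimes>\<^bsub>K\<^esub> (w \<otimes>\<^bsub>K\<^esub> w)"
        unfolding w(2) using w(1) g_closed by (simp only: K.m_ac K.m_closed)
    qed
  qed
  have gg: "g \<otimes>\<^bsub>K\<^esub> g \<in> carrier K" by simp
  have "(g \<otimes>\<^bsub>K\<^esub> g) divides\<^bsub>K\<^esub> (c \<otimes>\<^bsub>K\<^esub> (x3 \<otimes>\<^bsub>K\<^esub> x3 \<oplus>\<^bsub>K\<^esub> x4 \<otimes>\<^bsub>K\<^esub> x4) \<ominus>\<^bsub>K\<^esub> x1 \<otimes>\<^bsub>K\<^esub> x1)"
  proof (rule K.divides_minus[OF K.divides_prod_l sq[OF g_dvd(1)] gg])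
    show "(g \<otimes>\<^bsub>K\<^esub> g) divides\<^bsub>K\<^esub> (x3 \<otimes>\<^bsub>K\<^esub> x3 \<oplus>\<^bsub>K\<^esub> x4 \<otimes>\<^bsub>K\<^esub> x4)"
      by (rule K.divides_add[OF sq[OF g_dvd(2)] sq[OF g_dvd(3)] gg])
  qed (use x in simp_all)
  moreover have "x2 \<otimes>\<^bsub>K\<^esub> x2 \<ominus>\<^bsub>K\<^esub> K.qnorm c (x1, x2, x3, x4)
      = c \<otimes>\<^bsub>K\<^esub> (x3 \<otimes>\<^bsub>K\<^esub> x3 \<oplus>\<^bsub>K\<^esub> x4 \<otimes>\<^bsub>K\<^esub> x4) \<ominus>\<^bsub>K\<^esub> x1 \<otimes>\<^bsub>K\<^esub> x1"
    by (rule K.qnorm_rearrange[OF x c_closed])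
  ultimately have "(P [^]\<^bsub>K\<^esub> (p ^ e + 1)) divides\<^bsub>K\<^esub> (x2 \<otimes>\<^bsub>K\<^esub> x2 \<ominus>\<^bsub>K\<^esub> T [^]\<^bsub>K\<^esub> n)"
    unfolding norm g_square by (simp only:)
  with no_approx[OF _ x(2) len dvd] show "L \<le> n" by (meson not_le_imp_less)
qed

text \<open>A square root of \<open>t\<close> modulo \<open>g\<close> would also be one modulo
  \<open>P\<close>, so the determinant \<open>t\<close> of the generators is a non-square.\<close>

lemma bipartite_graph:
  assumes nonsquare: "\<And>y. y \<in> carrier K \<Longrightarrow> \<not> P divides\<^bsub>K\<^esub> (y \<otimes>\<^bsub>K\<^esub> y \<ominus>\<^bsub>K\<^esub> T)"
  shows "bipartite \<Gamma>"
  unfolding morgenstern_graph_def Let_def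
proof (rule R.cayley_PGL2_bipartite[OF unit_T])
  fix w assume w: "w \<in> Units RR"
  then obtain y where y: "y \<in> carrier K" "w = \<rho> y" using R.Units_closed[OF w] unfolding carrier_RR by blast
  show "\<rho> T \<noteq> w \<otimes>\<^bsub>RR\<^esub> w"
  proof
    assume "\<rho> T = w \<otimes>\<^bsub>RR\<^esub> w"
    then have "\<rho> (y \<otimes>\<^bsub>K\<^esub> y) = \<rho> T" using y by simp
    then have "g divides\<^bsub>K\<^esub> (y \<otimes>\<^bsub>K\<^esub> y \<ominus>\<^bsub>K\<^esub> T)" using residue_eq_iff[of "y \<otimes>\<^bsub>K\<^esub> y" T] y(1) by simp
    then have "P divides\<^bsub>K\<^esub> (y \<otimes>\<^bsub>K\<^esub> y \<ominus>\<^bsub>K\<^esub> T)" by (rule K.divides_trans[OF P_divides_g _ P_closed])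
    with nonsquare[OF y(1)] show False by blast
  qed
next
  fix s assume "s \<in> PGL2_class RR ` reduce_quat F (\<ominus> \<one>) g ` basic_quats F (\<ominus> \<one>)"
  then obtain b where b: "b \<in> basic_quats F (\<ominus> \<one>)" "s = PGL2_class RR (reduce_quat F (\<ominus> \<one>) g b)" by blast
  show "\<exists>M\<in>carrier (GL2 RR). mat2_det RR M = \<rho> T \<and> s = PGL2_class RR M"
    using basic_quat_red[OF b(1)] b(2) by (intro bexI[of _ "red b"]) simp_all
qed

text \<open>If \<open>w\<close> is the pure part of a basic quaternion then \<open>w\<^sup>2 = 1 - t\<close>, so the powers of
  \<open>1 + w\<close> are computed in \<open>quad_ring K (1 - t)\<close>.\<close>

lemma quat_walk_power:
  assumes "\<gamma> \<in> carrier K" "\<delta> \<in> carrier K" "\<gamma> \<otimes>\<^bsub>K\<^esub> \<gamma> \<oplus>\<^bsub>K\<^esub> \<delta> \<otimes>\<^bsub>K\<^esub> \<delta> = \<ominus>\<^bsub>K\<^esub> \<one>\<^bsub>K\<^esub>"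
    and basic: "(\<one>\<^bsub>K\<^esub>, \<zero>\<^bsub>K\<^esub>, \<gamma>, \<delta>) \<in> basic_quats F (\<ominus> \<one>)"
  shows "\<exists>a\<in>carrier K. \<exists>b\<in>carrier K. (\<one>\<^bsub>K\<^esub>, \<one>\<^bsub>K\<^esub>) [^]\<^bsub>quad_ring K (\<ominus>\<^bsub>K\<^esub> c)\<^esub> n = (a, b) \<and>
    quat_walk n (a, \<zero>\<^bsub>K\<^esub>, b \<otimes>\<^bsub>K\<^esub> \<gamma>, b \<otimes>\<^bsub>K\<^esub> \<delta>)"
proof (induction n)
  case 0
  show ?case using quat_walk_0 assms(1,2) by (intro bexI[of _ "\<one>\<^bsub>K\<^esub>"] bexI[of _ "\<zero>\<^bsub>K\<^esub>"]) simp_all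
next
  case (Suc n)
  then obtain a b where ab: "a \<in> carrier K" "b \<in> carrier K"
    "(\<one>\<^bsub>K\<^esub>, \<one>\<^bsub>K\<^esub>) [^]\<^bsub>quad_ring K (\<ominus>\<^bsub>K\<^esub> c)\<^esub> n = (a, b)"
    "quat_walk n (a, \<zero>\<^bsub>K\<^esub>, b \<otimes>\<^bsub>K\<^esub> \<gamma>, b \<otimes>\<^bsub>K\<^esub> \<delta>)" by blast
  interpret Q: cring "quad_ring K (\<ominus>\<^bsub>K\<^esub> c)" by (rule K.cring_quad_ring) simp
  have "(\<one>\<^bsub>K\<^esub>, \<one>\<^bsub>K\<^esub>) [^]\<^bsub>quad_ring K (\<ominus>\<^bsub>K\<^esub> c)\<^esub> Suc n = (a \<ominus>\<^bsub>K\<^esub> c \<otimes>\<^bsub>K\<^esub> b, a \<oplus>\<^bsub>K\<^esub> b)"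
    using ab(1,2) unfolding Q.nat_pow_Suc ab(3) by (simp add: K.minus_eq K.l_minus)
  moreover have "K.qstep c \<gamma> \<delta> (a, \<zero>\<^bsub>K\<^esub>, b \<otimes>\<^bsub>K\<^esub> \<gamma>, b \<otimes>\<^bsub>K\<^esub> \<delta>)
      = (a \<ominus>\<^bsub>K\<^esub> c \<otimes>\<^bsub>K\<^esub> b, \<zero>\<^bsub>K\<^esub>, (a \<oplus>\<^bsub>K\<^esub> b) \<otimes>\<^bsub>K\<^esub> \<gamma>, (a \<oplus>\<^bsub>K\<^esub> b) \<otimes>\<^bsub>K\<^esub> \<delta>)"
    by (rule K.qstep_pure[OF ab(1,2) c_closed assms(1-3)])
  moreover note quat_walk.quat_walk_Suc[OF ab(4) basic]
  moreover have "a \<ominus>\<^bsub>K\<^esub> c \<otimes>\<^bsub>K\<^esub> b \<in> carrier K" "a \<oplus>\<^bsub>K\<^esub> b \<in> carrier K" using ab(1,2) by simp_all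
  ultimately show ?case by (intro bexI[of _ "a \<ominus>\<^bsub>K\<^esub> c \<otimes>\<^bsub>K\<^esub> b"] bexI[of _ "a \<oplus>\<^bsub>K\<^esub> b"]) (simp_all only:)
qed

text \<open>One basic quaternion is repeated \<open>m * p ^ e\<close> times. Its power
  \<open>m\<close> has a pure part divisible by \<open>P\<close>, the Frobenius power makes this
  \<open>P ^ (p ^ e)\<close>, and \<open>N \<le> p ^ e\<close>, so modulo \<open>g\<close> only a
  scalar is left.\<close>

lemma not_bipartite_graph:
  assumes m: "odd (m::nat)" and dvd: "P divides\<^bsub>K\<^esub> snd ((\<one>\<^bsub>K\<^esub>, \<one>\<^bsub>K\<^esub>) [^]\<^bsub>quad_ring K (\<ominus>\<^bsub>K\<^esub> c)\<^esub> m)"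
    and p: "odd p"
  shows "\<not> bipartite \<Gamma>"
proof -
  let ?Q = "quad_ring K (\<ominus>\<^bsub>K\<^esub> c)" and ?n = "m * p ^ e"
  interpret Q: cring ?Q by (rule K.cring_quad_ring) simp
  obtain \<gamma> \<delta> where gd: "\<gamma> \<in> carrier K" "\<delta> \<in> carrier K"
    "\<gamma> \<otimes>\<^bsub>K\<^esub> \<gamma> \<oplus>\<^bsub>K\<^esub> \<delta> \<otimes>\<^bsub>K\<^esub> \<delta> = \<ominus>\<^bsub>K\<^esub> \<one>\<^bsub>K\<^esub>" "(\<one>\<^bsub>K\<^esub>, \<zero>\<^bsub>K\<^esub>, \<gamma>, \<delta>) \<in> basic_quats F (\<ominus> \<one>)"
    by (rule basic_quat_exists)
  obtain a b where ab: "a \<in> carrier K" "b \<in> carrier K" "(\<one>\<^bsub>K\<^esub>, \<one>\<^bsub>K\<^esub>) [^]\<^bsub>?Q\<^esub> ?n = (a, b)"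
    "quat_walk ?n (a, \<zero>\<^bsub>K\<^esub>, b \<otimes>\<^bsub>K\<^esub> \<gamma>, b \<otimes>\<^bsub>K\<^esub> \<delta>)"
    using quat_walk_power[OF gd, of ?n] by blast
  obtain a' b' where ab': "a' \<in> carrier K" "b' \<in> carrier K" "(\<one>\<^bsub>K\<^esub>, \<one>\<^bsub>K\<^esub>) [^]\<^bsub>?Q\<^esub> m = (a', b')"
    using quat_walk_power[OF gd, of m] by blast
  have "(\<one>\<^bsub>K\<^esub>, \<one>\<^bsub>K\<^esub>) [^]\<^bsub>?Q\<^esub> ?n = (a', b') [^]\<^bsub>?Q\<^esub> (p ^ e)"
    unfolding ab'(3)[symmetric] by (simp add: Q.nat_pow_pow)
  then have "(a', b') [^]\<^bsub>?Q\<^esub> (p ^ e) = (a, b)" using ab(3) by (simp only:)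
  then have b: "b = snd ((a', b') [^]\<^bsub>?Q\<^esub> (p ^ e))" by (simp only: snd_conv)
  have "(P [^]\<^bsub>K\<^esub> (p ^ e)) divides\<^bsub>K\<^esub> b"
    unfolding b using dvd unfolding ab'(3) snd_conv
    by (intro K.quad_ring_snd_pow_divides[OF p_prime add_pow_K[OF char_p] _ ab'(1,2) P_closed]) simp_all
  then have "g divides\<^bsub>K\<^esub> b"
    by (rule K.divides_trans[OF K.divides_pow_mono[OF P_closed p_pow_pred(2)] _ g_closed])
  then have b0: "\<rho> b = \<zero>\<^bsub>RR\<^esub>" using residue_eq_zero_iff[OF ab(2)] by blast
  have a: "\<rho> a \<in> carrier RR" using ab(1) by simp
  let ?z = "(a, \<zero>\<^bsub>K\<^esub>, b \<otimes>\<^bsub>K\<^esub> \<gamma>, b \<otimes>\<^bsub>K\<^esub> \<delta>)"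
  have red: "red ?z = (\<rho> a, \<zero>\<^bsub>RR\<^esub>, \<zero>\<^bsub>RR\<^esub>, \<rho> a)"
    unfolding red_def using ab(1,2) gd(1,2) b0 a splitting_props(1,2) by (simp add: R.minus_eq)
  \<comment> \<open>The matrix lies in \<open>GL2\<close>, so its determinant, the square of
    \<open>\<rho> a\<close>, is a unit; only then is the scalar matrix trivial in
    \<open>PGL2\<close>.\<close>
  have "\<rho> a \<otimes>\<^bsub>RR\<^esub> \<rho> a \<in> Units RR"
    using quat_walk_red(1)[OF ab(4)] a unfolding red R.carrier_GL2 by (simp add: R.minus_eq)
  then have au: "\<rho> a \<in> Units RR" using R.unit_factor a by blast
  let ?one = "(\<one>\<^bsub>RR\<^esub>, \<zero>\<^bsub>RR\<^esub>, \<zero>\<^bsub>RR\<^esub>, \<one>\<^bsub>RR\<^esub>)"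
  have one: "?one \<in> carrier (GL2 RR)" using quat_walk_red(1)[OF quat_walk_0] unfolding red_one .
  have "red ?z = mat2_mult RR (\<rho> a, \<zero>\<^bsub>RR\<^esub>, \<zero>\<^bsub>RR\<^esub>, \<rho> a) ?one" unfolding red using a by simp
  then have "PGL2_class RR (red ?z) = PGL2_class RR ?one" using R.PGL2_class_scale(1)[OF au one] by simp
  then have "(PGL2_class RR ?one, PGL2_class RR ?one) \<in> snd \<Gamma> ^^ ?n"
    using quat_walk_relpow[OF ab(4)] unfolding red_one by simp
  then show ?thesis by (rule not_bipartite_if_odd_cycle) (use m p in simp)
qed

lemma card_graph_vertices:
  "finite (fst \<Gamma>)" "fst \<Gamma> \<noteq> {}"
  "card (fst \<Gamma>) \<le> 2 * card (carrier F) ^ (3 * (N * degree P))"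
proof -
  have *: "finite (PSL2_with_det RR (\<rho> T))" "card (PSL2_with_det RR (\<rho> T)) \<le> 2 * card (carrier RR) ^ 3"
    by (rule R.card_PSL2_with_det_le[OF card_RR(1)], erule first_row_unit)+
  show "finite (fst \<Gamma>)" unfolding graph_vertices by (rule *(1))
  show "fst \<Gamma> \<noteq> {}" using quat_walk_vertex[OF quat_walk_0] by blast
  have "card (carrier RR) ^ 3 \<le> (card (carrier F) ^ (N * degree P)) ^ 3"
    using card_RR(2) by (rule power_mono) simp
  also have "\<dots> = card (carrier F) ^ (3 * (N * degree P))"
    by (simp add: power_mult[symmetric] mult.commute)
  finally show "card (fst \<Gamma>) \<le> 2 * card (carrier F) ^ (3 * (N * degree P))"
    unfolding graph_vertices using *(2) by linarith
qed

section \<open>Square roots of powers of the indeterminate\<close>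

text \<open>Exploits the last factor of \<open>P ^ (Q + 1)\<close> once the modulus
  \<open>P ^ Q\<close> has determined a root.\<close>

lemma pow_Suc_divides_cancel:
  assumes "(P [^]\<^bsub>K\<^esub> (n + 1 :: nat)) divides\<^bsub>K\<^esub> (P [^]\<^bsub>K\<^esub> n \<otimes>\<^bsub>K\<^esub> y)" "y \<in> carrier K"
  shows "P divides\<^bsub>K\<^esub> y"
proof -
  obtain z where z: "z \<in> carrier K" "P [^]\<^bsub>K\<^esub> n \<otimes>\<^bsub>K\<^esub> y = P [^]\<^bsub>K\<^esub> (n + 1) \<otimes>\<^bsub>K\<^esub> z"
    using assms(1) by (auto simp: factor_def)
  then have "P [^]\<^bsub>K\<^esub> n \<otimes>\<^bsub>K\<^esub> y = P [^]\<^bsub>K\<^esub> n \<otimes>\<^bsub>K\<^esub> (P \<otimes>\<^bsub>K\<^esub> z)" by (simp add: K.m_assoc)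
  then have "y = P \<otimes>\<^bsub>K\<^esub> z"
    using K.m_lcancel[OF P_pow_nonzero[of n] K.nat_pow_closed[OF P_closed, of n] assms(2), of "P \<otimes>\<^bsub>K\<^esub> z"] z(1) by simp
  then show ?thesis by (rule dividesI[OF z(1)])
qed

lemma P_not_dvd_T_pow: "\<not> P divides\<^bsub>K\<^esub> (T [^]\<^bsub>K\<^esub> (n::nat))"
  by (rule P_not_dvd_pow[OF T_closed not_dvd_T])

text \<open>\<open>P\<close> cannot divide both \<open>x - y\<close> and \<open>x + y\<close>, whose
  difference is \<open>2 y\<close> up to sign, so the whole power falls on one of them.\<close>

lemma square_divides_difference:
  assumes cl: "x \<in> carrier K" "y \<in> carrier K" and ndvd: "\<not> P divides\<^bsub>K\<^esub> y"
    and dvd: "(P [^]\<^bsub>K\<^esub> (n::nat)) divides\<^bsub>K\<^esub> (x \<otimes>\<^bsub>K\<^esub> x \<ominus>\<^bsub>K\<^esub> y \<otimes>\<^bsub>K\<^esub> y)"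
  shows "(P [^]\<^bsub>K\<^esub> n) divides\<^bsub>K\<^esub> (x \<ominus>\<^bsub>K\<^esub> y) \<or> (P [^]\<^bsub>K\<^esub> n) divides\<^bsub>K\<^esub> (x \<oplus>\<^bsub>K\<^esub> y)"
proof (rule pow_divides_one_factor)
  have "x \<otimes>\<^bsub>K\<^esub> x \<ominus>\<^bsub>K\<^esub> y \<otimes>\<^bsub>K\<^esub> y = (x \<ominus>\<^bsub>K\<^esub> y) \<otimes>\<^bsub>K\<^esub> (x \<oplus>\<^bsub>K\<^esub> y)"
    using cl by algebra
  with dvd show "(P [^]\<^bsub>K\<^esub> n) divides\<^bsub>K\<^esub> ((x \<ominus>\<^bsub>K\<^esub> y) \<otimes>\<^bsub>K\<^esub> (x \<oplus>\<^bsub>K\<^esub> y))" by (simp only:)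
  show "\<not> (P divides\<^bsub>K\<^esub> (x \<ominus>\<^bsub>K\<^esub> y) \<and> P divides\<^bsub>K\<^esub> (x \<oplus>\<^bsub>K\<^esub> y))"
  proof
    assume *: "P divides\<^bsub>K\<^esub> (x \<ominus>\<^bsub>K\<^esub> y) \<and> P divides\<^bsub>K\<^esub> (x \<oplus>\<^bsub>K\<^esub> y)"
    have "P divides\<^bsub>K\<^esub> ((x \<oplus>\<^bsub>K\<^esub> y) \<ominus>\<^bsub>K\<^esub> (x \<ominus>\<^bsub>K\<^esub> y))"
      by (rule K.divides_minus[OF conjunct2[OF *] conjunct1[OF *] P_closed])
    moreover have "(x \<oplus>\<^bsub>K\<^esub> y) \<ominus>\<^bsub>K\<^esub> (x \<ominus>\<^bsub>K\<^esub> y) = (\<one>\<^bsub>K\<^esub> \<oplus>\<^bsub>K\<^esub> \<one>\<^bsub>K\<^esub>) \<otimes>\<^bsub>K\<^esub> y"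
      using cl by algebra
    ultimately have "P divides\<^bsub>K\<^esub> ((\<one>\<^bsub>K\<^esub> \<oplus>\<^bsub>K\<^esub> \<one>\<^bsub>K\<^esub>) \<otimes>\<^bsub>K\<^esub> y)" by (simp only:)
    then show False
      using P_prime[OF K.Units_closed[OF two_unit_K] cl(2)] P_not_unit[OF two_unit_K] ndvd by blast
  qed
qed (use cl in simp_all)

text \<open>The sign in \<open>x w \<equiv> \<plusminus>y\<close> is absorbed into \<open>x\<close>.\<close>

lemma square_congruence_root:
  assumes cl: "x \<in> carrier K" "w \<in> carrier K" "y \<in> carrier K" and ndvd: "\<not> P divides\<^bsub>K\<^esub> y"
    and dvd: "(P [^]\<^bsub>K\<^esub> (n::nat)) divides\<^bsub>K\<^esub> ((x \<otimes>\<^bsub>K\<^esub> w) \<otimes>\<^bsub>K\<^esub> (x \<otimes>\<^bsub>K\<^esub> w) \<ominus>\<^bsub>K\<^esub> y \<otimes>\<^bsub>K\<^esub> y)"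
  obtains x' where "x' \<in> carrier K" "x' \<otimes>\<^bsub>K\<^esub> x' = x \<otimes>\<^bsub>K\<^esub> x" "length x' = length x"
    "(P [^]\<^bsub>K\<^esub> n) divides\<^bsub>K\<^esub> (x' \<otimes>\<^bsub>K\<^esub> w \<ominus>\<^bsub>K\<^esub> y)"
proof -
  have xw: "x \<otimes>\<^bsub>K\<^esub> w \<in> carrier K" using cl by simp
  have Pn: "P [^]\<^bsub>K\<^esub> n \<in> carrier K" by simp
  consider "(P [^]\<^bsub>K\<^esub> n) divides\<^bsub>K\<^esub> (x \<otimes>\<^bsub>K\<^esub> w \<ominus>\<^bsub>K\<^esub> y)" | "(P [^]\<^bsub>K\<^esub> n) divides\<^bsub>K\<^esub> (x \<otimes>\<^bsub>K\<^esub> w \<oplus>\<^bsub>K\<^esub> y)"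
    using square_divides_difference[OF xw cl(3) ndvd dvd] by blast
  then show thesis
  proof cases
    case 1
    then show thesis using that[OF cl(1)] by blast
  next
    case 2
    have "\<ominus>\<^bsub>K\<^esub> (x \<otimes>\<^bsub>K\<^esub> w \<oplus>\<^bsub>K\<^esub> y) = (\<ominus>\<^bsub>K\<^esub> x) \<otimes>\<^bsub>K\<^esub> w \<ominus>\<^bsub>K\<^esub> y"
      using cl by (simp add: K.minus_add K.l_minus K.minus_eq)
    with K.divides_uminus[OF 2 Pn] have "(P [^]\<^bsub>K\<^esub> n) divides\<^bsub>K\<^esub> ((\<ominus>\<^bsub>K\<^esub> x) \<otimes>\<^bsub>K\<^esub> w \<ominus>\<^bsub>K\<^esub> y)" by (simp only:)
    moreover have "(\<ominus>\<^bsub>K\<^esub> x) \<otimes>\<^bsub>K\<^esub> (\<ominus>\<^bsub>K\<^esub> x) = x \<otimes>\<^bsub>K\<^esub> x" using cl by (simp add: K.l_minus K.r_minus)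
    moreover have "length (\<ominus>\<^bsub>K\<^esub> x) = length x" by (rule length_uminus[OF cl(1)])
    ultimately show thesis using that[of "\<ominus>\<^bsub>K\<^esub> x"] cl(1) by blast
  qed
qed

lemma eq_if_short:
  assumes "(P [^]\<^bsub>K\<^esub> (n::nat)) divides\<^bsub>K\<^esub> (x \<ominus>\<^bsub>K\<^esub> y)" "x \<in> carrier K" "y \<in> carrier K"
    and "length x \<le> n * degree P" "length y \<le> n * degree P"
  shows "x = y"
proof -
  have "length (x \<ominus>\<^bsub>K\<^esub> y) \<le> n * degree P" by (rule length_minus_le[OF assms(4,5,3)])
  then have "x \<ominus>\<^bsub>K\<^esub> y = \<zero>\<^bsub>K\<^esub>"
    by (intro divides_short_imp_zero[OF assms(1)]) (simp_all add: length_P_pow)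
  then show ?thesis using assms(2,3) by simp
qed

text \<open>Evaluation at 1 kills \<open>t - 1\<close> but sends powers of \<open>t\<close> to
  1.\<close>

lemma c_not_dvd_T_pow: "\<not> c divides\<^bsub>K\<^esub> (T [^]\<^bsub>K\<^esub> (n::nat))"
proof
  assume "c divides\<^bsub>K\<^esub> (T [^]\<^bsub>K\<^esub> n)"
  then obtain z where z: "z \<in> carrier K" "T [^]\<^bsub>K\<^esub> n = c \<otimes>\<^bsub>K\<^esub> z" by (auto simp: factor_def)
  interpret v: ring_hom_cring K F "\<lambda>p. eval p \<one>" by (rule eval_hom) simp
  have T1: "eval T \<one> = \<one>" by (simp add: eval_var)
  have "eval (T [^]\<^bsub>K\<^esub> n) \<one> = \<one>" by (induction n) (simp_all add: T1)
  moreover have "eval (c \<otimes>\<^bsub>K\<^esub> z) \<one> = \<zero>"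
    using z(1) by (simp add: c_def K.minus_eq T1 r_neg)
  ultimately show False using z(2) by simp
qed

lemma even_no_approx:
  assumes x: "x \<in> carrier K" "length x \<le> k + 1" "c divides\<^bsub>K\<^esub> x"
    and dvd: "(P [^]\<^bsub>K\<^esub> (n::nat)) divides\<^bsub>K\<^esub> (x \<otimes>\<^bsub>K\<^esub> x \<ominus>\<^bsub>K\<^esub> T [^]\<^bsub>K\<^esub> (2 * k))"
    and short: "k + 1 \<le> n * degree P"
  shows False
proof -
  have eq: "T [^]\<^bsub>K\<^esub> (2 * k) = T [^]\<^bsub>K\<^esub> k \<otimes>\<^bsub>K\<^esub> T [^]\<^bsub>K\<^esub> k" by (simp add: K.nat_pow_mult mult_2)
  \<comment> \<open>The factor one fits the multiplier \<open>w\<close> of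
    \<open>square_congruence_root\<close>, which is non-trivial only for odd powers of
    \<open>t\<close>.\<close>
  have d: "(P [^]\<^bsub>K\<^esub> n) divides\<^bsub>K\<^esub> ((x \<otimes>\<^bsub>K\<^esub> \<one>\<^bsub>K\<^esub>) \<otimes>\<^bsub>K\<^esub> (x \<otimes>\<^bsub>K\<^esub> \<one>\<^bsub>K\<^esub>) \<ominus>\<^bsub>K\<^esub> T [^]\<^bsub>K\<^esub> k \<otimes>\<^bsub>K\<^esub> T [^]\<^bsub>K\<^esub> k)"
    using dvd unfolding eq K.r_one[OF x(1)] .
  obtain y where y: "y \<in> carrier K" "y \<otimes>\<^bsub>K\<^esub> y = x \<otimes>\<^bsub>K\<^esub> x" "length y = length x"
    "(P [^]\<^bsub>K\<^esub> n) divides\<^bsub>K\<^esub> (y \<otimes>\<^bsub>K\<^esub> \<one>\<^bsub>K\<^esub> \<ominus>\<^bsub>K\<^esub> T [^]\<^bsub>K\<^esub> k)"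
    by (rule square_congruence_root[OF x(1) K.one_closed K.nat_pow_closed[OF T_closed] P_not_dvd_T_pow d])
  have "y = T [^]\<^bsub>K\<^esub> k"
    by (rule eq_if_short[OF y(4)[unfolded K.r_one[OF y(1)]]]) (use y x short in simp_all)
  then have "x \<otimes>\<^bsub>K\<^esub> x = T [^]\<^bsub>K\<^esub> (2 * k)" using y(2) eq by simp
  moreover have "c divides\<^bsub>K\<^esub> (x \<otimes>\<^bsub>K\<^esub> x)" by (rule K.divides_prod_r[OF x(3) c_closed x(1)])
  ultimately show False using c_not_dvd_T_pow by (simp only:)
qed

abbreviation "two \<equiv> \<one>\<^bsub>K\<^esub> \<oplus>\<^bsub>K\<^esub> \<one>\<^bsub>K\<^esub>"

lemma length_two: "length two \<le> Suc 0"
  by (intro length_add_le) (simp_all add: univ_poly_one)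

text \<open>Modulo \<open>P ^ Q = t ^ Q - 4\<close> the number \<open>t ^ (2 * k + 1 + Q)\<close> is the square of \<open>t ^ m\<close> as well
  as \<open>4\<close> times \<open>t ^ (2 * k + 1)\<close>.\<close>

lemma odd_no_approx_linear:
  assumes deg: "degree P = 1" and PQ: "P [^]\<^bsub>K\<^esub> (p ^ e) = T [^]\<^bsub>K\<^esub> (p ^ e) \<ominus>\<^bsub>K\<^esub> two \<otimes>\<^bsub>K\<^esub> two"
    and x: "x \<in> carrier K" "length x \<le> k + 1"
    and dvd: "(P [^]\<^bsub>K\<^esub> (p ^ e + 1)) divides\<^bsub>K\<^esub> (x \<otimes>\<^bsub>K\<^esub> x \<ominus>\<^bsub>K\<^esub> T [^]\<^bsub>K\<^esub> (2 * k + 1))"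
    and k: "k < p ^ e"
  shows False
proof -
  define Q where "Q = p ^ e"
  define m where "m = k + N"
  define D where "D = two"
  define M where "M = T [^]\<^bsub>K\<^esub> m"
  define S where "S = T [^]\<^bsub>K\<^esub> (2 * k + 1)"
  define V where "V = T [^]\<^bsub>K\<^esub> Q"
  have cl: "D \<in> carrier K" "M \<in> carrier K" "S \<in> carrier K" "V \<in> carrier K"
    by (simp_all add: D_def M_def S_def V_def)
  have QN: "Q + 1 = 2 * N" using N by (simp add: Q_def)
  have PQ': "P [^]\<^bsub>K\<^esub> Q = V \<ominus>\<^bsub>K\<^esub> D \<otimes>\<^bsub>K\<^esub> D" using PQ by (simp add: Q_def V_def D_def)
  have Pc: "P [^]\<^bsub>K\<^esub> Q \<in> carrier K" by simp
  have sz: "Q * degree P = Q" by (simp only: deg mult_1_right)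
  \<comment> \<open>Since \<open>Q\<close> is odd, the shift by \<open>Q\<close> turns the odd
    exponent \<open>2 k + 1\<close> into an even one.\<close>
  have "m + m = 2 * k + 1 + Q" using QN by (simp add: m_def)
  then have MM: "M \<otimes>\<^bsub>K\<^esub> M = S \<otimes>\<^bsub>K\<^esub> V" by (simp only: M_def S_def V_def K.nat_pow_mult[OF T_closed])
  have "(P [^]\<^bsub>K\<^esub> Q) divides\<^bsub>K\<^esub> (P [^]\<^bsub>K\<^esub> (Q + 1))" by (rule K.divides_pow_mono) simp_all
  then have d1: "(P [^]\<^bsub>K\<^esub> Q) divides\<^bsub>K\<^esub> (x \<otimes>\<^bsub>K\<^esub> x \<ominus>\<^bsub>K\<^esub> S)"
    using dvd unfolding Q_def[symmetric] S_def[symmetric] by (rule K.divides_trans[OF _ _ Pc])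
  \<comment> \<open>A multiple of \<open>P ^ Q\<close> is subtracted to replace
    \<open>4 t ^ (2 k + 1)\<close> by \<open>t ^ (2 k + 1 + Q)\<close>.\<close>
  have "(P [^]\<^bsub>K\<^esub> Q) divides\<^bsub>K\<^esub> (D \<otimes>\<^bsub>K\<^esub> D \<otimes>\<^bsub>K\<^esub> (x \<otimes>\<^bsub>K\<^esub> x \<ominus>\<^bsub>K\<^esub> S) \<ominus>\<^bsub>K\<^esub> S \<otimes>\<^bsub>K\<^esub> (P [^]\<^bsub>K\<^esub> Q))"
    by (rule K.divides_minus[OF K.divides_prod_l[OF Pc _ _ d1] K.divides_prod_l[OF Pc _ _ K.divides_refl] Pc])
      (use cl x in simp_all)
  moreover have "D \<otimes>\<^bsub>K\<^esub> D \<otimes>\<^bsub>K\<^esub> (x \<otimes>\<^bsub>K\<^esub> x \<ominus>\<^bsub>K\<^esub> S) \<ominus>\<^bsub>K\<^esub> S \<otimes>\<^bsub>K\<^esub> (V \<ominus>\<^bsub>K\<^esub> D \<otimes>\<^bsub>K\<^esub> D)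
      = (x \<otimes>\<^bsub>K\<^esub> D) \<otimes>\<^bsub>K\<^esub> (x \<otimes>\<^bsub>K\<^esub> D) \<ominus>\<^bsub>K\<^esub> S \<otimes>\<^bsub>K\<^esub> V"
    using cl x(1) by algebra
  ultimately have "(P [^]\<^bsub>K\<^esub> Q) divides\<^bsub>K\<^esub> ((x \<otimes>\<^bsub>K\<^esub> D) \<otimes>\<^bsub>K\<^esub> (x \<otimes>\<^bsub>K\<^esub> D) \<ominus>\<^bsub>K\<^esub> M \<otimes>\<^bsub>K\<^esub> M)"
    unfolding MM PQ' by (simp only:)
  from square_congruence_root[OF x(1) cl(1,2) _ this]
  obtain y where y: "y \<in> carrier K" "y \<otimes>\<^bsub>K\<^esub> y = x \<otimes>\<^bsub>K\<^esub> x" "length y = length x"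
    "(P [^]\<^bsub>K\<^esub> Q) divides\<^bsub>K\<^esub> (y \<otimes>\<^bsub>K\<^esub> D \<ominus>\<^bsub>K\<^esub> M)"
    using P_not_dvd_T_pow[of m] unfolding M_def by blast
  have yD: "length (y \<otimes>\<^bsub>K\<^esub> D) \<le> k + 1"
    using length_mult_le[OF y(1) cl(1), of "k + 1" 0] y(3) x(2) length_two by (simp add: D_def)
  show False
  proof (cases "m < Q")
    case True
    \<comment> \<open>Both sides are shorter than the modulus, so the congruence is an equality; but
      \<open>2 y\<close> has degree at most \<open>k\<close> and \<open>t ^ m\<close> has degree
      \<open>k + N\<close>.\<close>
    have "y \<otimes>\<^bsub>K\<^esub> D = M"
      by (rule eq_if_short[OF y(4), unfolded sz]) (use y(1) cl yD k True in \<open>simp_all add: M_def Q_def\<close>)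
    then have "m + 1 \<le> k + 1" using yD by (simp add: M_def)
    then show False using N_pos by (simp add: m_def)
  next
    case False
    define r where "r = m - Q"
    define A where "A = T [^]\<^bsub>K\<^esub> r"
    have r: "m = r + Q" using False by (simp add: r_def)
    have rQ: "r < Q" using k QN r by (simp add: m_def Q_def)
    have A: "A \<in> carrier K" by (simp add: A_def)
    have M: "M = A \<otimes>\<^bsub>K\<^esub> V" by (simp add: M_def A_def V_def r K.nat_pow_mult)
    have "2 * k + 1 = r + r + Q" using QN r by (simp add: m_def)
    then have S: "S = A \<otimes>\<^bsub>K\<^esub> A \<otimes>\<^bsub>K\<^esub> V" by (simp only: S_def A_def V_def K.nat_pow_mult[OF T_closed])
    \<comment> \<open>Now \<open>t ^ m = t ^ r t ^ Q\<close> reduces to \<open>4 t ^ r\<close>. The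
      resulting root \<open>y = 2 t ^ r\<close> can be short, so its degree gives no
      contradiction.\<close>
    have "(P [^]\<^bsub>K\<^esub> Q) divides\<^bsub>K\<^esub> (y \<otimes>\<^bsub>K\<^esub> D \<ominus>\<^bsub>K\<^esub> M \<oplus>\<^bsub>K\<^esub> A \<otimes>\<^bsub>K\<^esub> (P [^]\<^bsub>K\<^esub> Q))"
      by (rule K.divides_add[OF y(4) K.divides_prod_l[OF Pc _ _ K.divides_refl] Pc]) (use A in simp_all)
    moreover have "y \<otimes>\<^bsub>K\<^esub> D \<ominus>\<^bsub>K\<^esub> A \<otimes>\<^bsub>K\<^esub> V \<oplus>\<^bsub>K\<^esub> A \<otimes>\<^bsub>K\<^esub> (V \<ominus>\<^bsub>K\<^esub> D \<otimes>\<^bsub>K\<^esub> D) = y \<otimes>\<^bsub>K\<^esub> D \<ominus>\<^bsub>K\<^esub> A \<otimes>\<^bsub>K\<^esub> D \<otimes>\<^bsub>K\<^esub> D"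
      using cl y(1) A by algebra
    ultimately have d2: "(P [^]\<^bsub>K\<^esub> Q) divides\<^bsub>K\<^esub> (y \<otimes>\<^bsub>K\<^esub> D \<ominus>\<^bsub>K\<^esub> A \<otimes>\<^bsub>K\<^esub> D \<otimes>\<^bsub>K\<^esub> D)" unfolding M PQ' by (simp only:)
    have "length (A \<otimes>\<^bsub>K\<^esub> D) \<le> r + 1"
      using length_mult_le[OF A cl(1), of "r + 1" 0] length_two by (simp add: D_def A_def)
    then have "length (A \<otimes>\<^bsub>K\<^esub> D \<otimes>\<^bsub>K\<^esub> D) \<le> r + 1"
      using length_mult_le[OF _ cl(1), of "A \<otimes>\<^bsub>K\<^esub> D" "r + 1" 0] length_two A cl(1) by (simp add: D_def)
    then have "y \<otimes>\<^bsub>K\<^esub> D = A \<otimes>\<^bsub>K\<^esub> D \<otimes>\<^bsub>K\<^esub> D"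
      by (intro eq_if_short[OF d2, unfolded sz]) (use y(1) cl A yD k rQ in \<open>simp_all add: Q_def\<close>)
    moreover have "D \<noteq> \<zero>\<^bsub>K\<^esub>"
    proof
      assume "D = \<zero>\<^bsub>K\<^esub>"
      then show False using P_not_unit[OF two_unit_K] K.divides_zero[OF P_closed] unfolding D_def by (simp only: simp_thms)
    qed
    ultimately have yAD: "y = A \<otimes>\<^bsub>K\<^esub> D"
      using K.m_rcancel[OF _ cl(1) y(1) K.m_closed[OF A cl(1)]] by blast
    \<comment> \<open>This root fails at the last factor \<open>P\<close>: the difference is exactly
      \<open>-t ^ (2 r) P ^ Q\<close>.\<close>
    have "x \<otimes>\<^bsub>K\<^esub> x \<ominus>\<^bsub>K\<^esub> S = A \<otimes>\<^bsub>K\<^esub> D \<otimes>\<^bsub>K\<^esub> (A \<otimes>\<^bsub>K\<^esub> D) \<ominus>\<^bsub>K\<^esub> A \<otimes>\<^bsub>K\<^esub> A \<otimes>\<^bsub>K\<^esub> V"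
      unfolding y(2)[symmetric] yAD S ..
    also have "\<dots> = (V \<ominus>\<^bsub>K\<^esub> D \<otimes>\<^bsub>K\<^esub> D) \<otimes>\<^bsub>K\<^esub> (\<ominus>\<^bsub>K\<^esub> (A \<otimes>\<^bsub>K\<^esub> A))"
      using cl A by algebra
    finally have "(P [^]\<^bsub>K\<^esub> (Q + 1)) divides\<^bsub>K\<^esub> (P [^]\<^bsub>K\<^esub> Q \<otimes>\<^bsub>K\<^esub> (\<ominus>\<^bsub>K\<^esub> (A \<otimes>\<^bsub>K\<^esub> A)))"
      using dvd unfolding PQ' Q_def[symmetric] S_def[symmetric] by (simp only:)
    then have "P divides\<^bsub>K\<^esub> (\<ominus>\<^bsub>K\<^esub> (A \<otimes>\<^bsub>K\<^esub> A))" by (rule pow_Suc_divides_cancel) (use A in simp)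
    then have "P divides\<^bsub>K\<^esub> (\<ominus>\<^bsub>K\<^esub> (\<ominus>\<^bsub>K\<^esub> (A \<otimes>\<^bsub>K\<^esub> A)))" by (rule K.divides_uminus) simp
    moreover have "\<ominus>\<^bsub>K\<^esub> (\<ominus>\<^bsub>K\<^esub> (A \<otimes>\<^bsub>K\<^esub> A)) = T [^]\<^bsub>K\<^esub> (r + r)" using A by (simp add: A_def K.nat_pow_mult)
    ultimately show False using P_not_dvd_T_pow by (simp only:)
  qed
qed

text \<open>Here \<open>P ^ Q = u\<^sup>2 + 1\<close> with \<open>u = t ^ Q\<close>, so that \<open>u\<close> is congruent to the square
  \<open>(u - 1)\<^sup>2\<close> in characteristic \<open>3\<close>, and \<open>(u - 1) * (u + 1)\<close> to \<open>1\<close>.\<close>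

lemma odd_no_approx_quadratic:
  assumes deg: "degree P = 2" and three: "\<one>\<^bsub>K\<^esub> \<oplus>\<^bsub>K\<^esub> \<one>\<^bsub>K\<^esub> \<oplus>\<^bsub>K\<^esub> \<one>\<^bsub>K\<^esub> = \<zero>\<^bsub>K\<^esub>"
    and PQ: "P [^]\<^bsub>K\<^esub> (p ^ e) = T [^]\<^bsub>K\<^esub> (p ^ e) \<otimes>\<^bsub>K\<^esub> T [^]\<^bsub>K\<^esub> (p ^ e) \<oplus>\<^bsub>K\<^esub> \<one>\<^bsub>K\<^esub>"
    and x: "x \<in> carrier K" "length x \<le> k + 1"
    and dvd: "(P [^]\<^bsub>K\<^esub> (p ^ e + 1)) divides\<^bsub>K\<^esub> (x \<otimes>\<^bsub>K\<^esub> x \<ominus>\<^bsub>K\<^esub> T [^]\<^bsub>K\<^esub> (2 * k + 1))"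
    and k: "k < 2 * p ^ e"
  shows False
proof -
  define Q where "Q = p ^ e"
  define m where "m = k + N"
  define M where "M = T [^]\<^bsub>K\<^esub> m"
  define S where "S = T [^]\<^bsub>K\<^esub> (2 * k + 1)"
  define U where "U = T [^]\<^bsub>K\<^esub> Q"
  define W where "W = U \<ominus>\<^bsub>K\<^esub> \<one>\<^bsub>K\<^esub>"
  define G where "G = U \<otimes>\<^bsub>K\<^esub> U \<oplus>\<^bsub>K\<^esub> \<one>\<^bsub>K\<^esub>"
  have cl: "W \<in> carrier K" "M \<in> carrier K" "S \<in> carrier K" "U \<in> carrier K" "G \<in> carrier K"
    by (simp_all add: W_def M_def S_def U_def G_def)
  have WW: "W \<otimes>\<^bsub>K\<^esub> W = G \<oplus>\<^bsub>K\<^esub> U" and WU: "W \<otimes>\<^bsub>K\<^esub> (U \<oplus>\<^bsub>K\<^esub> \<one>\<^bsub>K\<^esub>) = G \<oplus>\<^bsub>K\<^esub> \<one>\<^bsub>K\<^esub>"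
    unfolding W_def G_def by (rule K.char3_pred_square[OF three cl(4)], rule K.char3_pred_succ[OF three cl(4)])
  have QN: "Q + 1 = 2 * N" using N by (simp add: Q_def)
  have PQ': "P [^]\<^bsub>K\<^esub> Q = G" using PQ by (simp add: Q_def U_def G_def)
  have Pc: "P [^]\<^bsub>K\<^esub> Q \<in> carrier K" by simp
  have sz: "Q * degree P = 2 * Q" by (simp only: deg mult.commute[of Q])
  have mult: "(P [^]\<^bsub>K\<^esub> Q) divides\<^bsub>K\<^esub> (y \<otimes>\<^bsub>K\<^esub> (P [^]\<^bsub>K\<^esub> Q))" if y: "y \<in> carrier K" for y
    by (rule K.divides_prod_l[OF Pc Pc y K.divides_refl[OF Pc]])
  have "m + m = 2 * k + 1 + Q" using QN by (simp add: m_def)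
  then have MM: "M \<otimes>\<^bsub>K\<^esub> M = S \<otimes>\<^bsub>K\<^esub> U" by (simp only: M_def S_def U_def K.nat_pow_mult[OF T_closed])
  have "(P [^]\<^bsub>K\<^esub> Q) divides\<^bsub>K\<^esub> (P [^]\<^bsub>K\<^esub> (Q + 1))" by (rule K.divides_pow_mono) simp_all
  then have d1: "(P [^]\<^bsub>K\<^esub> Q) divides\<^bsub>K\<^esub> (x \<otimes>\<^bsub>K\<^esub> x \<ominus>\<^bsub>K\<^esub> S)"
    using dvd unfolding Q_def[symmetric] S_def[symmetric] by (rule K.divides_trans[OF _ _ Pc])
  have "(P [^]\<^bsub>K\<^esub> Q) divides\<^bsub>K\<^esub> (W \<otimes>\<^bsub>K\<^esub> W \<otimes>\<^bsub>K\<^esub> (x \<otimes>\<^bsub>K\<^esub> x \<ominus>\<^bsub>K\<^esub> S) \<oplus>\<^bsub>K\<^esub> S \<otimes>\<^bsub>K\<^esub> (P [^]\<^bsub>K\<^esub> Q))"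
    by (rule K.divides_add[OF K.divides_prod_l[OF Pc _ _ d1] mult Pc]) (use cl x in simp_all)
  moreover have "(x \<otimes>\<^bsub>K\<^esub> W) \<otimes>\<^bsub>K\<^esub> (x \<otimes>\<^bsub>K\<^esub> W) = (W \<otimes>\<^bsub>K\<^esub> W) \<otimes>\<^bsub>K\<^esub> (x \<otimes>\<^bsub>K\<^esub> x)"
    using cl x(1) by (simp only: K.m_ac K.m_closed)
  moreover have "(G \<oplus>\<^bsub>K\<^esub> U) \<otimes>\<^bsub>K\<^esub> (x \<otimes>\<^bsub>K\<^esub> x) \<ominus>\<^bsub>K\<^esub> S \<otimes>\<^bsub>K\<^esub> U
      = (G \<oplus>\<^bsub>K\<^esub> U) \<otimes>\<^bsub>K\<^esub> (x \<otimes>\<^bsub>K\<^esub> x \<ominus>\<^bsub>K\<^esub> S) \<oplus>\<^bsub>K\<^esub> S \<otimes>\<^bsub>K\<^esub> G"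
    using cl x(1) by algebra
  ultimately have "(P [^]\<^bsub>K\<^esub> Q) divides\<^bsub>K\<^esub> ((x \<otimes>\<^bsub>K\<^esub> W) \<otimes>\<^bsub>K\<^esub> (x \<otimes>\<^bsub>K\<^esub> W) \<ominus>\<^bsub>K\<^esub> M \<otimes>\<^bsub>K\<^esub> M)"
    unfolding MM by (simp only: WW PQ')
  from square_congruence_root[OF x(1) cl(1,2) _ this]
  obtain y where y: "y \<in> carrier K" "y \<otimes>\<^bsub>K\<^esub> y = x \<otimes>\<^bsub>K\<^esub> x" "length y = length x"
    "(P [^]\<^bsub>K\<^esub> Q) divides\<^bsub>K\<^esub> (y \<otimes>\<^bsub>K\<^esub> W \<ominus>\<^bsub>K\<^esub> M)"
    using P_not_dvd_T_pow[of m] unfolding M_def by blast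
  have ly: "length y \<le> k + 1" "length y \<le> 2 * Q" using y(3) x(2) k by (simp_all add: Q_def)
  \<comment> \<open>Multiplication by \<open>u + 1\<close>, the inverse of \<open>u - 1\<close>
    modulo \<open>P ^ Q\<close>, solves the congruence for \<open>y\<close>.\<close>
  have "(P [^]\<^bsub>K\<^esub> Q) divides\<^bsub>K\<^esub> ((y \<otimes>\<^bsub>K\<^esub> W \<ominus>\<^bsub>K\<^esub> M) \<otimes>\<^bsub>K\<^esub> (U \<oplus>\<^bsub>K\<^esub> \<one>\<^bsub>K\<^esub>) \<ominus>\<^bsub>K\<^esub> y \<otimes>\<^bsub>K\<^esub> (P [^]\<^bsub>K\<^esub> Q))"
    by (rule K.divides_minus[OF K.divides_prod_r[OF y(4) Pc] mult[OF y(1)] Pc]) (use cl in simp)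
  moreover have "(y \<otimes>\<^bsub>K\<^esub> W \<ominus>\<^bsub>K\<^esub> M) \<otimes>\<^bsub>K\<^esub> (U \<oplus>\<^bsub>K\<^esub> \<one>\<^bsub>K\<^esub>)
      = y \<otimes>\<^bsub>K\<^esub> (W \<otimes>\<^bsub>K\<^esub> (U \<oplus>\<^bsub>K\<^esub> \<one>\<^bsub>K\<^esub>)) \<ominus>\<^bsub>K\<^esub> M \<otimes>\<^bsub>K\<^esub> (U \<oplus>\<^bsub>K\<^esub> \<one>\<^bsub>K\<^esub>)"
    using cl y(1) by algebra
  moreover have "y \<otimes>\<^bsub>K\<^esub> (G \<oplus>\<^bsub>K\<^esub> \<one>\<^bsub>K\<^esub>) \<ominus>\<^bsub>K\<^esub> M \<otimes>\<^bsub>K\<^esub> (U \<oplus>\<^bsub>K\<^esub> \<one>\<^bsub>K\<^esub>) \<ominus>\<^bsub>K\<^esub> y \<otimes>\<^bsub>K\<^esub> G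
      = y \<ominus>\<^bsub>K\<^esub> M \<otimes>\<^bsub>K\<^esub> (U \<oplus>\<^bsub>K\<^esub> \<one>\<^bsub>K\<^esub>)"
    using cl y(1) by algebra
  ultimately have d2: "(P [^]\<^bsub>K\<^esub> Q) divides\<^bsub>K\<^esub> (y \<ominus>\<^bsub>K\<^esub> M \<otimes>\<^bsub>K\<^esub> (U \<oplus>\<^bsub>K\<^esub> \<one>\<^bsub>K\<^esub>))" by (simp only: WU PQ')
  consider "m < Q" | "Q \<le> m" "m < 2 * Q" | "2 * Q \<le> m" by linarith
  then show False
  proof cases
    case 1
    \<comment> \<open>The product has degree \<open>m + Q < 2 Q\<close>, so it is already reduced
      and equals \<open>y\<close>, against the degree bound \<open>k\<close>.\<close>
    have "M \<otimes>\<^bsub>K\<^esub> (U \<oplus>\<^bsub>K\<^esub> \<one>\<^bsub>K\<^esub>) = T [^]\<^bsub>K\<^esub> (m + Q) \<oplus>\<^bsub>K\<^esub> M"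
      using cl by (simp add: K.r_distr M_def U_def K.nat_pow_mult)
    also have "length \<dots> = m + Q + 1"
      by (subst length_add_eq) (use 1 in \<open>simp_all add: M_def\<close>)
    finally have len: "length (M \<otimes>\<^bsub>K\<^esub> (U \<oplus>\<^bsub>K\<^esub> \<one>\<^bsub>K\<^esub>)) = m + Q + 1" .
    have "y = M \<otimes>\<^bsub>K\<^esub> (U \<oplus>\<^bsub>K\<^esub> \<one>\<^bsub>K\<^esub>)"
      by (rule eq_if_short[OF d2 y(1) _ ly(2)[folded sz], unfolded sz]) (use cl 1 in \<open>simp_all add: len\<close>)
    then show False using len ly(1) N_pos by (simp add: m_def)
  next
    case 2
    define r where "r = m - Q"
    define A where "A = T [^]\<^bsub>K\<^esub> r"
    have r: "m = r + Q" using 2 by (simp add: r_def)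
    have A: "A \<in> carrier K" by (simp add: A_def)
    have M: "M = A \<otimes>\<^bsub>K\<^esub> U" by (simp add: M_def A_def U_def r K.nat_pow_mult)
    \<comment> \<open>Here \<open>u (u + 1)\<close> reduces to \<open>u - 1\<close>, and
      \<open>t ^ r (u - 1)\<close> has degree \<open>m > k\<close>.\<close>
    have "(P [^]\<^bsub>K\<^esub> Q) divides\<^bsub>K\<^esub> (y \<ominus>\<^bsub>K\<^esub> M \<otimes>\<^bsub>K\<^esub> (U \<oplus>\<^bsub>K\<^esub> \<one>\<^bsub>K\<^esub>) \<oplus>\<^bsub>K\<^esub> A \<otimes>\<^bsub>K\<^esub> (P [^]\<^bsub>K\<^esub> Q))"
      by (rule K.divides_add[OF d2 mult[OF A] Pc])
    moreover have "y \<ominus>\<^bsub>K\<^esub> A \<otimes>\<^bsub>K\<^esub> U \<otimes>\<^bsub>K\<^esub> (U \<oplus>\<^bsub>K\<^esub> \<one>\<^bsub>K\<^esub>) \<oplus>\<^bsub>K\<^esub> A \<otimes>\<^bsub>K\<^esub> (U \<otimes>\<^bsub>K\<^esub> U \<oplus>\<^bsub>K\<^esub> \<one>\<^bsub>K\<^esub>)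
        = y \<ominus>\<^bsub>K\<^esub> (A \<otimes>\<^bsub>K\<^esub> U \<ominus>\<^bsub>K\<^esub> A)"
      using cl y(1) A by algebra simp
    ultimately have d3: "(P [^]\<^bsub>K\<^esub> Q) divides\<^bsub>K\<^esub> (y \<ominus>\<^bsub>K\<^esub> (M \<ominus>\<^bsub>K\<^esub> A))" unfolding M PQ' G_def by (simp only:)
    have Q0: "Q > 0" using QN N_pos by linarith
    have len: "length (M \<ominus>\<^bsub>K\<^esub> A) = m + 1"
      by (subst length_minus_eq) (use cl A r Q0 in \<open>simp_all add: M_def A_def\<close>)
    have "y = M \<ominus>\<^bsub>K\<^esub> A"
      by (rule eq_if_short[OF d3 y(1) _ ly(2)[folded sz], unfolded sz]) (use cl A 2 in \<open>simp_all add: len\<close>)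
    then show False using len ly(1) N_pos by (simp add: m_def)
  next
    case 3
    define r where "r = m - 2 * Q"
    define A where "A = T [^]\<^bsub>K\<^esub> r"
    have r: "m = r + Q + Q" using 3 by (simp add: r_def)
    have rQ: "r < Q" using k QN r N_pos by (simp add: m_def Q_def)
    have A: "A \<in> carrier K" by (simp add: A_def)
    have M: "M = A \<otimes>\<^bsub>K\<^esub> U \<otimes>\<^bsub>K\<^esub> U" by (simp only: M_def A_def U_def r K.nat_pow_mult[OF T_closed])
    have "2 * k + 1 = r + r + Q + Q + Q" using QN r by (simp add: m_def)
    then have S: "S = A \<otimes>\<^bsub>K\<^esub> A \<otimes>\<^bsub>K\<^esub> U \<otimes>\<^bsub>K\<^esub> U \<otimes>\<^bsub>K\<^esub> U" by (simp only: S_def A_def U_def K.nat_pow_mult[OF T_closed])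
    define B where "B = \<ominus>\<^bsub>K\<^esub> (A \<otimes>\<^bsub>K\<^esub> U \<oplus>\<^bsub>K\<^esub> A)"
    have AU: "A \<otimes>\<^bsub>K\<^esub> U \<oplus>\<^bsub>K\<^esub> A \<in> carrier K" using A cl by simp
    \<comment> \<open>Here \<open>u ^ 2 (u + 1)\<close> reduces to \<open>-(u + 1)\<close>. The root
      \<open>-t ^ r (u + 1)\<close> has degree below \<open>2 Q\<close> and can satisfy the degree
      bound, so the additional factor \<open>P\<close> has to decide.\<close>
    have "(P [^]\<^bsub>K\<^esub> Q) divides\<^bsub>K\<^esub> (y \<ominus>\<^bsub>K\<^esub> M \<otimes>\<^bsub>K\<^esub> (U \<oplus>\<^bsub>K\<^esub> \<one>\<^bsub>K\<^esub>) \<oplus>\<^bsub>K\<^esub> (A \<otimes>\<^bsub>K\<^esub> U \<oplus>\<^bsub>K\<^esub> A) \<otimes>\<^bsub>K\<^esub> (P [^]\<^bsub>K\<^esub> Q))"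
      by (rule K.divides_add[OF d2 mult[OF AU] Pc])
    moreover have "y \<ominus>\<^bsub>K\<^esub> A \<otimes>\<^bsub>K\<^esub> U \<otimes>\<^bsub>K\<^esub> U \<otimes>\<^bsub>K\<^esub> (U \<oplus>\<^bsub>K\<^esub> \<one>\<^bsub>K\<^esub>) \<oplus>\<^bsub>K\<^esub> (A \<otimes>\<^bsub>K\<^esub> U \<oplus>\<^bsub>K\<^esub> A) \<otimes>\<^bsub>K\<^esub> (U \<otimes>\<^bsub>K\<^esub> U \<oplus>\<^bsub>K\<^esub> \<one>\<^bsub>K\<^esub>)
        = y \<ominus>\<^bsub>K\<^esub> B"
      unfolding B_def using cl y(1) A by algebra simp
    ultimately have d3: "(P [^]\<^bsub>K\<^esub> Q) divides\<^bsub>K\<^esub> (y \<ominus>\<^bsub>K\<^esub> B)" unfolding M PQ' G_def by (simp only:)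
    have "A \<otimes>\<^bsub>K\<^esub> U = T [^]\<^bsub>K\<^esub> (r + Q)" by (simp add: A_def U_def K.nat_pow_mult)
    then have "length (A \<otimes>\<^bsub>K\<^esub> U \<oplus>\<^bsub>K\<^esub> A) \<le> r + Q + 1"
      by (intro length_add_le) (simp_all add: A_def)
    then have "length B \<le> 2 * Q" unfolding B_def length_uminus[OF AU] using rQ by simp
    then have "y = B" by (intro eq_if_short[OF d3 y(1) _ ly(2)[folded sz], unfolded sz]) (use AU in \<open>simp_all add: B_def\<close>)
    then have xB: "x \<otimes>\<^bsub>K\<^esub> x = B \<otimes>\<^bsub>K\<^esub> B" using y(2) by simp
    have "B \<otimes>\<^bsub>K\<^esub> B = A \<otimes>\<^bsub>K\<^esub> A \<otimes>\<^bsub>K\<^esub> ((U \<oplus>\<^bsub>K\<^esub> \<one>\<^bsub>K\<^esub>) \<otimes>\<^bsub>K\<^esub> (U \<oplus>\<^bsub>K\<^esub> \<one>\<^bsub>K\<^esub>))"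
      unfolding B_def using cl A by (algebra; simp)
    also have "(U \<oplus>\<^bsub>K\<^esub> \<one>\<^bsub>K\<^esub>) \<otimes>\<^bsub>K\<^esub> (U \<oplus>\<^bsub>K\<^esub> \<one>\<^bsub>K\<^esub>) = G \<ominus>\<^bsub>K\<^esub> U"
      unfolding G_def by (rule K.char3_succ_square[OF three cl(4)])
    finally have BB: "B \<otimes>\<^bsub>K\<^esub> B = A \<otimes>\<^bsub>K\<^esub> A \<otimes>\<^bsub>K\<^esub> (G \<ominus>\<^bsub>K\<^esub> U)" .
    have S': "S = A \<otimes>\<^bsub>K\<^esub> A \<otimes>\<^bsub>K\<^esub> ((G \<ominus>\<^bsub>K\<^esub> \<one>\<^bsub>K\<^esub>) \<otimes>\<^bsub>K\<^esub> U)"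
      unfolding S G_def using cl A by (algebra; simp)
    \<comment> \<open>In characteristic 3,
      \<open>(u + 1) ^ 2 - u ^ 3 = (u ^ 2 + 1) (1 - u)\<close>.\<close>
    have "x \<otimes>\<^bsub>K\<^esub> x \<ominus>\<^bsub>K\<^esub> S = G \<otimes>\<^bsub>K\<^esub> (A \<otimes>\<^bsub>K\<^esub> A \<otimes>\<^bsub>K\<^esub> (\<one>\<^bsub>K\<^esub> \<ominus>\<^bsub>K\<^esub> U))"
      unfolding xB BB S' using cl A by (algebra; simp)
    then have "(P [^]\<^bsub>K\<^esub> (Q + 1)) divides\<^bsub>K\<^esub> (P [^]\<^bsub>K\<^esub> Q \<otimes>\<^bsub>K\<^esub> (A \<otimes>\<^bsub>K\<^esub> A \<otimes>\<^bsub>K\<^esub> (\<one>\<^bsub>K\<^esub> \<ominus>\<^bsub>K\<^esub> U)))"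
      using dvd unfolding PQ' Q_def[symmetric] S_def[symmetric] by (simp only:)
    then have d4: "P divides\<^bsub>K\<^esub> (A \<otimes>\<^bsub>K\<^esub> A \<otimes>\<^bsub>K\<^esub> (\<one>\<^bsub>K\<^esub> \<ominus>\<^bsub>K\<^esub> U))" by (rule pow_Suc_divides_cancel) (use A cl in simp)
    have AA: "A \<otimes>\<^bsub>K\<^esub> A = T [^]\<^bsub>K\<^esub> (r + r)" by (simp add: A_def K.nat_pow_mult)
    have c': "\<one>\<^bsub>K\<^esub> \<ominus>\<^bsub>K\<^esub> T = \<ominus>\<^bsub>K\<^esub> c" by (simp add: c_def K.minus_eq K.minus_add K.a_comm)
    \<comment> \<open>Frobenius turns \<open>1 - u\<close> into \<open>(1 - t) ^ Q\<close>, which is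
      prime to \<open>P\<close>.\<close>
    have "(\<one>\<^bsub>K\<^esub> \<ominus>\<^bsub>K\<^esub> T) [^]\<^bsub>K\<^esub> (p ^ e) = \<one>\<^bsub>K\<^esub> \<ominus>\<^bsub>K\<^esub> U"
      using K.frobenius_minus[OF p_prime add_pow_K[OF char_p] K.one_closed T_closed, of e] by (simp add: U_def Q_def)
    moreover have "\<not> P divides\<^bsub>K\<^esub> (\<ominus>\<^bsub>K\<^esub> c)"
      using K.divides_uminus[of P "\<ominus>\<^bsub>K\<^esub> c", OF _ P_closed] not_dvd_c unfolding K.minus_minus[OF c_closed] by blast
    then have "\<not> P divides\<^bsub>K\<^esub> ((\<ominus>\<^bsub>K\<^esub> c) [^]\<^bsub>K\<^esub> (p ^ e))" by (intro P_not_dvd_pow) simp_all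
    ultimately have "\<not> P divides\<^bsub>K\<^esub> (\<one>\<^bsub>K\<^esub> \<ominus>\<^bsub>K\<^esub> U)" unfolding c' by (simp only: simp_thms)
    moreover have "\<not> P divides\<^bsub>K\<^esub> (A \<otimes>\<^bsub>K\<^esub> A)" unfolding AA by (rule P_not_dvd_T_pow)
    ultimately show False using P_prime[OF _ _ d4] K.m_closed[OF A A] K.minus_closed[OF K.one_closed cl(4)] by blast
  qed
qed

section \<open>From degrees to the diameter bound\<close>

text \<open>For \<open>d\<close> the degree of \<open>g\<close>, the vertex count is at most
  \<open>2 q ^ (3 d) \<le> q ^ (3 d + 1)\<close>, and
  \<open>4 / 3 * (3 d + 1) = 4 d + 4 / 3\<close>. Together with the 8 of the hypothesis the loss is
  below 10.\<close>

lemma diam_bound: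
  assumes "enat (4 * (N * degree P) - 8) \<le> graph_diam \<Gamma>"
  shows "ereal (4 / 3 * log (real (card (carrier F))) (real (card (fst \<Gamma>))) - 10) \<le> ereal_of_enat (graph_diam \<Gamma>)"
proof -
  let ?q = "real (card (carrier F))" and ?d = "N * degree P"
  have q: "?q \<ge> 3" using card_mod by (cases "card (carrier F) < 3") (auto simp: numeral_3_eq_3 less_Suc_eq)
  have pos: "card (fst \<Gamma>) > 0" using card_graph_vertices(1,2) by (simp add: card_gt_0_iff)
  have "real (card (fst \<Gamma>)) \<le> real (2 * card (carrier F) ^ (3 * ?d))"
    using card_graph_vertices(3) by (rule of_nat_mono)
  also have "\<dots> = 2 * ?q ^ (3 * ?d)" by simp
  also have "\<dots> \<le> ?q ^ (3 * ?d + 1)" using q by simp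
  finally have "log ?q (card (fst \<Gamma>)) \<le> log ?q (?q ^ (3 * ?d + 1))"
    using q pos by (subst log_le_cancel_iff) auto
  also have "\<dots> = real (3 * ?d + 1)" using q by (subst log_nat_power) auto
  finally have "4 / 3 * log ?q (card (fst \<Gamma>)) - 10 \<le> 4 * real ?d - 8" by (simp del: One_nat_def)
  \<comment> \<open>An inequality, because subtraction on the right is truncated when
    \<open>d\<close> is small.\<close>
  also have "\<dots> \<le> real (4 * ?d - 8)" by linarith
  finally have "4 / 3 * log ?q (card (fst \<Gamma>)) - 10 \<le> real (4 * ?d - 8)" .
  then have "ereal (4 / 3 * log ?q (card (fst \<Gamma>)) - 10) \<le> ereal_of_enat (enat (4 * ?d - 8))" by simp
  also have "\<dots> \<le> ereal_of_enat (graph_diam \<Gamma>)" using assms by (simp only: ereal_of_enat_le_iff)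
  finally show ?thesis .
qed

text \<open>In terms of \<open>Q = p ^ e\<close>, \<open>4 * (N * degree P)\<close> is
  \<open>2 (Q + 1) * degree P\<close>. For the degrees 1 and 2 used later, subtracting 8 leaves
  \<open>k < Q * degree P\<close>, as needed when the odd case works modulo \<open>P ^ Q\<close>.
  The even case works modulo the full \<open>P ^ (Q + 1)\<close>.\<close>

lemma diam_ge_if_odd_no_approx:
  assumes odd: "\<And>k x. 2 * k + 1 < 4 * (N * degree P) - 8 \<Longrightarrow> x \<in> carrier K \<Longrightarrow> length x \<le> k + 1 \<Longrightarrow>
      (P [^]\<^bsub>K\<^esub> (p ^ e + 1)) divides\<^bsub>K\<^esub> (x \<otimes>\<^bsub>K\<^esub> x \<ominus>\<^bsub>K\<^esub> T [^]\<^bsub>K\<^esub> (2 * k + 1)) \<Longrightarrow> False"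
  shows "enat (4 * (N * degree P) - 8) \<le> graph_diam \<Gamma>"
proof (rule graph_diam_ge_if_no_approx)
  fix h x
  assume h: "h < 4 * (N * degree P) - 8" and x: "x \<in> carrier K" "length x \<le> h div 2 + 1" "c divides\<^bsub>K\<^esub> x"
    and dvd: "(P [^]\<^bsub>K\<^esub> (p ^ e + 1)) divides\<^bsub>K\<^esub> (x \<otimes>\<^bsub>K\<^esub> x \<ominus>\<^bsub>K\<^esub> T [^]\<^bsub>K\<^esub> h)"
  show False
  proof (cases "even h")
    case True
    then obtain k where k: "h = 2 * k" by (elim evenE)
    have "k + 1 \<le> (p ^ e + 1) * degree P" using h unfolding k N by simp
    moreover have "length x \<le> k + 1" using x(2) unfolding k by simp
    ultimately show False using even_no_approx[OF x(1) _ x(3) dvd[unfolded k]] by blast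
  next
    case False
    then obtain k where "h = 2 * k + 1" by (elim oddE)
    then show False using odd[of k x] h x dvd by simp
  qed
qed

end

section \<open>The moduli\<close>

context finite_field_3_mod_4
begin

text \<open>Links the ring expression to the literal list \<open>[\<one>, \<ominus> a]\<close>, the
  form in which roots correspond to divisors.\<close>

lemma monic_linear: "a \<in> carrier F \<Longrightarrow> T \<ominus>\<^bsub>K\<^esub> pconst F a = [\<one>, \<ominus> a]"
proof -
  assume a: "a \<in> carrier F"
  have "\<ominus>\<^bsub>K\<^esub> pconst F a = map (\<lambda>x. \<ominus> x) (pconst F a)"
    by (rule univ_poly_a_inv_def'[OF carrier_is_subring pconst_closed[OF a]])
  then show ?thesis using a
    by (cases "a = \<zero>") (simp_all add: K.minus_eq univ_poly_add var_def pconst_def poly_of_const_def)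
qed

lemma linear_divides_iff:
  assumes a: "a \<in> carrier F" and f: "f \<in> carrier K"
  shows "(T \<ominus>\<^bsub>K\<^esub> pconst F a) divides\<^bsub>K\<^esub> f \<longleftrightarrow> eval f a = \<zero>"
proof
  assume "(T \<ominus>\<^bsub>K\<^esub> pconst F a) divides\<^bsub>K\<^esub> f"
  then have "[\<one>, \<ominus> a] pdivides f" unfolding pdivides_def monic_linear[OF a] .
  then show "eval f a = \<zero>" using pdivides_imp_is_root[OF _ a, of f] by (cases "f = []") (auto simp: is_root_def)
next
  assume 0: "eval f a = \<zero>"
  show "(T \<ominus>\<^bsub>K\<^esub> pconst F a) divides\<^bsub>K\<^esub> f"
  proof (cases "f = []")
    case True
    then show ?thesis using K.divides_zero[of "T \<ominus>\<^bsub>K\<^esub> pconst F a"] a by (simp add: K_zero)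
  next
    case False
    then have "is_root f a" using 0 a by (simp add: is_root_def)
    then show ?thesis using is_root_imp_pdivides[OF f] unfolding pdivides_def monic_linear[OF a] by blast
  qed
qed

lemma eval_T: "a \<in> carrier F \<Longrightarrow> eval T a = a"
  by (rule eval_var)

lemma eval_c: "a \<in> carrier F \<Longrightarrow> eval c a = a \<ominus> \<one>"
proof -
  assume a: "a \<in> carrier F"
  interpret v: ring_hom_cring K F "\<lambda>p. eval p a" by (rule eval_hom[OF a])
  show ?thesis using a by (simp add: c_def K.minus_eq eval_T minus_eq)
qed

lemma eval_pconst: "a \<in> carrier F \<Longrightarrow> b \<in> carrier F \<Longrightarrow> eval (pconst F b) a = b"
  by (cases "b = \<zero>") (simp_all add: pconst_def poly_of_const_def)

lemma two_nonzero: "\<one> \<oplus> \<one> \<noteq> \<zero>"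
  by (rule odd_card_two_nonzero[OF fin]) (use card_mod in presburger)

text \<open>Divisibility by \<open>t - a\<close> is vanishing at \<open>a\<close>:
  \<open>a \<noteq> \<zero>\<close> and \<open>a \<noteq> \<one>\<close> give coprimality to
  \<open>t (t - 1)\<close>, and a splitting is a representation of the constant \<open>a - 1\<close>
  as a sum of two squares in \<open>F\<close>.\<close>

lemma linear_modulus:
  assumes a: "a \<in> carrier F" "a \<noteq> \<zero>" "a \<noteq> \<one>"
    and p: "Factorial_Ring.prime (p::nat)" "add_pow F p \<one> = \<zero>" and N: "p ^ e + 1 = 2 * N"
  shows "prime_power_modulus F (T \<ominus>\<^bsub>K\<^esub> pconst F a) p e N"
proof -
  let ?P = "T \<ominus>\<^bsub>K\<^esub> pconst F a"
  have P: "?P \<in> carrier K" using a by simp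
  have irr: "pirreducible (carrier F) ?P"
    by (rule degree_one_imp_pirreducible[OF carrier_is_subfield P]) (simp add: monic_linear[OF a(1)])
  have nT: "\<not> ?P divides\<^bsub>K\<^esub> T" using linear_divides_iff[OF a(1) T_closed] a eval_T by simp
  have nc: "\<not> ?P divides\<^bsub>K\<^esub> c" using linear_divides_iff[OF a(1) c_closed] a eval_c by simp
  obtain x y where xy: "x \<in> carrier F" "y \<in> carrier F" "x \<otimes> x \<oplus> y \<otimes> y = a \<ominus> \<one>"
    using sum_two_squares[OF fin, of "a \<ominus> \<one>"] card_mod a(1) by (metis minus_closed one_closed odd_numeral even_mod_4_div_2 dvd_mod_iff even_numeral num.distinct mod_mod_trivial)
  interpret v: ring_hom_cring K F "\<lambda>p. eval p a" by (rule eval_hom[OF a(1)])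
  have "eval (pconst F x \<otimes>\<^bsub>K\<^esub> pconst F x \<oplus>\<^bsub>K\<^esub> pconst F y \<otimes>\<^bsub>K\<^esub> pconst F y \<ominus>\<^bsub>K\<^esub> c) a = \<zero>"
    using xy a by (simp add: K.minus_eq eval_pconst eval_c r_neg)
  then have sp: "?P divides\<^bsub>K\<^esub> (pconst F x \<otimes>\<^bsub>K\<^esub> pconst F x \<oplus>\<^bsub>K\<^esub> pconst F y \<otimes>\<^bsub>K\<^esub> pconst F y \<ominus>\<^bsub>K\<^esub> c)"
    using xy linear_divides_iff[OF a(1)] by simp
  show ?thesis
    by (intro prime_power_modulus.intro prime_power_modulus_axioms.intro finite_field_3_mod_4_axioms P irr p N nT nc
        bexI[of _ "pconst F x"] bexI[of _ "pconst F y"] sp pconst_closed xy(1,2))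
qed

lemma minus_one_ne: "\<ominus> \<one> \<noteq> \<zero>" "\<ominus> \<one> \<noteq> \<one>"
  using minus_one_not_square[OF fin card_mod, of \<zero>] minus_one_not_square[OF fin card_mod, of \<one>] by auto

lemma bipartite_instance:
  assumes p: "Factorial_Ring.prime (p::nat)" "add_pow F p \<one> = \<zero>" and N: "p ^ e + 1 = 2 * N"
    and P: "P = T \<ominus>\<^bsub>K\<^esub> pconst F (\<ominus> \<one>)"
  defines "g \<equiv> P [^]\<^bsub>K\<^esub> N"
  shows "morgenstern_modulus F g \<and> bipartite (morgenstern_graph F (\<ominus> \<one>) g) \<and>
    ereal (4 / 3 * log (real (card (carrier F))) (real (card (fst (morgenstern_graph F (\<ominus> \<one>) g)))) - 10)
      \<le> ereal_of_enat (graph_diam (morgenstern_graph F (\<ominus> \<one>) g))"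
proof -
  have a: "\<ominus> \<one> \<in> carrier F" by simp
  interpret M: prime_power_modulus F P p e N
    unfolding P by (rule linear_modulus[OF a minus_one_ne p N])
  interpret v: ring_hom_cring K F "\<lambda>p. eval p (\<ominus> \<one>)" by (rule eval_hom[OF a])
  \<comment> \<open>At \<open>t = -1\<close> every odd power of \<open>t\<close> takes the
    non-square value -1. The case \<open>k = 0\<close> gives bipartiteness, the other cases exclude
    the approximations for odd \<open>h\<close>.\<close>
  have nsq: "\<not> P divides\<^bsub>K\<^esub> (y \<otimes>\<^bsub>K\<^esub> y \<ominus>\<^bsub>K\<^esub> T [^]\<^bsub>K\<^esub> (2 * k + 1 :: nat))" if y: "y \<in> carrier K" for y k
  proof
    assume "P divides\<^bsub>K\<^esub> (y \<otimes>\<^bsub>K\<^esub> y \<ominus>\<^bsub>K\<^esub> T [^]\<^bsub>K\<^esub> (2 * k + 1))"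
    then have "eval (y \<otimes>\<^bsub>K\<^esub> y \<ominus>\<^bsub>K\<^esub> T [^]\<^bsub>K\<^esub> (2 * k + 1)) (\<ominus> \<one>) = \<zero>"
      using linear_divides_iff[OF a] y unfolding P by simp
    moreover have "eval (T [^]\<^bsub>K\<^esub> (2 * k + 1)) (\<ominus> \<one>) = \<ominus> \<one>"
      by (induction k) (simp_all add: eval_T l_minus r_minus)
    moreover have ey: "eval y (\<ominus> \<one>) \<in> carrier F" using y by simp
    ultimately have "eval y (\<ominus> \<one>) \<otimes> eval y (\<ominus> \<one>) \<oplus> \<one> = \<zero>" using y by (simp add: K.minus_eq)
    then have "eval y (\<ominus> \<one>) \<otimes> eval y (\<ominus> \<one>) = \<ominus> \<one>" using ey minus_equality[of "eval y (\<ominus> \<one>) \<otimes> eval y (\<ominus> \<one>)" \<one>] by simp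
    then show False using minus_one_not_square[OF fin card_mod ey] by simp
  qed
  have "bipartite (morgenstern_graph F (\<ominus> \<one>) g)"
    unfolding g_def by (rule M.bipartite_graph) (use nsq[of _ 0] in simp)
  moreover have "enat (4 * (N * degree P) - 8) \<le> graph_diam (morgenstern_graph F (\<ominus> \<one>) g)"
    unfolding g_def
  proof (rule M.diam_ge_if_odd_no_approx)
    fix k :: nat and x assume x: "x \<in> carrier K"
      and dvd: "(P [^]\<^bsub>K\<^esub> (p ^ e + 1)) divides\<^bsub>K\<^esub> (x \<otimes>\<^bsub>K\<^esub> x \<ominus>\<^bsub>K\<^esub> T [^]\<^bsub>K\<^esub> (2 * k + 1))"
    have "P divides\<^bsub>K\<^esub> (P [^]\<^bsub>K\<^esub> (p ^ e + 1))"
      using K.divides_pow_mono[OF M.P_closed, of 1 "p ^ e + 1"] unfolding K.nat_pow_eone[OF M.P_closed] by simp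
    from K.divides_trans[OF this dvd M.P_closed] show False using nsq[OF x] by blast
  qed
  ultimately show ?thesis using M.diam_bound M.morgenstern_modulus_g unfolding g_def by blast
qed

lemma not_bipartite_instance_linear:
  assumes p: "Factorial_Ring.prime (p::nat)" "add_pow F p \<one> = \<zero>" "odd p" and N: "p ^ e + 1 = 2 * N"
    and three: "\<one> \<oplus> \<one> \<oplus> \<one> \<noteq> \<zero>"
    and P: "P = T \<ominus>\<^bsub>K\<^esub> pconst F ((\<one> \<oplus> \<one>) \<otimes> (\<one> \<oplus> \<one>))"
  defines "g \<equiv> P [^]\<^bsub>K\<^esub> N"
  shows "morgenstern_modulus F g \<and> \<not> bipartite (morgenstern_graph F (\<ominus> \<one>) g) \<and>
    ereal (4 / 3 * log (real (card (carrier F))) (real (card (fst (morgenstern_graph F (\<ominus> \<one>) g)))) - 10)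
      \<le> ereal_of_enat (graph_diam (morgenstern_graph F (\<ominus> \<one>) g))"
proof -
  let ?a = "(\<one> \<oplus> \<one>) \<otimes> (\<one> \<oplus> \<one>)"
  have a: "?a \<in> carrier F" "?a \<noteq> \<zero>" using two_nonzero by (simp_all add: integral_iff)
  \<comment> \<open>The difference is 3, so characteristic 3 is exactly where \<open>t - 4\<close>
    coincides with \<open>t - 1\<close>.\<close>
  have "?a \<ominus> \<one> = \<one> \<oplus> \<one> \<oplus> \<one>" by algebra
  then have a1: "?a \<noteq> \<one>" using three a(1) by (metis one_closed r_right_minus_eq)
  interpret M: prime_power_modulus F P p e N
    unfolding P by (rule linear_modulus[OF a a1 p(1,2) N])
  interpret h: ring_hom_ring F K "pconst F" by (rule pconst_hom)
  have P': "P = T \<ominus>\<^bsub>K\<^esub> M.two \<otimes>\<^bsub>K\<^esub> M.two" unfolding P by simp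
  \<comment> \<open>Since \<open>(1 + 1) ^ Q = 1 + 1\<close>, the constant term 4 survives the
    Frobenius power of \<open>t - 4\<close>.\<close>
  have frob: "M.two [^]\<^bsub>K\<^esub> (p ^ e) = M.two"
    using K.frobenius_add[OF p(1) add_pow_K[OF p(2)] K.one_closed K.one_closed, of e] by simp
  have PQ: "P [^]\<^bsub>K\<^esub> (p ^ e) = T [^]\<^bsub>K\<^esub> (p ^ e) \<ominus>\<^bsub>K\<^esub> M.two \<otimes>\<^bsub>K\<^esub> M.two"
    unfolding P' by (subst K.frobenius_minus[OF p(1) add_pow_K[OF p(2)]]) (simp_all add: K.nat_pow_distrib frob)
  have deg: "degree P = 1" unfolding P monic_linear[OF a(1)] by simp
  have "\<not> bipartite (morgenstern_graph F (\<ominus> \<one>) g)"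
    unfolding g_def
  proof (rule M.not_bipartite_graph)
    have "snd ((\<one>\<^bsub>K\<^esub>, \<one>\<^bsub>K\<^esub>) [^]\<^bsub>quad_ring K (\<ominus>\<^bsub>K\<^esub> c)\<^esub> (3::nat)) = \<ominus>\<^bsub>K\<^esub> P"
      unfolding P' c_def by (rule K.quad_ring_cube[OF T_closed])
    then show "P divides\<^bsub>K\<^esub> snd ((\<one>\<^bsub>K\<^esub>, \<one>\<^bsub>K\<^esub>) [^]\<^bsub>quad_ring K (\<ominus>\<^bsub>K\<^esub> c)\<^esub> (3::nat))"
      using K.divides_uminus[OF K.divides_refl[OF M.P_closed] M.P_closed] by (simp only:)
  qed (use p in simp_all)
  moreover have "enat (4 * (N * degree P) - 8) \<le> graph_diam (morgenstern_graph F (\<ominus> \<one>) g)"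
    unfolding g_def
  proof (rule M.diam_ge_if_odd_no_approx)
    fix k :: nat and x assume k: "2 * k + 1 < 4 * (N * degree P) - 8" and x: "x \<in> carrier K" "length x \<le> k + 1"
      and dvd: "(P [^]\<^bsub>K\<^esub> (p ^ e + 1)) divides\<^bsub>K\<^esub> (x \<otimes>\<^bsub>K\<^esub> x \<ominus>\<^bsub>K\<^esub> T [^]\<^bsub>K\<^esub> (2 * k + 1))"
    have "k < p ^ e" using k N unfolding deg mult_1_right by linarith
    then show False by (rule M.odd_no_approx_linear[OF deg PQ x dvd])
  qed
  ultimately show ?thesis using M.diam_bound M.morgenstern_modulus_g unfolding g_def by blast
qed

text \<open>A quadratic polynomial without roots is irreducible, and a root of
  \<open>t ^ 2 + 1\<close> would be a square root of -1. Since \<open>t\<close> and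
  \<open>t - 1\<close> have smaller degree than \<open>P\<close>, they are prime to it.\<close>

lemma quadratic_modulus:
  assumes three: "\<one> \<oplus> \<one> \<oplus> \<one> = \<zero>"
    and p: "Factorial_Ring.prime (p::nat)" "add_pow F p \<one> = \<zero>" and N: "p ^ e + 1 = 2 * N"
    and P: "P = T \<otimes>\<^bsub>K\<^esub> T \<oplus>\<^bsub>K\<^esub> \<one>\<^bsub>K\<^esub>"
  shows "prime_power_modulus F P p e N" "length P = 3" "\<one>\<^bsub>K\<^esub> \<oplus>\<^bsub>K\<^esub> \<one>\<^bsub>K\<^esub> \<oplus>\<^bsub>K\<^esub> \<one>\<^bsub>K\<^esub> = \<zero>\<^bsub>K\<^esub>"
proof -
  interpret h: ring_hom_ring F K "pconst F" by (rule pconst_hom)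
  have "pconst F (\<one> \<oplus> \<one> \<oplus> \<one>) = \<zero>\<^bsub>K\<^esub>" unfolding three by simp
  then show threeK: "\<one>\<^bsub>K\<^esub> \<oplus>\<^bsub>K\<^esub> \<one>\<^bsub>K\<^esub> \<oplus>\<^bsub>K\<^esub> \<one>\<^bsub>K\<^esub> = \<zero>\<^bsub>K\<^esub>" by simp
  have Pc: "P \<in> carrier K" by (simp add: P)
  have TT: "T \<otimes>\<^bsub>K\<^esub> T = T [^]\<^bsub>K\<^esub> (2::nat)" by (simp add: numeral_2_eq_2)
  show len: "length P = 3" unfolding P TT
    by (subst length_add_eq[OF _ K.one_closed]) (simp_all add: univ_poly_one del: K.nat_pow_Suc)
  have P0: "P \<noteq> []" using len by auto
  have no_root: "eval P a \<noteq> \<zero>" if a: "a \<in> carrier F" for a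
  proof
    assume 0: "eval P a = \<zero>"
    interpret v: ring_hom_cring K F "\<lambda>p. eval p a" by (rule eval_hom[OF a])
    have "a \<otimes> a \<oplus> \<one> = \<zero>" using 0 a unfolding P by (simp add: eval_T)
    then have "a \<otimes> a = \<ominus> \<one>" using a minus_equality[of "a \<otimes> a" \<one>] by simp
    then show False using minus_one_not_square[OF fin card_mod a] by simp
  qed
  have linear_dvd: False if q: "q \<in> carrier K" "r \<in> carrier K" "P = q \<otimes>\<^bsub>K\<^esub> r" "degree q = 1" for q r
  proof -
    let ?a = "\<ominus> (inv (lead_coeff q) \<otimes> (const_term q))"
    obtain u v where uv: "u \<in> carrier F" "u \<noteq> \<zero>" "v \<in> carrier F" "q = [u, v]"
      by (rule degree_oneE[OF q(1,4)])
    then have "u \<in> Units F" by (simp add: field_Units)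
    then have a: "?a \<in> carrier F" using uv(1,3) by (simp add: uv(4) const_term_def)
    interpret v: ring_hom_cring K F "\<lambda>p. eval p ?a" by (rule eval_hom[OF a])
    have "eval q ?a = \<zero>" by (rule degree_one_root[OF carrier_is_subfield q(1,4)])
    then have "eval P ?a = \<zero>" unfolding q(3) using q(1,2) by simp
    then show False using no_root[OF a] by blast
  qed
  have irr: "pirreducible (carrier F) P"
  proof (rule pirreducibleI[OF carrier_is_subring Pc P0])
    show "P \<notin> Units K" using univ_poly_units'[OF carrier_is_subfield, of P] len by simp
    fix q r assume qr: "q \<in> carrier K" "r \<in> carrier K" "P = q \<otimes>\<^bsub>K\<^esub> r"
    have q0: "q \<noteq> \<zero>\<^bsub>K\<^esub>" "r \<noteq> \<zero>\<^bsub>K\<^esub>" using qr P0 unfolding K_zero[symmetric] by auto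
    have "length q + length r = 4" using length_mult[OF qr(1,2) q0] len qr(3) by simp
    moreover have "length q \<ge> 1" "length r \<ge> 1" using q0 unfolding K_zero by (cases q; cases r; simp)+
    ultimately consider "length q = 1" | "length q = 2" | "length r = 1" by linarith
    then show "q \<in> Units K \<or> r \<in> Units K"
    proof cases
      case 2
      then show ?thesis using linear_dvd[OF qr] by simp
    qed (use univ_poly_units'[OF carrier_is_subfield] qr q0 in \<open>auto simp: K_zero\<close>)
  qed
  have short: "\<not> P divides\<^bsub>K\<^esub> f" if f: "length f = 2" for f
    using divides_short_imp_zero[of P f] Pc len f unfolding K_zero by auto
  have lT: "length T = 2" by (simp add: var_def)
  have lc: "length c = 2" unfolding c_def by (subst length_minus_eq[OF T_closed K.one_closed]) (simp_all add: var_def univ_poly_one)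
  have "T \<otimes>\<^bsub>K\<^esub> T \<oplus>\<^bsub>K\<^esub> (T \<ominus>\<^bsub>K\<^esub> \<one>\<^bsub>K\<^esub>) \<otimes>\<^bsub>K\<^esub> (T \<ominus>\<^bsub>K\<^esub> \<one>\<^bsub>K\<^esub>) \<ominus>\<^bsub>K\<^esub> (T \<ominus>\<^bsub>K\<^esub> \<one>\<^bsub>K\<^esub>)
      = P \<otimes>\<^bsub>K\<^esub> (\<one>\<^bsub>K\<^esub> \<oplus>\<^bsub>K\<^esub> \<one>\<^bsub>K\<^esub>)"
    unfolding P by (rule K.char3_splitting[OF threeK T_closed])
  then have sp: "P divides\<^bsub>K\<^esub> (T \<otimes>\<^bsub>K\<^esub> T \<oplus>\<^bsub>K\<^esub> c \<otimes>\<^bsub>K\<^esub> c \<ominus>\<^bsub>K\<^esub> c)"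
    unfolding c_def by (rule dividesI[rotated]) simp
  show "prime_power_modulus F P p e N"
    by (intro prime_power_modulus.intro prime_power_modulus_axioms.intro finite_field_3_mod_4_axioms Pc irr p N
        short lT lc bexI[of _ T] bexI[of _ c] sp T_closed c_closed)
qed

lemma not_bipartite_instance_quadratic:
  assumes p: "Factorial_Ring.prime (p::nat)" "add_pow F p \<one> = \<zero>" "odd p" and N: "p ^ e + 1 = 2 * N"
    and three: "\<one> \<oplus> \<one> \<oplus> \<one> = \<zero>"
    and P: "P = T \<otimes>\<^bsub>K\<^esub> T \<oplus>\<^bsub>K\<^esub> \<one>\<^bsub>K\<^esub>"
  defines "g \<equiv> P [^]\<^bsub>K\<^esub> N"
  shows "morgenstern_modulus F g \<and> \<not> bipartite (morgenstern_graph F (\<ominus> \<one>) g) \<and>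
    ereal (4 / 3 * log (real (card (carrier F))) (real (card (fst (morgenstern_graph F (\<ominus> \<one>) g)))) - 10)
      \<le> ereal_of_enat (graph_diam (morgenstern_graph F (\<ominus> \<one>) g))"
proof -
  note Q = quadratic_modulus[OF three p(1,2) N P]
  interpret M: prime_power_modulus F P p e N by (rule Q(1))
  have deg: "degree P = 2" using Q(2) by simp
  have PQ: "P [^]\<^bsub>K\<^esub> (p ^ e) = T [^]\<^bsub>K\<^esub> (p ^ e) \<otimes>\<^bsub>K\<^esub> T [^]\<^bsub>K\<^esub> (p ^ e) \<oplus>\<^bsub>K\<^esub> \<one>\<^bsub>K\<^esub>"
    unfolding P by (subst K.frobenius_add[OF p(1) add_pow_K[OF p(2)]]) (simp_all add: K.nat_pow_distrib)
  have "\<not> bipartite (morgenstern_graph F (\<ominus> \<one>) g)"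
    unfolding g_def
  proof (rule M.not_bipartite_graph)
    have "snd ((\<one>\<^bsub>K\<^esub>, \<one>\<^bsub>K\<^esub>) [^]\<^bsub>quad_ring K (\<ominus>\<^bsub>K\<^esub> c)\<^esub> (5::nat)) = P"
      unfolding P c_def by (rule K.quad_ring_pow5_char3[OF Q(3) T_closed])
    then show "P divides\<^bsub>K\<^esub> snd ((\<one>\<^bsub>K\<^esub>, \<one>\<^bsub>K\<^esub>) [^]\<^bsub>quad_ring K (\<ominus>\<^bsub>K\<^esub> c)\<^esub> (5::nat))"
      using K.divides_refl[OF M.P_closed] by (simp only:)
  qed (use p in simp_all)
  moreover have "enat (4 * (N * degree P) - 8) \<le> graph_diam (morgenstern_graph F (\<ominus> \<one>) g)"
    unfolding g_def
  proof (rule M.diam_ge_if_odd_no_approx)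
    fix k :: nat and x assume k: "2 * k + 1 < 4 * (N * degree P) - 8" and x: "x \<in> carrier K" "length x \<le> k + 1"
      and dvd: "(P [^]\<^bsub>K\<^esub> (p ^ e + 1)) divides\<^bsub>K\<^esub> (x \<otimes>\<^bsub>K\<^esub> x \<ominus>\<^bsub>K\<^esub> T [^]\<^bsub>K\<^esub> (2 * k + 1))"
    have "k < 2 * p ^ e" using k N unfolding deg by linarith
    then show False by (rule M.odd_no_approx_quadratic[OF deg Q(3) PQ x dvd])
  qed
  ultimately show ?thesis using M.diam_bound M.morgenstern_modulus_g unfolding g_def by blast
qed

text \<open>Oddness of \<open>p\<close> makes every exponent \<open>e\<close> admissible, and the
  degrees of \<open>P ^ N\<close> distinguish the resulting moduli.\<close>

lemma infinite_powers:
  assumes p: "Factorial_Ring.prime (p::nat)" "odd p" and P: "P \<in> carrier K" "degree P \<ge> 1"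
    and pow: "\<And>e N. p ^ e + 1 = 2 * N \<Longrightarrow> Prp (P [^]\<^bsub>K\<^esub> N)"
  shows "infinite {g. Prp g}"
proof -
  define N where "N e = (p ^ e + 1) div 2" for e
  have N: "p ^ e + 1 = 2 * N e" for e using p(2) by (simp add: N_def)
  have "inj (\<lambda>e. P [^]\<^bsub>K\<^esub> N e)"
  proof (rule injI)
    fix e f assume "P [^]\<^bsub>K\<^esub> N e = P [^]\<^bsub>K\<^esub> N f"
    then have "N e * degree P = N f * degree P"
      using polynomial_pow_degree[OF P(1), of "N e"] polynomial_pow_degree[OF P(1), of "N f"] by simp
    then have "N e = N f" using P(2) mult_cancel2[of "N e" "degree P" "N f"] by linarith
    then have "p ^ e = p ^ f" using N[of e] N[of f] by linarith
    then show "e = f" using prime_gt_1_nat[OF p(1)] by simp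
  qed
  then have "infinite (range (\<lambda>e. P [^]\<^bsub>K\<^esub> N e))" by (rule range_inj_infinite)
  moreover have "range (\<lambda>e. P [^]\<^bsub>K\<^esub> N e) \<subseteq> {g. Prp g}" using pow N by auto
  ultimately show ?thesis using infinite_super by blast
qed

lemma infinite_moduli:
  "infinite {g. morgenstern_modulus F g \<and> \<not> bipartite (morgenstern_graph F (\<ominus> \<one>) g) \<and>
    ereal (4 / 3 * log (real (card (carrier F))) (real (card (fst (morgenstern_graph F (\<ominus> \<one>) g)))) - 10)
      \<le> ereal_of_enat (graph_diam (morgenstern_graph F (\<ominus> \<one>) g))}" (is "infinite {g. ?nb g}")
  "infinite {g. morgenstern_modulus F g \<and> bipartite (morgenstern_graph F (\<ominus> \<one>) g) \<and>
    ereal (4 / 3 * log (real (card (carrier F))) (real (card (fst (morgenstern_graph F (\<ominus> \<one>) g)))) - 10)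
      \<le> ereal_of_enat (graph_diam (morgenstern_graph F (\<ominus> \<one>) g))}"
proof -
  obtain p k where p: "Factorial_Ring.prime p" "k > 0" "card (carrier F) = p ^ k" "add_pow F p \<one> = \<zero>"
    by (rule primepow_card_char[OF card_pp fin])
  have "odd (p ^ k)" using card_mod unfolding p(3) by presburger
  then have odd: "odd p" using p(2) by simp
  have deg: "degree (T \<ominus>\<^bsub>K\<^esub> pconst F a) \<ge> 1" if "a \<in> carrier F" for a
    unfolding monic_linear[OF that] by simp
  show "infinite {g. morgenstern_modulus F g \<and> bipartite (morgenstern_graph F (\<ominus> \<one>) g) \<and>
    ereal (4 / 3 * log (real (card (carrier F))) (real (card (fst (morgenstern_graph F (\<ominus> \<one>) g)))) - 10)
      \<le> ereal_of_enat (graph_diam (morgenstern_graph F (\<ominus> \<one>) g))}"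
    by (rule infinite_powers[OF p(1) odd _ deg[of "\<ominus> \<one>"]]) (simp, simp, rule bipartite_instance[OF p(1,4) _ refl], assumption)
  show "infinite {g. ?nb g}"
  proof (cases "\<one> \<oplus> \<one> \<oplus> \<one> = \<zero>")
    case True
    let ?P = "T \<otimes>\<^bsub>K\<^esub> T \<oplus>\<^bsub>K\<^esub> \<one>\<^bsub>K\<^esub>"
    \<comment> \<open>The degree of \<open>?P\<close> does not depend on the exponent;
      \<open>e = 0\<close> and \<open>N = 1\<close> only serve to instantiate the lemma.\<close>
    have "p ^ 0 + 1 = 2 * (1::nat)" by simp
    from quadratic_modulus(2)[OF True p(1,4) this refl] have "degree ?P \<ge> 1" by simp
    then show ?thesis
      by (intro infinite_powers[OF p(1) odd, of ?P ?nb] not_bipartite_instance_quadratic[OF p(1,4) odd _ True refl]) simp_all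
  next
    case False
    have cl: "(\<one> \<oplus> \<one>) \<otimes> (\<one> \<oplus> \<one>) \<in> carrier F" by simp
    show ?thesis
      by (rule infinite_powers[OF p(1) odd _ deg[OF cl]]) (simp, rule not_bipartite_instance_linear[OF p(1,4) odd _ False refl], assumption)
  qed
qed

end

theorem theorem1p9:
  shows "\<exists>C::real. \<forall>q::nat. primepow q \<and> q mod 4 = 3 \<longrightarrow>
    (\<forall>F :: nat ring. field F \<and> card (carrier F) = q \<longrightarrow>
      (let \<Gamma> = morgenstern_graph F (\<ominus>\<^bsub>F\<^esub> \<one>\<^bsub>F\<^esub>) in
        infinite {g. morgenstern_modulus F g \<and> \<not> bipartite (\<Gamma> g) \<and>
          ereal_of_enat (graph_diam (\<Gamma> g))
            \<ge> ereal (4 / 3 * log (real q) (real (card (fst (\<Gamma> g)))) - C)} \<and>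
        infinite {g. morgenstern_modulus F g \<and> bipartite (\<Gamma> g) \<and>
          ereal_of_enat (graph_diam (\<Gamma> g))
            \<ge> ereal (4 / 3 * log (real q) (real (card (fst (\<Gamma> g)))) - C)}))"
proof (intro exI[of _ 10] allI impI)
  fix q :: nat and F :: "nat ring"
  assume q: "primepow q \<and> q mod 4 = 3" and F: "field F \<and> card (carrier F) = q"
  \<comment> \<open>An infinite carrier would have \<open>card\<close> equal to 0, which is not 3
    modulo 4.\<close>
  have "finite (carrier F)" using q F by (intro card_ge_0_finite) (auto intro: Nat.gr0I)
  then have "finite_field_3_mod_4 F"
    using q F by (intro finite_field_3_mod_4.intro finite_field_3_mod_4_axioms.intro) auto
  from finite_field_3_mod_4.infinite_moduli[OF this] F
  show "let \<Gamma> = morgenstern_graph F (\<ominus>\<^bsub>F\<^esub> \<one>\<^bsub>F\<^esub>) in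
        infinite {g. morgenstern_modulus F g \<and> \<not> bipartite (\<Gamma> g) \<and>
          ereal_of_enat (graph_diam (\<Gamma> g))
            \<ge> ereal (4 / 3 * log (real q) (real (card (fst (\<Gamma> g)))) - 10)} \<and>
        infinite {g. morgenstern_modulus F g \<and> bipartite (\<Gamma> g) \<and>
          ereal_of_enat (graph_diam (\<Gamma> g))
            \<ge> ereal (4 / 3 * log (real q) (real (card (fst (\<Gamma> g)))) - 10)}"
    unfolding Let_def by simp
qed

end
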